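(* Let $p,q\colon[0,\infty)\to\mathbb{R}$ be smooth functions with $p(x)>0$ for all $x$, and suppose that $p(x)=1$ and $q(x)=0$ for all sufficiently large $x$. Let $D=-\frac{d}{dx}\,p(x)\,\frac{d}{dx}+q(x)$. For each $\lambda\in\mathbb{R}$ let $F_\lambda\colon[0,\infty)\to\mathbb{R}$ be a nonzero real-valued solution of $DF_\lambda=\lambda F_\lambda$ with $F_\lambda(0)=0$ (unique up to a nonzero real scalar), and for $\lambda>0$ let $c(\lambda)\in\mathbb{C}$ be the nonzero number such that $$F_\lambda(x)=c(\lambda)e^{i\sqrt{\lambda}\,x}+\overline{c(\lambda)}\,e^{-i\sqrt{\lambda}\,x}$$ for all sufficiently large $x$. Then the set $\Sigma$ of those $\lambda<0$ for which $F_\lambda\in L^2(0,\infty)$ is finite, and for all smooth compactly supported functions $g,h\colon(0,\infty)\to\mathbb{C}$, $$\langle g,h\rangle=\sum_{\lambda\in\Sigma}\frac{\langle g,F_\lambda\rangle\,\langle F_\lambda,h\rangle}{\langle F_\lambda,F_\lambda\rangle}+\frac{1}{4\pi}\int_0^\infty\frac{\langle g,F_\lambda\rangle\,\langle F_\lambda,h\rangle}{|c(\lambda)|^2}\,\frac{d\lambda}{\sqrt{\lambda}},$$ where the integral is absolutely convergent.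
   Context: All inner products have the standard $L^2$-form on $(0,\infty)$, conjugate-linear in the first variable: $\langle u,v\rangle=\int_0^\infty\overline{u(x)}\,v(x)\,dx$ (for $\langle g,F_\lambda\rangle$ and $\langle F_\lambda,h\rangle$ this makes sense because $g,h$ have compact support). The summands and the integrand do not depend on the choice of the real scalar normalization of $F_\lambda$. *)

theory Defs
  imports "HOL-Analysis.Analysis"
begin

text \<open>
  All functions on the half-line are total functions on the reals whose values outside the
  half-line are irrelevant.  Derivatives are taken within the domain, so that at the end point
  of \<open>[0,\<infinity>)\<close> they are one-sided; for an open domain they are ordinary derivatives.
\<close>

definition smooth_within :: "real set \<Rightarrow> (real \<Rightarrow> 'a::real_normed_vector) \<Rightarrow> bool" where
  "smooth_within S f \<longleftrightarrow>
     (\<exists>d. (\<forall>x\<in>S. d 0 x = f x) \<and>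
          (\<forall>n::nat. \<forall>x\<in>S. (d n has_vector_derivative d (Suc n) x) (at x within S)))"

definition compact_support_in :: "real set \<Rightarrow> (real \<Rightarrow> 'a::real_normed_vector) \<Rightarrow> bool" where
  "compact_support_in S f \<longleftrightarrow> compact (top_of_set S closure_of support_on S f)"

definition half_line_deriv :: "(real \<Rightarrow> real) \<Rightarrow> real \<Rightarrow> real" where
  "half_line_deriv u x = vector_derivative u (at x within {0..})"

definition sturm_liouville ::
    "(real \<Rightarrow> real) \<Rightarrow> (real \<Rightarrow> real) \<Rightarrow> (real \<Rightarrow> real) \<Rightarrow> real \<Rightarrow> real" where
  "sturm_liouville p q u x = - half_line_deriv (\<lambda>t. p t * half_line_deriv u t) x + q x * u x"

text \<open>
  The differentiability conditions are needed because \<^const>\<open>vector_derivative\<close> is total and has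
  an unspecified value where the derivative does not exist.
\<close>

definition sl_solution ::
    "(real \<Rightarrow> real) \<Rightarrow> (real \<Rightarrow> real) \<Rightarrow> real \<Rightarrow> (real \<Rightarrow> real) \<Rightarrow> bool" where
  "sl_solution p q l u \<longleftrightarrow>
     u differentiable_on {0..} \<and>
     (\<lambda>t. p t * half_line_deriv u t) differentiable_on {0..} \<and>
     (\<forall>x\<ge>0. sturm_liouville p q u x = l * u x)"

definition square_integrable :: "(real \<Rightarrow> 'a::euclidean_space) \<Rightarrow> bool" where
  "square_integrable u \<longleftrightarrow>
     set_borel_measurable lborel {0<..} u \<and>
     set_integrable lborel {0<..} (\<lambda>x. (norm (u x))\<^sup>2)"

definition l2_inner :: "(real \<Rightarrow> complex) \<Rightarrow> (real \<Rightarrow> complex) \<Rightarrow> complex" where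
  "l2_inner u v = (LBINT x:{0<..}. cnj (u x) * v x)"

end

theory Submission
  imports Defs "HOL-Complex_Analysis.Complex_Analysis"
begin

text \<open>
  The expansion comes from integrating the resolvent of \<open>D\<close> around a large half disc in the plane of
  the momentum \<open>k\<close>, where \<open>k\<^sup>2 = l\<close> is the spectral parameter.

  Choose \<open>R\<close> such that \<open>p = 1\<close> and \<open>q = 0\<close> beyond \<open>R\<close> and \<open>g\<close>, \<open>h\<close> vanish there.  On \<open>[0,R]\<close> the
  equation \<open>D u - l u = f\<close> is a first-order system for \<open>u\<close> and its quasi-derivative \<open>v = p u'\<close>, and its
  solutions with fixed initial data are entire in \<open>l\<close> (\<open>system_sol\<close>, \<open>sol_holomorphic\<close>).  Let
  \<open>phi l\<close> be the solution of the homogeneous system with data \<open>(0,1)\<close>; the given \<open>F l\<close> is a nonzero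
  multiple of it.  For \<open>Im k > 0\<close> the function \<open>u = (D - k\<^sup>2)\<^sup>-\<^sup>1 h\<close> is the solution with \<open>u(0) = 0\<close> that
  continues beyond \<open>R\<close> as a multiple of \<open>exp (i k x)\<close>, that is, with \<open>u'(R) = i k u(R)\<close>.  Adding to the
  solution with zero initial data the right multiple of \<open>phi\<close> shows that \<open>\<langle>g, (D - k\<^sup>2)\<^sup>-\<^sup>1 h\<rangle>\<close> is a
  quotient of entire functions of \<open>k\<close> with denominator \<open>jost k = phi'(R) - i k phi(R)\<close>; call it
  \<open>resolvent k\<close>.

  Integrate \<open>2 k resolvent k\<close> over the boundary of the upper half disc of radius \<open>A\<close>.  On the real axis
  the values at \<open>k\<close> and \<open>- k\<close> combine to \<open>4 i k\<^sup>2 \<langle>g, phi\<rangle> \<langle>phi, h\<rangle> / |jost k|\<^sup>2\<close>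
  (\<open>resolvent_jump\<close>), and \<open>|jost k|\<^sup>2 = phi'(R)\<^sup>2 + k\<^sup>2 phi(R)\<^sup>2\<close> equals \<open>4 k\<^sup>2 |c|\<^sup>2\<close> for the
  amplitude \<open>c\<close> of \<open>phi\<close> (\<open>amplitude\<close>): this is the continuous part.  The zeros of
  \<open>jost\<close> in the open upper half plane are the points \<open>i \<kappa>\<close> for which \<open>F (- \<kappa>\<^sup>2)\<close> decays, there are
  finitely many of them, and the residues are, up to sign, the terms of the finite sum (\<open>residue_at_eigenvalue\<close>).
  A zero of \<open>jost\<close> at \<open>0\<close> is simple and cancels against the factor \<open>2 k\<close>.  On the arc,
  \<open>k\<^sup>2 resolvent k\<close> is \<open>- \<langle>g, h\<rangle>\<close> up to \<open>\<langle>g, (D - k\<^sup>2)\<^sup>-\<^sup>1 D h\<rangle>\<close>.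

  That last term is bounded only by a constant times \<open>1 / |Im k\<^sup>2|\<close>, which is useless where the arc meets
  the real and the imaginary axis.  This is repaired by a weight: with the extra factor \<open>1 - k\<^sup>4 / A\<^sup>4\<close>, whose modulus on the arc is exactly
  \<open>2 |Im k\<^sup>2| / A\<^sup>2\<close>, the singular factor cancels and the error of the weighted identity is
  \<open>O(1 / A\<^sup>2)\<close> (\<open>contour_identity\<close>).  The weight increases to \<open>1\<close> as \<open>A\<close> grows.  For \<open>g = h\<close> the density is
  nonnegative, so monotone convergence makes it integrable; in general it is dominated by the densities
  of the pairs \<open>(g, g)\<close> and \<open>(h, h)\<close>, and dominated convergence removes the weight
  (\<open>expansion_in_momentum\<close>).  The substitution \<open>l = k\<^sup>2\<close> then gives the integral over the spectrum.
\<close>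

section \<open>Solutions and their analytic dependence on the spectral parameter\<close>

locale sl_interval =
  fixes p q :: "real \<Rightarrow> real" and R :: real
  assumes R_pos: "R > 0"
    and p_cont: "continuous_on {0..R} p"
    and q_cont: "continuous_on {0..R} q"
    and p_pos: "\<And>x. x \<in> {0..R} \<Longrightarrow> p x > 0"
begin

text \<open>
  The equation \<open>- (p u')' + q u - l u = f\<close> for \<open>u\<close> and \<open>v = p u'\<close>.  Keeping \<open>v\<close> as an unknown of its
  own means that \<open>p\<close> is never differentiated.
\<close>

definition system ::
    "complex \<Rightarrow> (real \<Rightarrow> complex) \<Rightarrow> (real \<Rightarrow> complex) \<Rightarrow> (real \<Rightarrow> complex) \<Rightarrow> bool" where
  "system l f u v \<longleftrightarrow> (\<forall>x\<in>{0..R}.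
     (u has_vector_derivative v x / complex_of_real (p x)) (at x within {0..R}) \<and>
     (v has_vector_derivative (complex_of_real (q x) - l) * u x - f x) (at x within {0..R}))"

text \<open>
  The terms of the Picard series are polynomials in \<open>l\<close> with continuous coefficients.  In this class,
  analyticity in \<open>l\<close>, both at a point and after integration against a continuous function, is evident,
  so that for the sum of the series only uniform convergence is left to prove.
\<close>

definition poly_family :: "(complex \<Rightarrow> real \<Rightarrow> complex) \<Rightarrow> bool" where
  "poly_family d \<longleftrightarrow> (\<exists>N c. (\<forall>j. continuous_on {0..R} (c j)) \<and>
     (\<forall>l. \<forall>x\<in>{0..R}. d l x = (\<Sum>j<N. c j x * l ^ j)))"

lemma poly_family_const:
  assumes "continuous_on {0..R} f"
  shows "poly_family (\<lambda>l. f)"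
  unfolding poly_family_def
  by (rule exI[of _ 1], rule exI[of _ "\<lambda>_. f"]) (use assms in simp)

lemma poly_family_mult_param:
  assumes "poly_family d"
  shows "poly_family (\<lambda>l x. l * d l x)"
proof -
  obtain N c where c: "\<And>j. continuous_on {0..R} (c j)"
      "\<And>l x. x \<in> {0..R} \<Longrightarrow> d l x = (\<Sum>j<N. c j x * l ^ j)"
    using assms unfolding poly_family_def by blast
  show ?thesis
    unfolding poly_family_def
  proof (intro exI conjI allI ballI)
    fix j show "continuous_on {0..R} (\<lambda>x. case j of 0 \<Rightarrow> 0 | Suc i \<Rightarrow> c i x)"
      using c(1) by (cases j) auto
  next
    fix l x assume "x \<in> {0..R}"
    then show "l * d l x = (\<Sum>j<Suc N. (case j of 0 \<Rightarrow> 0 | Suc i \<Rightarrow> c i x) * l ^ j)"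
      by (simp only: c(2) sum.lessThan_Suc_shift) (simp add: sum_distrib_left mult_ac)
  qed
qed

lemma poly_family_diff:
  assumes "poly_family d" "poly_family e"
  shows "poly_family (\<lambda>l x. d l x - e l x)"
proof -
  obtain N c where c: "\<And>j. continuous_on {0..R} (c j)"
      "\<And>l x. x \<in> {0..R} \<Longrightarrow> d l x = (\<Sum>j<N. c j x * l ^ j)"
    using assms(1) unfolding poly_family_def by blast
  obtain N' c' where c': "\<And>j. continuous_on {0..R} (c' j)"
      "\<And>l x. x \<in> {0..R} \<Longrightarrow> e l x = (\<Sum>j<N'. c' j x * l ^ j)"
    using assms(2) unfolding poly_family_def by blast
  define C where "C j x = (if j < N then c j x else 0) - (if j < N' then c' j x else 0)" for j x
  show ?thesis
    unfolding poly_family_def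
  proof (intro exI conjI allI ballI)
    fix j show "continuous_on {0..R} (C j)"
      unfolding C_def using c(1)[of j] c'(1)[of j]
      by (cases "j < N"; cases "j < N'") (simp_all add: continuous_on_diff continuous_on_minus)
  next
    fix l x assume x: "x \<in> {0..R}"
    have "d l x = (\<Sum>j<max N N'. (if j < N then c j x else 0) * l ^ j)"
      unfolding c(2)[OF x] by (rule sum.mono_neutral_cong_left) auto
    moreover have "e l x = (\<Sum>j<max N N'. (if j < N' then c' j x else 0) * l ^ j)"
      unfolding c'(2)[OF x] by (rule sum.mono_neutral_cong_left) auto
    ultimately show "d l x - e l x = (\<Sum>j<max N N'. C j x * l ^ j)"
      unfolding C_def by (simp add: sum_subtractf left_diff_distrib)
  qed
qed

lemma poly_family_mult:
  assumes "poly_family d" "continuous_on {0..R} f"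
  shows "poly_family (\<lambda>l x. f x * d l x)"
proof -
  obtain N c where c: "\<And>j. continuous_on {0..R} (c j)"
      "\<And>l x. x \<in> {0..R} \<Longrightarrow> d l x = (\<Sum>j<N. c j x * l ^ j)"
    using assms unfolding poly_family_def by blast
  show ?thesis
    unfolding poly_family_def
    by (rule exI[of _ N], rule exI[of _ "\<lambda>j x. f x * c j x"])
       (use c assms(2) in \<open>auto intro!: continuous_intros simp: sum_distrib_left mult_ac\<close>)
qed

lemma poly_family_integral:
  assumes "poly_family d"
  shows "poly_family (\<lambda>l x. integral {0..x} (d l))"
proof -
  obtain N c where c: "\<And>j. continuous_on {0..R} (c j)"
      "\<And>l x. x \<in> {0..R} \<Longrightarrow> d l x = (\<Sum>j<N. c j x * l ^ j)"
    using assms unfolding poly_family_def by blast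
  show ?thesis
    unfolding poly_family_def
  proof (intro exI conjI allI ballI)
    fix j show "continuous_on {0..R} (\<lambda>x. integral {0..x} (c j))"
      by (intro indefinite_integral_continuous_1 integrable_continuous_real c)
  next
    fix l x assume x: "x \<in> {0..R}"
    have c_int: "c j integrable_on {0..x}" for j
      by (rule integrable_continuous_real, rule continuous_on_subset[OF c(1)]) (use x in auto)
    have "integral {0..x} (d l) = integral {0..x} (\<lambda>t. \<Sum>j<N. c j t * l ^ j)"
      by (rule integral_cong) (use x c(2) in auto)
    also have "\<dots> = (\<Sum>j<N. integral {0..x} (\<lambda>t. c j t * l ^ j))"
      by (rule integral_sum) (auto intro: integrable_on_mult_left c_int)
    also have "\<dots> = (\<Sum>j<N. integral {0..x} (c j) * l ^ j)"
      by simp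
    finally show "integral {0..x} (d l) = (\<Sum>j<N. integral {0..x} (c j) * l ^ j)" .
  qed
qed

lemma poly_family_continuous:
  assumes "poly_family d"
  shows "continuous_on {0..R} (d l)"
proof -
  obtain N c where c: "\<And>j. continuous_on {0..R} (c j)"
      "\<And>l x. x \<in> {0..R} \<Longrightarrow> d l x = (\<Sum>j<N. c j x * l ^ j)"
    using assms unfolding poly_family_def by blast
  have "continuous_on {0..R} (\<lambda>x. \<Sum>j<N. c j x * l ^ j)"
    by (intro continuous_intros c)
  then show ?thesis by (rule continuous_on_eq) (simp add: c(2))
qed

lemma poly_family_holomorphic:
  assumes "poly_family d" "x \<in> {0..R}"
  shows "(\<lambda>l. d l x) holomorphic_on UNIV"
proof -
  obtain N c where c: "\<And>l x. x \<in> {0..R} \<Longrightarrow> d l x = (\<Sum>j<N. c j x * l ^ j)"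
    using assms unfolding poly_family_def by blast
  show ?thesis unfolding c[OF assms(2)] by (intro holomorphic_intros)
qed

text \<open>
  The \<open>n\<close>-th term of the Picard series (the difference of consecutive iterates), not the iterate itself.
  The inhomogeneity enters through the zeroth term alone, because the recursion is linear.
\<close>

primrec picard :: "complex \<Rightarrow> complex \<Rightarrow> (real \<Rightarrow> complex) \<Rightarrow> nat \<Rightarrow>
    complex \<Rightarrow> real \<Rightarrow> complex \<times> complex" where
  "picard u0 v0 f 0 l x = (u0, v0 - integral {0..x} f)"
| "picard u0 v0 f (Suc n) l x =
     (integral {0..x} (\<lambda>t. snd (picard u0 v0 f n l t) / of_real (p t)),
      integral {0..x} (\<lambda>t. (of_real (q t) - l) * fst (picard u0 v0 f n l t)))"

definition sol :: "complex \<Rightarrow> complex \<Rightarrow> (real \<Rightarrow> complex) \<Rightarrow> complex \<Rightarrow> real \<Rightarrow> complex" where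
  "sol u0 v0 f l x = (\<Sum>n. fst (picard u0 v0 f n l x))"

definition quasi_sol :: "complex \<Rightarrow> complex \<Rightarrow> (real \<Rightarrow> complex) \<Rightarrow> complex \<Rightarrow> real \<Rightarrow> complex" where
  "quasi_sol u0 v0 f l x = (\<Sum>n. snd (picard u0 v0 f n l x))"

lemma inverse_p_continuous: "continuous_on {0..R} (\<lambda>t. 1 / complex_of_real (p t))"
  using p_cont p_pos by (auto intro!: continuous_intros) fastforce

lemma q_of_real_continuous: "continuous_on {0..R} (\<lambda>t. complex_of_real (q t))"
  using q_cont by (auto intro!: continuous_intros)

lemma poly_family_picard:
  assumes "continuous_on {0..R} f"
  shows "poly_family (\<lambda>l x. fst (picard u0 v0 f n l x)) \<and>
         poly_family (\<lambda>l x. snd (picard u0 v0 f n l x))"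
proof (induction n)
  case 0
  have "continuous_on {0..R} (\<lambda>x. v0 - integral {0..x} f)"
    by (intro continuous_intros indefinite_integral_continuous_1 integrable_continuous_real assms)
  then show ?case
    by (auto intro!: poly_family_const)
next
  case (Suc n)
  from poly_family_mult[OF conjunct2[OF Suc] inverse_p_continuous]
  have 1: "poly_family (\<lambda>l x. snd (picard u0 v0 f n l x) / of_real (p x))" by simp
  from poly_family_diff[OF poly_family_mult[OF conjunct1[OF Suc] q_of_real_continuous]
      poly_family_mult_param[OF conjunct1[OF Suc]]]
  have 2: "poly_family (\<lambda>l x. (of_real (q x) - l) * fst (picard u0 v0 f n l x))"
    by (simp add: left_diff_distrib)
  show ?case
    using poly_family_integral[OF 1] poly_family_integral[OF 2] by simp
qed

lemmas picard_continuous =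
  poly_family_continuous[OF conjunct1[OF poly_family_picard]]
  poly_family_continuous[OF conjunct2[OF poly_family_picard]]

text \<open>
  \<open>K\<close> bounds \<open>1 / p\<close> and \<open>q - l\<close> and \<open>M\<close> bounds the zeroth term; each further term costs a factor \<open>K\<close> and one
  integration, which produces the factorial.
\<close>

lemma picard_bound:
  fixes L :: real and u0 v0 :: complex
  assumes f: "continuous_on {0..R} f"
  obtains K M where "K \<ge> 0" "M \<ge> 0"
    "\<And>n l x. norm l \<le> L \<Longrightarrow> x \<in> {0..R} \<Longrightarrow>
       norm (fst (picard u0 v0 f n l x)) \<le> M * (K * x) ^ n / fact n \<and>
       norm (snd (picard u0 v0 f n l x)) \<le> M * (K * x) ^ n / fact n"
proof -
  have "bounded ((\<lambda>t. 1 / complex_of_real (p t)) ` {0..R})"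
    by (intro compact_imp_bounded compact_continuous_image inverse_p_continuous) auto
  then obtain K1 where K1: "\<And>x. x \<in> {0..R} \<Longrightarrow> norm (1 / complex_of_real (p x)) \<le> K1"
    unfolding bounded_iff by (simp only: ball_simps) blast
  have "bounded ((\<lambda>t. complex_of_real (q t)) ` {0..R})"
    by (intro compact_imp_bounded compact_continuous_image q_of_real_continuous) auto
  then obtain K2 where K2: "\<And>x. x \<in> {0..R} \<Longrightarrow> norm (complex_of_real (q x)) \<le> K2"
    unfolding bounded_iff by (simp only: ball_simps) blast
  have "continuous_on {0..R} (\<lambda>x. v0 - integral {0..x} f)"
    by (intro continuous_intros indefinite_integral_continuous_1 integrable_continuous_real f)
  then have "bounded ((\<lambda>x. v0 - integral {0..x} f) ` {0..R})"
    by (intro compact_imp_bounded compact_continuous_image) auto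
  then obtain M1 where M1: "\<And>x. x \<in> {0..R} \<Longrightarrow> norm (v0 - integral {0..x} f) \<le> M1"
    unfolding bounded_iff by (simp only: ball_simps) blast
  define K where "K = max 0 (max K1 (K2 + L))"
  define M where "M = max (norm u0) M1"
  have "K \<ge> 0" "M \<ge> 0" by (auto simp: K_def M_def le_max_iff_disj)
  have "norm (fst (picard u0 v0 f n l x)) \<le> M * (K * x) ^ n / fact n \<and>
        norm (snd (picard u0 v0 f n l x)) \<le> M * (K * x) ^ n / fact n"
    if l: "norm l \<le> L" and "x \<in> {0..R}" for n l x
    using \<open>x \<in> {0..R}\<close>
  proof (induction n arbitrary: x)
    case 0
    then show ?case using M1[OF 0] by (auto simp: M_def)
  next
    case (Suc n)
    have int: "((\<lambda>t. K * (M * (K * t) ^ n / fact n)) has_integral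
                M * (K * x) ^ Suc n / fact (Suc n)) {0..x}"
    proof -
      have "((\<lambda>t. K * (M * (K * t) ^ n / fact n)) has_integral
              M * (K * x) ^ Suc n / fact (Suc n) - M * (K * 0) ^ Suc n / fact (Suc n)) {0..x}"
      proof (rule fundamental_theorem_of_calculus)
        show "0 \<le> x" using Suc.prems by simp
        show "((\<lambda>x. M * (K * x) ^ Suc n / fact (Suc n)) has_vector_derivative
            K * (M * (K * t) ^ n / fact n)) (at t within {0..x})" for t
          unfolding has_real_derivative_iff_has_vector_derivative[symmetric]
          by (rule derivative_eq_intros refl | simp)+
      qed
      then show ?thesis by simp
    qed
    have sub: "{0..x} \<subseteq> {0..R}" using Suc.prems by auto
    have 1: "norm (integral {0..x} (\<lambda>t. snd (picard u0 v0 f n l t) / of_real (p t)))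
        \<le> integral {0..x} (\<lambda>t. K * (M * (K * t) ^ n / fact n))"
    proof (rule integral_norm_bound_integral)
      have "continuous_on {0..R} (\<lambda>t. snd (picard u0 v0 f n l t) * (1 / of_real (p t)))"
        by (intro continuous_intros picard_continuous inverse_p_continuous f)
      then show "(\<lambda>t. snd (picard u0 v0 f n l t) / of_real (p t)) integrable_on {0..x}"
        by (intro integrable_continuous_real continuous_on_subset[OF _ sub]) simp
      show "(\<lambda>t. K * (M * (K * t) ^ n / fact n)) integrable_on {0..x}"
        using int by blast
      fix t assume t: "t \<in> {0..x}"
      then have tR: "t \<in> {0..R}" using sub by auto
      have "norm (1 / complex_of_real (p t)) * norm (snd (picard u0 v0 f n l t)) \<le>
            K * (M * (K * t) ^ n / fact n)"
        using K1[OF tR] Suc.IH[OF tR] \<open>K \<ge> 0\<close> by (intro mult_mono) (auto simp: K_def)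
      then show "norm (snd (picard u0 v0 f n l t) / of_real (p t)) \<le> K * (M * (K * t) ^ n / fact n)"
        by (simp add: norm_divide)
    qed
    have 2: "norm (integral {0..x} (\<lambda>t. (of_real (q t) - l) * fst (picard u0 v0 f n l t)))
        \<le> integral {0..x} (\<lambda>t. K * (M * (K * t) ^ n / fact n))"
    proof (rule integral_norm_bound_integral)
      have "continuous_on {0..R} (\<lambda>t. (of_real (q t) - l) * fst (picard u0 v0 f n l t))"
        by (intro continuous_intros picard_continuous q_cont f)
      then show "(\<lambda>t. (of_real (q t) - l) * fst (picard u0 v0 f n l t)) integrable_on {0..x}"
        by (intro integrable_continuous_real continuous_on_subset[OF _ sub]) simp
      show "(\<lambda>t. K * (M * (K * t) ^ n / fact n)) integrable_on {0..x}"
        using int by blast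
      fix t assume t: "t \<in> {0..x}"
      then have tR: "t \<in> {0..R}" using sub by auto
      have "norm (of_real (q t) - l) \<le> K"
        using norm_triangle_ineq4[of "complex_of_real (q t)" l] K2[OF tR] l by (auto simp: K_def)
      then show "norm ((of_real (q t) - l) * fst (picard u0 v0 f n l t)) \<le> K * (M * (K * t) ^ n / fact n)"
        using Suc.IH[OF tR] \<open>K \<ge> 0\<close> unfolding norm_mult by (intro mult_mono) auto
    qed
    show ?case
      using 1 2 integral_unique[OF int] by simp
  qed
  with that \<open>K \<ge> 0\<close> \<open>M \<ge> 0\<close> show ?thesis by blast
qed

lemma picard_uniform:
  fixes L :: real and u0 v0 :: complex
  assumes f: "continuous_on {0..R} f"
  shows "uniform_limit (cball 0 L \<times> {0..R})
           (\<lambda>n (l,x). \<Sum>i<n. fst (picard u0 v0 f i l x)) (\<lambda>(l,x). sol u0 v0 f l x) sequentially"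
    and "uniform_limit (cball 0 L \<times> {0..R})
           (\<lambda>n (l,x). \<Sum>i<n. snd (picard u0 v0 f i l x)) (\<lambda>(l,x). quasi_sol u0 v0 f l x) sequentially"
proof -
  obtain K M where KM: "K \<ge> 0" "M \<ge> 0"
    and b: "\<And>n l x. norm l \<le> L \<Longrightarrow> x \<in> {0..R} \<Longrightarrow>
       norm (fst (picard u0 v0 f n l x)) \<le> M * (K * x) ^ n / fact n \<and>
       norm (snd (picard u0 v0 f n l x)) \<le> M * (K * x) ^ n / fact n"
    using picard_bound[OF f, where L=L and ?u0.0=u0 and ?v0.0=v0] by blast
  have mono: "M * (K * x) ^ n / fact n \<le> M * (K * R) ^ n / fact n" if "x \<in> {0..R}" for x n
    using that KM by (intro divide_right_mono mult_left_mono power_mono) auto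
  have "summable (\<lambda>n. M * ((K * R) ^ n /\<^sub>R fact n))"
    by (intro summable_mult summable_exp_generic)
  then have sm: "summable (\<lambda>n. M * (K * R) ^ n / fact n)"
    by (simp add: divide_inverse mult_ac)
  have le: "norm (fst (picard u0 v0 f n l x)) \<le> M * (K * R) ^ n / fact n"
     "norm (snd (picard u0 v0 f n l x)) \<le> M * (K * R) ^ n / fact n"
    if "norm l \<le> L" "x \<in> {0..R}" for n l x
    using b[OF that, of n] mono[OF that(2), of n] by linarith+
  show "uniform_limit (cball 0 L \<times> {0..R})
           (\<lambda>n (l,x). \<Sum>i<n. fst (picard u0 v0 f i l x)) (\<lambda>(l,x). sol u0 v0 f l x) sequentially"
    unfolding sol_def case_prod_unfold
    by (rule Weierstrass_m_test[OF _ sm]) (auto intro!: le)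
  show "uniform_limit (cball 0 L \<times> {0..R})
           (\<lambda>n (l,x). \<Sum>i<n. snd (picard u0 v0 f i l x)) (\<lambda>(l,x). quasi_sol u0 v0 f l x) sequentially"
    unfolding quasi_sol_def case_prod_unfold
    by (rule Weierstrass_m_test[OF _ sm]) (auto intro!: le)
qed

lemma uniform_limit_slice:
  assumes "uniform_limit (A \<times> B) (\<lambda>n (l,x). F n l x) (\<lambda>(l,x). G l x) sequentially"
  shows "l \<in> A \<Longrightarrow> uniform_limit B (\<lambda>n x. F n l x) (G l) sequentially"
    and "x \<in> B \<Longrightarrow> uniform_limit A (\<lambda>n l. F n l x) (\<lambda>l. G l x) sequentially"
  by (rule uniform_limitI, drule uniform_limitD[OF assms], erule eventually_mono, force)+

lemma picard_uniform_at:
  assumes f: "continuous_on {0..R} f"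
  shows "uniform_limit {0..R}
           (\<lambda>n x. \<Sum>i<n. fst (picard u0 v0 f i l x)) (sol u0 v0 f l) sequentially"
    and "uniform_limit {0..R}
           (\<lambda>n x. \<Sum>i<n. snd (picard u0 v0 f i l x)) (quasi_sol u0 v0 f l) sequentially"
  using uniform_limit_slice(1)[OF picard_uniform(1)[OF f], of l "norm l" u0 v0]
    uniform_limit_slice(1)[OF picard_uniform(2)[OF f], of l "norm l" u0 v0] by auto

lemma sol_continuous:
  assumes f: "continuous_on {0..R} f"
  shows "continuous_on {0..R} (sol u0 v0 f l)" "continuous_on {0..R} (quasi_sol u0 v0 f l)"
  by (rule uniform_limit_theorem[OF _ picard_uniform_at(1)[OF f]];
      auto intro!: always_eventually continuous_intros picard_continuous f)
     (rule uniform_limit_theorem[OF _ picard_uniform_at(2)[OF f]];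
      auto intro!: always_eventually continuous_intros picard_continuous f)

lemma picard_uniform_cmul:
  assumes g: "continuous_on {0..R} g" and f: "continuous_on {0..R} f"
  shows "uniform_limit (cball 0 L \<times> {0..R})
      (\<lambda>n (l,x). \<Sum>i<n. g x * fst (picard u0 v0 f i l x)) (\<lambda>(l,x). g x * sol u0 v0 f l x)
      sequentially"
proof -
  have "bounded (g ` {0..R})"
    by (intro compact_imp_bounded compact_continuous_image g) auto
  then obtain C where C: "C > 0" "\<And>x. x \<in> {0..R} \<Longrightarrow> norm (g x) \<le> C"
    unfolding bounded_pos by auto
  show ?thesis
  proof (rule uniform_limitI)
    fix e :: real assume "e > 0"
    then have "e / C > 0" using C by simp
    from uniform_limitD[OF picard_uniform(1)[OF f, where L=L and ?u0.0=u0 and ?v0.0=v0] this]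
    show "\<forall>\<^sub>F n in sequentially. \<forall>x\<in>cball 0 L \<times> {0..R}.
       dist (case x of (l, x) \<Rightarrow> \<Sum>i<n. g x * fst (picard u0 v0 f i l x))
            (case x of (l, x) \<Rightarrow> g x * sol u0 v0 f l x) < e"
    proof (rule eventually_mono, safe)
      fix n and l :: complex and x :: real
      assume *: "\<forall>y\<in>cball 0 L \<times> {0..R}.
         dist (case y of (l, x) \<Rightarrow> \<Sum>i<n. fst (picard u0 v0 f i l x))
            (case y of (l, x) \<Rightarrow> sol u0 v0 f l x) < e / C"
        and l: "l \<in> cball 0 L" and x: "x \<in> {0..R}"
      have "dist (\<Sum>i<n. g x * fst (picard u0 v0 f i l x)) (g x * sol u0 v0 f l x)
          = norm (g x) * dist (\<Sum>i<n. fst (picard u0 v0 f i l x)) (sol u0 v0 f l x)"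
        unfolding dist_norm sum_distrib_left[symmetric] right_diff_distrib[symmetric] norm_mult ..
      also have "\<dots> \<le> C * dist (\<Sum>i<n. fst (picard u0 v0 f i l x)) (sol u0 v0 f l x)"
        using C(2)[OF x] by (intro mult_right_mono) auto
      also have "\<dots> < C * (e / C)"
        using bspec[OF *, of "(l,x)"] l x C(1) by (intro mult_strict_left_mono) auto
      finally show "dist (\<Sum>i<n. g x * fst (picard u0 v0 f i l x)) (g x * sol u0 v0 f l x) < e"
        using C(1) by simp
    qed
  qed
qed

text \<open>
  Uniform convergence allows the recursion for the terms to be summed under the integral sign.
\<close>

lemma sol_integral_eq:
  assumes f: "continuous_on {0..R} f" and x: "x \<in> {0..R}"
  shows "sol u0 v0 f l x = u0 + integral {0..x} (\<lambda>t. quasi_sol u0 v0 f l t / of_real (p t))"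
    and "quasi_sol u0 v0 f l x = v0 + integral {0..x} (\<lambda>t. (of_real (q t) - l) * sol u0 v0 f l t - f t)"
proof -
  have sub: "{0..x} \<subseteq> {0..R}" using x by auto
  have lim_cmul: "uniform_limit {0..x} (\<lambda>n t. (\<Sum>i<n. a i t) * c t) (\<lambda>t. b t * c t) sequentially"
    if u: "uniform_limit {0..R} (\<lambda>n t. \<Sum>i<n. a i t) b sequentially"
      and c: "continuous_on {0..R} c" and bc: "continuous_on {0..R} b"
    for a :: "nat \<Rightarrow> real \<Rightarrow> complex" and b c :: "real \<Rightarrow> complex"
  proof -
    have "bounded (b ` {0..R})" "bounded (c ` {0..R})"
      by (intro compact_imp_bounded compact_continuous_image bc c; simp)+
    then have "uniform_limit {0..R} (\<lambda>n t. (\<Sum>i<n. a i t) * c t) (\<lambda>t. b t * c t) sequentially"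
      by (intro uniform_lim_mult u uniform_limit_const)
    then show ?thesis by (rule uniform_limit_on_subset[OF _ sub])
  qed
  have 1: "(\<lambda>n. integral {0..x} (\<lambda>t. (\<Sum>i<n. snd (picard u0 v0 f i l t)) * (1 / of_real (p t))))
      \<longlonglongrightarrow> integral {0..x} (\<lambda>t. quasi_sol u0 v0 f l t * (1 / of_real (p t)))"
  proof -
    obtain I J where IJ:
      "\<And>n. ((\<lambda>t. (\<Sum>i<n. snd (picard u0 v0 f i l t)) * (1 / of_real (p t))) has_integral I n) {0..x}"
      "((\<lambda>t. quasi_sol u0 v0 f l t * (1 / of_real (p t))) has_integral J) {0..x}" "I \<longlonglongrightarrow> J"
    proof (rule uniform_limit_integral[OF lim_cmul[OF picard_uniform_at(2)[OF f]
            inverse_p_continuous sol_continuous(2)[OF f]]])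
      show "continuous_on {0..x} (\<lambda>t. (\<Sum>i<n. snd (picard u0 v0 f i l t)) * (1 / of_real (p t)))" for n
        by (rule continuous_on_subset[OF _ sub])
           (intro continuous_intros picard_continuous inverse_p_continuous f)
    qed auto
    then show ?thesis by (simp only: integral_unique[OF IJ(1)] integral_unique[OF IJ(2)])
  qed
  have 2: "(\<lambda>n. integral {0..x} (\<lambda>t. (\<Sum>i<n. fst (picard u0 v0 f i l t)) * (of_real (q t) - l)))
      \<longlonglongrightarrow> integral {0..x} (\<lambda>t. sol u0 v0 f l t * (of_real (q t) - l))"
  proof -
    have ql: "continuous_on {0..R} (\<lambda>t. of_real (q t) - l)"
      by (intro continuous_intros q_of_real_continuous)
    obtain I J where IJ:
      "\<And>n. ((\<lambda>t. (\<Sum>i<n. fst (picard u0 v0 f i l t)) * (of_real (q t) - l)) has_integral I n) {0..x}"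
      "((\<lambda>t. sol u0 v0 f l t * (of_real (q t) - l)) has_integral J) {0..x}" "I \<longlonglongrightarrow> J"
    proof (rule uniform_limit_integral[OF lim_cmul[OF picard_uniform_at(1)[OF f]
            ql sol_continuous(1)[OF f]]])
      show "continuous_on {0..x} (\<lambda>t. (\<Sum>i<n. fst (picard u0 v0 f i l t)) * (of_real (q t) - l))" for n
        by (rule continuous_on_subset[OF _ sub])
           (intro continuous_intros picard_continuous q_of_real_continuous f)
    qed auto
    then show ?thesis by (simp only: integral_unique[OF IJ(1)] integral_unique[OF IJ(2)])
  qed
  \<comment> \<open>The shift of the summation index turns the recursion into an equation between partial sums.\<close>
  have S1: "(\<Sum>i<Suc n. fst (picard u0 v0 f i l x)) =
      u0 + integral {0..x} (\<lambda>t. (\<Sum>i<n. snd (picard u0 v0 f i l t)) * (1 / of_real (p t)))" for n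
  proof -
    have "integral {0..x} (\<lambda>t. (\<Sum>i<n. snd (picard u0 v0 f i l t)) * (1 / of_real (p t)))
        = integral {0..x} (\<lambda>t. \<Sum>i<n. snd (picard u0 v0 f i l t) * (1 / of_real (p t)))"
      by (simp add: sum_distrib_right sum_divide_distrib)
    also have "\<dots> = (\<Sum>i<n. integral {0..x} (\<lambda>t. snd (picard u0 v0 f i l t) * (1 / of_real (p t))))"
      by (intro integral_sum integrable_continuous_real continuous_on_subset[OF _ sub]
          continuous_intros picard_continuous inverse_p_continuous f finite_lessThan)
    finally show ?thesis by (simp only: sum.lessThan_Suc_shift) simp
  qed
  have S2: "(\<Sum>i<Suc n. snd (picard u0 v0 f i l x)) = v0 - integral {0..x} f +
      integral {0..x} (\<lambda>t. (\<Sum>i<n. fst (picard u0 v0 f i l t)) * (of_real (q t) - l))" for n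
  proof -
    have "integral {0..x} (\<lambda>t. (\<Sum>i<n. fst (picard u0 v0 f i l t)) * (of_real (q t) - l))
        = integral {0..x} (\<lambda>t. \<Sum>i<n. (of_real (q t) - l) * fst (picard u0 v0 f i l t))"
      unfolding sum_distrib_right by (simp add: mult.commute)
    also have "\<dots> = (\<Sum>i<n. integral {0..x} (\<lambda>t. (of_real (q t) - l) * fst (picard u0 v0 f i l t)))"
      by (intro integral_sum integrable_continuous_real continuous_on_subset[OF _ sub]
          continuous_intros picard_continuous q_of_real_continuous f finite_lessThan)
    finally show ?thesis by (simp only: sum.lessThan_Suc_shift) simp
  qed
  have L1: "(\<lambda>n. \<Sum>i<Suc n. fst (picard u0 v0 f i l x)) \<longlonglongrightarrow> sol u0 v0 f l x"
    by (rule LIMSEQ_Suc, rule tendsto_uniform_limitI[OF picard_uniform_at(1)[OF f] x])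
  have L2: "(\<lambda>n. \<Sum>i<Suc n. snd (picard u0 v0 f i l x)) \<longlonglongrightarrow> quasi_sol u0 v0 f l x"
    by (rule LIMSEQ_Suc, rule tendsto_uniform_limitI[OF picard_uniform_at(2)[OF f] x])
  show "sol u0 v0 f l x = u0 + integral {0..x} (\<lambda>t. quasi_sol u0 v0 f l t / of_real (p t))"
    using LIMSEQ_unique[OF L1[unfolded S1] tendsto_add[OF tendsto_const 1]] by simp
  have "quasi_sol u0 v0 f l x = v0 - integral {0..x} f + integral {0..x} (\<lambda>t. sol u0 v0 f l t * (of_real (q t) - l))"
    using LIMSEQ_unique[OF L2[unfolded S2] tendsto_add[OF tendsto_const 2]] by simp
  moreover have "integral {0..x} (\<lambda>t. (of_real (q t) - l) * sol u0 v0 f l t - f t) =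
      integral {0..x} (\<lambda>t. (of_real (q t) - l) * sol u0 v0 f l t) - integral {0..x} f"
    by (intro integral_diff integrable_continuous_real continuous_on_subset[OF _ sub]
          continuous_intros sol_continuous q_of_real_continuous f)
  ultimately show "quasi_sol u0 v0 f l x = v0 + integral {0..x} (\<lambda>t. (of_real (q t) - l) * sol u0 v0 f l t - f t)"
    by (simp add: mult.commute)
qed

lemma sol_0 [simp]: "sol u0 v0 f l 0 = u0" "quasi_sol u0 v0 f l 0 = v0" if "continuous_on {0..R} f"
  using sol_integral_eq[OF that, of 0] R_pos by auto

theorem system_sol:
  assumes f: "continuous_on {0..R} f"
  shows "system l f (sol u0 v0 f l) (quasi_sol u0 v0 f l)"
  unfolding system_def
proof (intro ballI conjI)
  fix x assume x: "x \<in> {0..R}"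
  have "continuous_on {0..R} (\<lambda>t. quasi_sol u0 v0 f l t * (1 / of_real (p t)))"
    by (intro continuous_intros sol_continuous inverse_p_continuous f)
  then have "((\<lambda>x. u0 + integral {0..x} (\<lambda>t. quasi_sol u0 v0 f l t / of_real (p t))) has_vector_derivative
      0 + quasi_sol u0 v0 f l x / of_real (p x)) (at x within {0..R})"
    by (intro has_vector_derivative_add has_vector_derivative_const
          integral_has_vector_derivative[OF _ x]) simp
  then have "((\<lambda>x. u0 + integral {0..x} (\<lambda>t. quasi_sol u0 v0 f l t / of_real (p t))) has_vector_derivative
      quasi_sol u0 v0 f l x / of_real (p x)) (at x within {0..R})" by simp
  then show "(sol u0 v0 f l has_vector_derivative quasi_sol u0 v0 f l x / of_real (p x)) (at x within {0..R})"
    by (rule has_vector_derivative_transform[OF x, rotated]) (rule sol_integral_eq(1)[OF f])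
  have "continuous_on {0..R} (\<lambda>t. (of_real (q t) - l) * sol u0 v0 f l t - f t)"
    by (intro continuous_intros sol_continuous q_of_real_continuous f)
  then have "((\<lambda>x. v0 + integral {0..x} (\<lambda>t. (of_real (q t) - l) * sol u0 v0 f l t - f t))
      has_vector_derivative 0 + ((of_real (q x) - l) * sol u0 v0 f l x - f x)) (at x within {0..R})"
    by (intro has_vector_derivative_add has_vector_derivative_const
          integral_has_vector_derivative[OF _ x]) simp
  then have "((\<lambda>x. v0 + integral {0..x} (\<lambda>t. (of_real (q t) - l) * sol u0 v0 f l t - f t))
      has_vector_derivative (of_real (q x) - l) * sol u0 v0 f l x - f x) (at x within {0..R})" by simp
  then show "(quasi_sol u0 v0 f l has_vector_derivative (of_real (q x) - l) * sol u0 v0 f l x - f x)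
      (at x within {0..R})"
    by (rule has_vector_derivative_transform[OF x, rotated]) (rule sol_integral_eq(2)[OF f])
qed

lemma holomorphic_if_uniform_on_cballs:
  assumes "\<And>n. F n holomorphic_on UNIV"
    and u: "\<And>L. uniform_limit (cball 0 L) F G sequentially"
  shows "G holomorphic_on UNIV"
proof (rule holomorphic_uniform_sequence[of UNIV F])
  fix z :: complex
  have "cball z 1 \<subseteq> cball 0 (norm z + 1)"
    using norm_triangle_sub by (auto simp: dist_norm) (smt (verit) norm_minus_commute norm_triangle_sub)
  then have "uniform_limit (cball z 1) F G sequentially"
    by (rule uniform_limit_on_subset[OF u])
  then show "\<exists>d. 0 < d \<and> cball z d \<subseteq> UNIV \<and> uniform_limit (cball z d) F G sequentially"
    by (intro exI[of _ 1]) auto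
qed (use assms in auto)

lemma sol_holomorphic:
  assumes f: "continuous_on {0..R} f" and x: "x \<in> {0..R}"
  shows "(\<lambda>l. sol u0 v0 f l x) holomorphic_on UNIV"
    and "(\<lambda>l. quasi_sol u0 v0 f l x) holomorphic_on UNIV"
proof -
  have "uniform_limit (cball 0 L) (\<lambda>n l. \<Sum>i<n. fst (picard u0 v0 f i l x))
          (\<lambda>l. sol u0 v0 f l x) sequentially" for L
    by (rule uniform_limit_slice(2)[OF picard_uniform(1)[OF f] x])
  then show "(\<lambda>l. sol u0 v0 f l x) holomorphic_on UNIV"
    by (rule holomorphic_if_uniform_on_cballs[rotated])
       (intro holomorphic_intros poly_family_holomorphic[OF conjunct1[OF poly_family_picard]] f x)
  have "uniform_limit (cball 0 L) (\<lambda>n l. \<Sum>i<n. snd (picard u0 v0 f i l x))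
          (\<lambda>l. quasi_sol u0 v0 f l x) sequentially" for L
    by (rule uniform_limit_slice(2)[OF picard_uniform(2)[OF f] x])
  then show "(\<lambda>l. quasi_sol u0 v0 f l x) holomorphic_on UNIV"
    by (rule holomorphic_if_uniform_on_cballs[rotated])
       (intro holomorphic_intros poly_family_holomorphic[OF conjunct2[OF poly_family_picard]] f x)
qed

lemma integral_sol_holomorphic:
  assumes g: "continuous_on {0..R} g" and f: "continuous_on {0..R} f"
  shows "(\<lambda>l. integral {0..R} (\<lambda>x. g x * sol u0 v0 f l x)) holomorphic_on UNIV"
proof (rule holomorphic_if_uniform_on_cballs)
  fix n
  have c: "continuous_on {0..R} (\<lambda>x. g x * fst (picard u0 v0 f i l x))" for i l
    by (intro continuous_intros g picard_continuous f)
  have "poly_family (\<lambda>l x. integral {0..x} (\<lambda>x. g x * fst (picard u0 v0 f i l x)))" for i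
    by (intro poly_family_integral poly_family_mult g conjunct1[OF poly_family_picard] f)
  then have "(\<lambda>l. integral {0..R} (\<lambda>x. g x * fst (picard u0 v0 f i l x))) holomorphic_on UNIV" for i
    by (rule poly_family_holomorphic) (use R_pos in auto)
  then have "(\<lambda>l. \<Sum>i<n. integral {0..R} (\<lambda>x. g x * fst (picard u0 v0 f i l x))) holomorphic_on UNIV"
    by (intro holomorphic_intros)
  then show "(\<lambda>l. integral {0..R} (\<lambda>x. \<Sum>i<n. g x * fst (picard u0 v0 f i l x))) holomorphic_on UNIV"
    by (subst integral_sum) (auto intro: integrable_continuous_real c)
next
  fix L
  have c1: "continuous_on {0..R} (\<lambda>x. \<Sum>i<n. g x * fst (picard u0 v0 f i l x))" for n l
    by (intro continuous_intros g picard_continuous f)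
  have c2: "continuous_on {0..R} (\<lambda>x. g x * sol u0 v0 f l x)" for l
    by (intro continuous_intros g sol_continuous f)
  show "uniform_limit (cball 0 L) (\<lambda>n l. integral {0..R} (\<lambda>x. \<Sum>i<n. g x * fst (picard u0 v0 f i l x)))
     (\<lambda>l. integral {0..R} (\<lambda>x. g x * sol u0 v0 f l x)) sequentially"
  proof (rule uniform_limitI)
    fix e :: real assume "e > 0"
    then have "e / (2 * R) > 0" using R_pos by simp
    from uniform_limitD[OF picard_uniform_cmul[OF g f, where L=L and ?u0.0=u0 and ?v0.0=v0] this]
    show "\<forall>\<^sub>F n in sequentially. \<forall>l\<in>cball 0 L.
        dist (integral {0..R} (\<lambda>x. \<Sum>i<n. g x * fst (picard u0 v0 f i l x)))
             (integral {0..R} (\<lambda>x. g x * sol u0 v0 f l x)) < e"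
    proof (rule eventually_mono, intro ballI)
      fix n and l :: complex
      assume *: "\<forall>y\<in>cball 0 L \<times> {0..R}.
           dist (case y of (l, x) \<Rightarrow> \<Sum>i<n. g x * fst (picard u0 v0 f i l x))
              (case y of (l, x) \<Rightarrow> g x * sol u0 v0 f l x) < e / (2 * R)"
        and l: "l \<in> cball 0 L"
      have "dist (integral {0..R} (\<lambda>x. \<Sum>i<n. g x * fst (picard u0 v0 f i l x)))
             (integral {0..R} (\<lambda>x. g x * sol u0 v0 f l x)) =
         norm (integral {0..R} (\<lambda>x. (\<Sum>i<n. g x * fst (picard u0 v0 f i l x)) - g x * sol u0 v0 f l x))"
        unfolding dist_norm
        by (subst integral_diff) (intro integrable_continuous_real c1 c2 refl)+
      also have "\<dots> \<le> e / (2 * R) * (R - 0)"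
      proof (rule integral_bound)
        fix x assume "x \<in> {0..R}"
        then show "norm ((\<Sum>i<n. g x * fst (picard u0 v0 f i l x)) - g x * sol u0 v0 f l x) \<le> e / (2 * R)"
          using bspec[OF *, of "(l,x)"] l by (simp add: dist_norm)
      qed (use R_pos in \<open>auto intro!: continuous_on_diff c1 c2\<close>)
      also have "\<dots> < e" using R_pos \<open>e > 0\<close> by simp
      finally show "dist (integral {0..R} (\<lambda>x. \<Sum>i<n. g x * fst (picard u0 v0 f i l x)))
             (integral {0..R} (\<lambda>x. g x * sol u0 v0 f l x)) < e" .
    qed
  qed
qed

end

section \<open>The Lagrange identity, the energy estimate and the Jost function\<close>

context sl_interval
begin

lemma system_continuous:
  assumes "system l f u v"
  shows "continuous_on {0..R} u" "continuous_on {0..R} v"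
  using assms unfolding system_def
  by (auto simp: continuous_on_eq_continuous_within intro!: has_vector_derivative_continuous)

text \<open>
  The one identity on which everything about the system rests.  With equal parameters and no
  inhomogeneity it says that Wronskians are constant, with \<open>u1 = cnj u2\<close> it is the energy estimate, with
  two different parameters it yields the derivative of the Jost function at a zero, and with
  \<open>f1 = 0\<close> it expresses \<open>\<integral> phi h\<close> by boundary values.
\<close>

lemma lagrange_identity:
  assumes 1: "system l1 f1 u1 v1" and 2: "system l2 f2 u2 v2" and X: "X \<in> {0..R}"
  shows "((\<lambda>x. (l1 - l2) * (u1 x * u2 x) - u1 x * f2 x + f1 x * u2 x) has_integral
           (u1 X * v2 X - v1 X * u2 X) - (u1 0 * v2 0 - v1 0 * u2 0)) {0..X}"
proof (rule fundamental_theorem_of_calculus)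
  show "0 \<le> X" using X by simp
  fix x assume "x \<in> {0..X}"
  then have x: "x \<in> {0..R}" using X by auto
  note d1 = 1[unfolded system_def, rule_format, OF x]
    and d2 = 2[unfolded system_def, rule_format, OF x]
  have "((\<lambda>x. u1 x * v2 x - v1 x * u2 x) has_vector_derivative
      (u1 x * ((of_real (q x) - l2) * u2 x - f2 x) + v1 x / of_real (p x) * v2 x) -
      (v1 x * (v2 x / of_real (p x)) + ((of_real (q x) - l1) * u1 x - f1 x) * u2 x))
      (at x within {0..R})"
    by (intro has_vector_derivative_diff has_vector_derivative_mult conjunct1[OF d1]
        conjunct2[OF d1] conjunct1[OF d2] conjunct2[OF d2])
  then have "((\<lambda>x. u1 x * v2 x - v1 x * u2 x) has_vector_derivative
      (l1 - l2) * (u1 x * u2 x) - u1 x * f2 x + f1 x * u2 x) (at x within {0..R})"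
    by (simp add: algebra_simps)
  then show "((\<lambda>x. u1 x * v2 x - v1 x * u2 x) has_vector_derivative
      (l1 - l2) * (u1 x * u2 x) - u1 x * f2 x + f1 x * u2 x) (at x within {0..X})"
    by (rule has_vector_derivative_within_subset) (use X in auto)
qed

lemma wronskian_constant:
  assumes "system l (\<lambda>_. 0) u1 v1" "system l (\<lambda>_. 0) u2 v2" "X \<in> {0..R}"
  shows "u1 X * v2 X - v1 X * u2 X = u1 0 * v2 0 - v1 0 * u2 0"
  using lagrange_identity[OF assms] has_integral_unique[OF _ has_integral_0] by force

lemma system_cnj:
  assumes "system l f u v"
  shows "system (cnj l) (\<lambda>x. cnj (f x)) (\<lambda>x. cnj (u x)) (\<lambda>x. cnj (v x))"
  unfolding system_def
proof (intro ballI conjI)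
  fix x assume x: "x \<in> {0..R}"
  note d = assms[unfolded system_def, rule_format, OF x]
  show "((\<lambda>x. cnj (u x)) has_vector_derivative cnj (v x) / of_real (p x)) (at x within {0..R})"
    using has_vector_derivative_cnj[OF conjunct1[OF d]] by simp
  show "((\<lambda>x. cnj (v x)) has_vector_derivative (of_real (q x) - cnj l) * cnj (u x) - cnj (f x))
      (at x within {0..R})"
    using has_vector_derivative_cnj[OF conjunct2[OF d]] by simp
qed

definition phi :: "complex \<Rightarrow> real \<Rightarrow> complex" where "phi = sol 0 1 (\<lambda>_. 0)"
definition quasi_phi :: "complex \<Rightarrow> real \<Rightarrow> complex" where "quasi_phi = quasi_sol 0 1 (\<lambda>_. 0)"

lemma system_phi: "system l (\<lambda>_. 0) (phi l) (quasi_phi l)"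
  unfolding phi_def quasi_phi_def by (rule system_sol) simp

lemma phi_0 [simp]: "phi l 0 = 0" "quasi_phi l 0 = 1"
  by (simp_all add: phi_def quasi_phi_def)

lemma phi_holomorphic [holomorphic_intros]:
  "x \<in> {0..R} \<Longrightarrow> (\<lambda>l. phi l x) holomorphic_on UNIV"
  "x \<in> {0..R} \<Longrightarrow> (\<lambda>l. quasi_phi l x) holomorphic_on UNIV"
  unfolding phi_def quasi_phi_def by (rule sol_holomorphic; simp)+

lemma phi_continuous: "continuous_on {0..R} (phi l)" "continuous_on {0..R} (quasi_phi l)"
  using system_continuous[OF system_phi] .

text \<open>
  The solution with initial data \<open>(1,0)\<close> completes \<open>phi\<close> to a fundamental system.
\<close>

lemma theta_wronskian:
  obtains th qth where "system l (\<lambda>_. 0) th qth" "th 0 = 1" "qth 0 = 0"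
    "\<And>x. x \<in> {0..R} \<Longrightarrow> phi l x * qth x - quasi_phi l x * th x = -1"
proof -
  have s: "system l (\<lambda>_. 0) (sol 1 0 (\<lambda>_. 0) l) (quasi_sol 1 0 (\<lambda>_. 0) l)"
    by (rule system_sol) simp
  show ?thesis
    by (rule that[OF s]) (use wronskian_constant[OF system_phi s] in auto)
qed

lemma phi_no_common_zero:
  assumes "x \<in> {0..R}"
  shows "phi l x \<noteq> 0 \<or> quasi_phi l x \<noteq> 0"
  by (rule theta_wronskian[of l]) (use assms in force)

text \<open>
  Cramer's rule: the Wronskians of \<open>u\<close> with both members of the fundamental system are constant, and the
  one with \<open>phi\<close> vanishes.  This also serves as the uniqueness theorem for the initial value problem.
\<close>

lemma system_eq_phi:
  assumes s: "system l (\<lambda>_. 0) u v" and u0: "u 0 = 0" and x: "x \<in> {0..R}"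
  shows "u x = v 0 * phi l x" "v x = v 0 * quasi_phi l x"
proof -
  obtain th qth where th: "system l (\<lambda>_. 0) th qth" "th 0 = 1" "qth 0 = 0"
    "\<And>x. x \<in> {0..R} \<Longrightarrow> phi l x * qth x - quasi_phi l x * th x = -1"
    using theta_wronskian[of l] by blast
  have 1: "u x * quasi_phi l x - v x * phi l x = 0"
    using wronskian_constant[OF s system_phi x] u0 by simp
  have 2: "u x * qth x - v x * th x = - v 0"
    using wronskian_constant[OF s th(1) x] u0 th by simp
  have 3: "phi l x * qth x - quasi_phi l x * th x = -1" by (rule th(4)[OF x])
  have "u x = - u x * (phi l x * qth x - quasi_phi l x * th x)" using 3 by simp
  also have "\<dots> = - phi l x * (u x * qth x - v x * th x) + th x * (u x * quasi_phi l x - v x * phi l x)"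
    by (simp add: algebra_simps)
  finally show "u x = v 0 * phi l x" using 1 2 by simp
  have "v x = - v x * (phi l x * qth x - quasi_phi l x * th x)" using 3 by simp
  also have "\<dots> = - quasi_phi l x * (u x * qth x - v x * th x) + qth x * (u x * quasi_phi l x - v x * phi l x)"
    by (simp add: algebra_simps)
  finally show "v x = v 0 * quasi_phi l x" using 1 2 by simp
qed

lemma phi_cnj:
  assumes "x \<in> {0..R}"
  shows "cnj (phi l x) = phi (cnj l) x" "cnj (quasi_phi l x) = quasi_phi (cnj l) x"
  using system_eq_phi[OF _ _ assms, of "cnj l" "\<lambda>x. cnj (phi l x)" "\<lambda>x. cnj (quasi_phi l x)"]
    system_cnj[OF system_phi, of l] by simp_all

lemma phi_real:
  assumes "x \<in> {0..R}"
  shows "of_real (Re (phi (of_real r) x)) = phi (of_real r) x"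
    "of_real (Re (quasi_phi (of_real r) x)) = quasi_phi (of_real r) x"
  using phi_cnj[OF assms, of "of_real r"] by (simp_all add: complex_eq_iff)

lemma R_in: "R \<in> {0..R}" using R_pos by simp

text \<open>
  For a solution with the outgoing condition \<open>v(R) = i k u(R)\<close>, take the imaginary part of \<open>\<langle>u, f\<rangle>\<close> after
  an integration by parts.  The boundary term is \<open>Re k |u(R)|\<^sup>2\<close> up to sign, and since
  \<open>Im k\<^sup>2 = 2 Re k Im k\<close> with \<open>Im k > 0\<close> it has the same sign as the volume term: both
  contributions add up instead of cancelling.
\<close>

lemma energy_estimate:
  assumes s: "system l f u v" and f: "continuous_on {0..R} f"
    and u0: "u 0 = 0" and uR: "v R = \<i> * k * u R" and l: "l = k\<^sup>2"
    and k: "Im k > 0" "Re k \<noteq> 0"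
  shows "\<bar>Im l\<bar> * integral {0..R} (\<lambda>x. (norm (u x))\<^sup>2) + \<bar>Re k\<bar> * (norm (u R))\<^sup>2
           \<le> integral {0..R} (\<lambda>x. norm (f x) * norm (u x))"
proof -
  note cu = system_continuous(1)[OF s]
  let ?U = "integral {0..R} (\<lambda>x. (norm (u x))\<^sup>2)"
  have "((\<lambda>x. (cnj l - l) * (cnj (u x) * u x) - cnj (u x) * f x + cnj (f x) * u x) has_integral
           (cnj (u R) * v R - cnj (v R) * u R)) {0..R}"
    using lagrange_identity[OF system_cnj[OF s] s R_in] u0 by simp
  then have "((\<lambda>x. Im ((cnj l - l) * (cnj (u x) * u x) - cnj (u x) * f x + cnj (f x) * u x))
      has_integral Im (cnj (u R) * v R - cnj (v R) * u R)) {0..R}"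
    by (rule has_integral_linear[OF _ bounded_linear_Im, unfolded o_def])
  moreover have "Im ((cnj l - l) * (cnj (u x) * u x) - cnj (u x) * f x + cnj (f x) * u x) =
      - 2 * (Im l * (norm (u x))\<^sup>2) + 2 * Im (cnj (f x) * u x)" for x
  proof -
    have 1: "cnj (u x) * u x = of_real ((norm (u x))\<^sup>2)"
      by (simp only: complex_norm_square mult.commute)
    have 2: "cnj (u x) * f x = cnj (cnj (f x) * u x)" by simp
    have "Im ((cnj l - l) * of_real r - cnj w + w) = - 2 * (Im l * r) + 2 * Im w" for r w by simp
    then show ?thesis unfolding 1 2 .
  qed
  moreover have "Im (cnj (u R) * v R - cnj (v R) * u R) = 2 * (Re k * (norm (u R))\<^sup>2)"
    unfolding uR cmod_power2 by (simp add: algebra_simps power2_eq_square)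
  ultimately have 1: "((\<lambda>x. - 2 * (Im l * (norm (u x))\<^sup>2) + 2 * Im (cnj (f x) * u x))
      has_integral 2 * (Re k * (norm (u R))\<^sup>2)) {0..R}"
    by (simp only:)
  have 2: "((\<lambda>x. (norm (u x))\<^sup>2) has_integral ?U) {0..R}"
    by (intro integrable_integral integrable_continuous_real continuous_intros cu)
  have "((\<lambda>x. 2 * Im (cnj (f x) * u x)) has_integral
      2 * (Re k * (norm (u R))\<^sup>2) + 2 * (Im l * ?U)) {0..R}"
    using has_integral_add[OF 1 has_integral_mult_right[OF has_integral_mult_right[OF 2, of "Im l"], of 2]]
    by simp
  from integral_unique[OF this]
  have 3: "integral {0..R} (\<lambda>x. Im (cnj (f x) * u x)) = Re k * (norm (u R))\<^sup>2 + Im l * ?U"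
    unfolding integral_mult_right by linarith
  have "\<bar>integral {0..R} (\<lambda>x. Im (cnj (f x) * u x))\<bar> \<le> integral {0..R} (\<lambda>x. norm (f x) * norm (u x))"
    unfolding real_norm_def[symmetric]
  proof (rule integral_norm_bound_integral)
    show "(\<lambda>x. Im (cnj (f x) * u x)) integrable_on {0..R}"
      by (intro integrable_continuous_real continuous_intros f cu)
    show "(\<lambda>x. norm (f x) * norm (u x)) integrable_on {0..R}"
      by (intro integrable_continuous_real continuous_intros f cu)
    show "norm (Im (cnj (f x) * u x)) \<le> norm (f x) * norm (u x)" for x
      using abs_Im_le_cmod[of "cnj (f x) * u x"] by (simp add: norm_mult)
  qed
  moreover have "\<bar>Re k * (norm (u R))\<^sup>2 + Im l * ?U\<bar> = \<bar>Im l\<bar> * ?U + \<bar>Re k\<bar> * (norm (u R))\<^sup>2"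
  proof -
    have U: "?U \<ge> 0" by (rule integral_nonneg[OF has_integral_integrable[OF 2]]) simp
    have "Im l = 2 * Re k * Im k" by (simp add: l power2_eq_square)
    then have e: "Re k * (norm (u R))\<^sup>2 + Im l * ?U = Re k * ((norm (u R))\<^sup>2 + 2 * Im k * ?U)"
      and e2: "\<bar>Im l\<bar> * ?U = \<bar>Re k\<bar> * (2 * Im k * ?U)"
      using k by (simp_all add: algebra_simps abs_mult)
    show ?thesis unfolding e e2 abs_mult using U k by (simp add: algebra_simps)
  qed
  ultimately show ?thesis using 3 by simp
qed

text \<open>
  The self-adjoint resolvent bound \<open>1 / |Im l|\<close>, in a form that follows from the inequality between
  arithmetic and geometric means with weight \<open>|Im l|\<close>, used once for \<open>\<integral> |f| |u|\<close> and once for \<open>\<integral> |g| |u|\<close>.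
\<close>

lemma pairing_bound:
  assumes s: "system l f u v" and f: "continuous_on {0..R} f"
    and u0: "u 0 = 0" and uR: "v R = \<i> * k * u R" and l: "l = k\<^sup>2"
    and k: "Im k > 0" "Re k \<noteq> 0" and g: "continuous_on {0..R} g"
  shows "norm (integral {0..R} (\<lambda>x. cnj (g x) * u x)) \<le>
      (integral {0..R} (\<lambda>x. (norm (g x))\<^sup>2) + integral {0..R} (\<lambda>x. (norm (f x))\<^sup>2)) / (2 * \<bar>Im l\<bar>)"
proof -
  note cu = system_continuous(1)[OF s]
  have amgm: "a * b \<le> t / 2 * b\<^sup>2 + a\<^sup>2 / (2 * t)" if "t > 0" for a b t :: real
  proof -
    have "0 \<le> (t * b - a)\<^sup>2 / (2 * t)" using that by simp
    also have "\<dots> = t / 2 * b\<^sup>2 + a\<^sup>2 / (2 * t) - a * b"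
      using that by (simp add: field_simps power2_eq_square)
    finally show ?thesis by simp
  qed
  define t where "t = \<bar>Im l\<bar>"
  have t: "t > 0" using k by (simp add: t_def l power2_eq_square)
  define Us where "Us = integral {0..R} (\<lambda>x. (norm (u x))\<^sup>2)"
  define Fs where "Fs = integral {0..R} (\<lambda>x. (norm (f x))\<^sup>2)"
  define Gs where "Gs = integral {0..R} (\<lambda>x. (norm (g x))\<^sup>2)"
  have U: "((\<lambda>x. (norm (u x))\<^sup>2) has_integral Us) {0..R}" unfolding Us_def
    by (intro integrable_integral integrable_continuous_real continuous_intros cu)
  have F: "((\<lambda>x. (norm (f x))\<^sup>2) has_integral Fs) {0..R}" unfolding Fs_def
    by (intro integrable_integral integrable_continuous_real continuous_intros f)
  have G: "((\<lambda>x. (norm (g x))\<^sup>2) has_integral Gs) {0..R}" unfolding Gs_def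
    by (intro integrable_integral integrable_continuous_real continuous_intros g)
  have prod_le: "integral {0..R} (\<lambda>x. norm (a x) * norm (u x)) \<le> t / 2 * Us + As / (2 * t)"
    if a: "continuous_on {0..R} a" and A: "((\<lambda>x. (norm (a x))\<^sup>2) has_integral As) {0..R}"
    for a :: "real \<Rightarrow> complex" and As
  proof -
    have "((\<lambda>x. t / 2 * (norm (u x))\<^sup>2 + (norm (a x))\<^sup>2 / (2 * t)) has_integral
        t / 2 * Us + As / (2 * t)) {0..R}"
      by (intro has_integral_add has_integral_mult_right has_integral_divide U A)
    note B = this
    have "integral {0..R} (\<lambda>x. norm (a x) * norm (u x)) \<le>
        integral {0..R} (\<lambda>x. t / 2 * (norm (u x))\<^sup>2 + (norm (a x))\<^sup>2 / (2 * t))"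
    proof (rule integral_le[OF _ has_integral_integrable[OF B]])
      show "(\<lambda>x. norm (a x) * norm (u x)) integrable_on {0..R}"
        by (intro integrable_continuous_real continuous_intros a cu)
    qed (rule amgm[OF t])
    then show ?thesis unfolding integral_unique[OF B] .
  qed
  have "t * Us \<le> t * Us + \<bar>Re k\<bar> * (norm (u R))\<^sup>2" by simp
  also have "\<dots> \<le> t / 2 * Us + Fs / (2 * t)"
    using energy_estimate[OF s f u0 uR l k] prod_le[OF f F] unfolding t_def Us_def by linarith
  finally have "t / 2 * Us \<le> Fs / (2 * t)" by (simp add: field_simps)
  moreover have "norm (integral {0..R} (\<lambda>x. cnj (g x) * u x)) \<le> t / 2 * Us + Gs / (2 * t)"
  proof -
    have "norm (integral {0..R} (\<lambda>x. cnj (g x) * u x)) \<le> integral {0..R} (\<lambda>x. norm (g x) * norm (u x))"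
      by (rule integral_norm_bound_integral)
         (auto intro!: integrable_continuous_real continuous_intros g cu simp: norm_mult)
    with prod_le[OF g G] show ?thesis by simp
  qed
  ultimately have "norm (integral {0..R} (\<lambda>x. cnj (g x) * u x)) \<le> Fs / (2 * t) + Gs / (2 * t)"
    by simp
  then show ?thesis unfolding t_def Fs_def Gs_def by (simp add: add_divide_distrib)
qed

text \<open>
  When \<open>p = 1\<close> and \<open>q = 0\<close> beyond \<open>R\<close>, this is, up to a nonzero factor, the Wronskian of \<open>phi\<close> with the
  solution that equals \<open>exp (i k x)\<close> for \<open>x \<ge> R\<close>.
\<close>

definition jost :: "complex \<Rightarrow> complex" where
  "jost k = quasi_phi (k\<^sup>2) R - \<i> * k * phi (k\<^sup>2) R"

lemma holomorphic_compose_square: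
  assumes "f holomorphic_on UNIV"
  shows "(\<lambda>k::complex. f (k\<^sup>2)) holomorphic_on A"
  using holomorphic_on_compose[OF holomorphic_on_power[OF holomorphic_on_ident, of 2 A]
      holomorphic_on_subset[OF assms]]
  by (simp add: o_def)

lemma phi_sq_holomorphic [holomorphic_intros]:
  "x \<in> {0..R} \<Longrightarrow> (\<lambda>k. phi (k\<^sup>2) x) holomorphic_on A"
  "x \<in> {0..R} \<Longrightarrow> (\<lambda>k. quasi_phi (k\<^sup>2) x) holomorphic_on A"
  by (rule holomorphic_compose_square[OF phi_holomorphic(1)]
      holomorphic_compose_square[OF phi_holomorphic(2)]; assumption)+

lemma jost_holomorphic [holomorphic_intros]: "jost holomorphic_on A"
  unfolding jost_def[abs_def] using R_in by (intro holomorphic_intros) auto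

text \<open>
  At real \<open>r\<close> the real part of \<open>jost r\<close> is the quasi-derivative of \<open>phi\<close> at \<open>R\<close> and the imaginary part is
  \<open>- r phi(R)\<close>; the two boundary values do not vanish together.
\<close>

lemma jost_nonzero_real:
  assumes "r \<noteq> 0"
  shows "jost (of_real r) \<noteq> 0"
proof
  assume *: "jost (of_real r) = 0"
  obtain a b where ab: "phi (of_real (r\<^sup>2)) R = of_real a" "quasi_phi (of_real (r\<^sup>2)) R = of_real b"
    using phi_real[OF R_in, of "r\<^sup>2"] by metis
  have e: "complex_of_real b = \<i> * complex_of_real (r * a)"
    using * ab by (simp add: jost_def mult.assoc)
  have "b = Re (\<i> * complex_of_real (r * a))" "0 = Im (\<i> * complex_of_real (r * a))"
    unfolding e[symmetric] by simp_all
  then have "b = 0" "r * a = 0" by simp_all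
  with assms ab phi_no_common_zero[OF R_in, of "of_real (r\<^sup>2)"] show False by auto
qed

text \<open>
  At such a zero \<open>phi\<close> itself would satisfy the outgoing condition without any inhomogeneity, and the energy
  estimate would force \<open>phi\<close> and its quasi-derivative to vanish at \<open>R\<close>.
\<close>

lemma jost_nonzero_upper:
  assumes "Im k > 0" "Re k \<noteq> 0"
  shows "jost k \<noteq> 0"
proof
  assume *: "jost k = 0"
  then have "quasi_phi (k\<^sup>2) R = \<i> * k * phi (k\<^sup>2) R" by (simp add: jost_def)
  from energy_estimate[OF system_phi _ _ this refl assms]
  have "\<bar>Im (k\<^sup>2)\<bar> * integral {0..R} (\<lambda>x. (norm (phi (k\<^sup>2) x))\<^sup>2)
      + \<bar>Re k\<bar> * (norm (phi (k\<^sup>2) R))\<^sup>2 \<le> 0" by simp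
  moreover have "integral {0..R} (\<lambda>x. (norm (phi (k\<^sup>2) x))\<^sup>2) \<ge> 0"
    by (intro integral_nonneg integrable_continuous_real continuous_intros phi_continuous) simp
  ultimately have "\<bar>Re k\<bar> * (norm (phi (k\<^sup>2) R))\<^sup>2 \<le> 0"
    by (smt (verit) mult_nonneg_nonneg abs_ge_zero)
  then have "phi (k\<^sup>2) R = 0" using assms(2) by (simp add: mult_le_0_iff)
  then show False using * phi_no_common_zero[OF R_in, of "k\<^sup>2"] by (auto simp: jost_def)
qed

text \<open>
  Zero energy may be a resonance, and then \<open>jost 0 = 0\<close>.  Since \<open>phi\<close> depends on \<open>k\<close> through \<open>k\<^sup>2\<close> only, the
  derivative at \<open>0\<close> is \<open>- i phi(R)\<close>, which is then nonzero: the zero is simple.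
\<close>

lemma jost_deriv_0:
  assumes "jost 0 = 0"
  shows "deriv jost 0 \<noteq> 0"
proof -
  have d: "((\<lambda>l. quasi_phi l R) has_field_derivative deriv (\<lambda>l. quasi_phi l R) 0) (at (0\<^sup>2))"
    using phi_holomorphic(2)[OF R_in] holomorphic_derivI[of _ UNIV] by simp
  have d2: "((\<lambda>l. phi l R) has_field_derivative deriv (\<lambda>l. phi l R) 0) (at (0\<^sup>2))"
    using phi_holomorphic(1)[OF R_in] holomorphic_derivI[of _ UNIV] by simp
  have sq: "((\<lambda>k::complex. k\<^sup>2) has_field_derivative 0) (at 0)"
    by (rule derivative_eq_intros refl | simp)+
  have "((\<lambda>k. quasi_phi (k\<^sup>2) R) has_field_derivative 0) (at 0)"
    using DERIV_chain2[OF d sq] by simp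
  moreover have "((\<lambda>k. phi (k\<^sup>2) R) has_field_derivative 0) (at 0)"
    using DERIV_chain2[OF d2 sq] by simp
  ultimately have "(jost has_field_derivative - \<i> * phi 0 R) (at 0)"
    unfolding jost_def[abs_def] by (auto intro!: derivative_eq_intros)
  then have "deriv jost 0 = - \<i> * phi 0 R" by (rule DERIV_imp_deriv)
  moreover have "phi 0 R \<noteq> 0"
    using assms phi_no_common_zero[OF R_in, of 0] by (auto simp: jost_def)
  ultimately show ?thesis by simp
qed

lemma integral_phi_holomorphic:
  assumes "continuous_on {0..R} g"
  shows "(\<lambda>k. integral {0..R} (\<lambda>x. g x * phi (k\<^sup>2) x)) holomorphic_on A"
  unfolding phi_def
  by (rule holomorphic_compose_square[OF integral_sol_holomorphic[OF assms]]) simp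

text \<open>
  The Lagrange identity for \<open>phi\<close> at \<open>\<mu> = - \<kappa>\<^sup>2\<close> and at \<open>k\<^sup>2\<close> splits off the factor \<open>k - i \<kappa>\<close> explicitly.  At
  \<open>k = i \<kappa>\<close> the cofactor is a multiple of the squared norm of the eigenfunction, so the zero is
  simple and the residue is known.
\<close>

lemma jost_factor:
  fixes \<kappa> :: real
  defines "\<mu> \<equiv> of_real (- \<kappa>\<^sup>2)"
  assumes z: "jost (\<i> * \<kappa>) = 0"
  shows "phi \<mu> R \<noteq> 0"
    and "jost k * phi \<mu> R = (k - \<i> * \<kappa>) *
      (- (k + \<i> * \<kappa>) * integral {0..R} (\<lambda>x. phi \<mu> x * phi (k\<^sup>2) x) - \<i> * phi (k\<^sup>2) R * phi \<mu> R)"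
proof -
  have mu: "(\<i> * of_real \<kappa>)\<^sup>2 = \<mu>" by (simp add: \<mu>_def power_mult_distrib)
  have q: "quasi_phi \<mu> R = - \<kappa> * phi \<mu> R"
    using z unfolding jost_def mu by (simp add: eq_neg_iff_add_eq_0 algebra_simps)
  then show "phi \<mu> R \<noteq> 0" using phi_no_common_zero[OF R_in, of \<mu>] by auto
  have c: "continuous_on {0..R} (\<lambda>x. phi \<mu> x * phi (k\<^sup>2) x)"
    by (intro continuous_intros phi_continuous)
  have "((\<lambda>x. (\<mu> - k\<^sup>2) * (phi \<mu> x * phi (k\<^sup>2) x)) has_integral
     phi \<mu> R * quasi_phi (k\<^sup>2) R - quasi_phi \<mu> R * phi (k\<^sup>2) R) {0..R}"
    using lagrange_identity[OF system_phi system_phi R_in, of \<mu> "k\<^sup>2"] by simp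
  then have "(\<mu> - k\<^sup>2) * integral {0..R} (\<lambda>x. phi \<mu> x * phi (k\<^sup>2) x) =
      phi \<mu> R * quasi_phi (k\<^sup>2) R - quasi_phi \<mu> R * phi (k\<^sup>2) R"
    using has_integral_unique[OF has_integral_mult_right[OF integrable_integral[OF integrable_continuous_real[OF c]]]]
    by blast
  note eq = this
  have alg: "(k - \<i> * \<kappa>) * (- (k + \<i> * \<kappa>) * I - \<i> * P * A) =
      (\<mu> - k\<^sup>2) * I - \<i> * k * P * A - \<kappa> * P * A" for I P A :: complex
    by (simp add: \<mu>_def algebra_simps power2_eq_square)
  have "jost k * phi \<mu> R = (\<mu> - k\<^sup>2) * integral {0..R} (\<lambda>x. phi \<mu> x * phi (k\<^sup>2) x)
      - \<i> * k * phi (k\<^sup>2) R * phi \<mu> R - \<kappa> * phi (k\<^sup>2) R * phi \<mu> R"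
    unfolding eq jost_def q by (simp add: algebra_simps)
  also have "\<dots> = (k - \<i> * \<kappa>) *
      (- (k + \<i> * \<kappa>) * integral {0..R} (\<lambda>x. phi \<mu> x * phi (k\<^sup>2) x) - \<i> * phi (k\<^sup>2) R * phi \<mu> R)"
    by (rule alg[symmetric])
  finally show "jost k * phi \<mu> R = (k - \<i> * \<kappa>) *
      (- (k + \<i> * \<kappa>) * integral {0..R} (\<lambda>x. phi \<mu> x * phi (k\<^sup>2) x) - \<i> * phi (k\<^sup>2) R * phi \<mu> R)" .
qed

lemma transform_eq_boundary:
  assumes h: "continuous_on {0..R} h"
  shows "integral {0..R} (\<lambda>x. phi l x * h x) =
    quasi_phi l R * sol 0 0 h l R - phi l R * quasi_sol 0 0 h l R"
proof -
  have "((\<lambda>x. - (phi l x * h x)) has_integral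
      phi l R * quasi_sol 0 0 h l R - quasi_phi l R * sol 0 0 h l R) {0..R}"
    using lagrange_identity[OF system_phi system_sol[OF h, of l 0 0] R_in, of l] h by simp
  from has_integral_neg[OF this] show ?thesis by (simp add: integral_unique)
qed

end

section \<open>Contour integrals over a half disc\<close>

lemma upper_arc_image:
  assumes "A > 0"
  shows "path_image (part_circlepath 0 A 0 pi) \<subseteq> {z. norm z = A \<and> Im z \<ge> 0}"
  using assms by (auto simp: path_image_part_circlepath' norm_mult sin_ge_zero closed_segment_eq_real_ivl)

text \<open>
  The boundaries of the upper and the lower half disc add up to the circle, because the two copies of
  the diameter cancel.  The circle winds once around \<open>z\<close>, and the lower boundary does not wind around \<open>z\<close>
  since it lies in a half plane that misses \<open>z\<close>.
\<close>

lemma winding_number_upper_half_disc: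
  assumes A: "A > 0" and z: "Im z > 0" "norm z < A"
  shows "winding_number (part_circlepath 0 A 0 pi +++ linepath (- complex_of_real A) (complex_of_real A)) z = 1"
proof -
  define up where "up = part_circlepath 0 A 0 pi"
  define dn where "dn = part_circlepath 0 A pi (2 * pi)"
  have ends: "pathstart up = A" "pathfinish up = -A" "pathstart dn = -A" "pathfinish dn = A"
    by (simp_all add: up_def dn_def exp_Euler exp_two_pi_i' mult.commute[of "\<i>"])
  have up_im: "path_image up \<subseteq> {z. norm z = A \<and> Im z \<ge> 0}"
    unfolding up_def by (rule upper_arc_image[OF A])
  have dn_im: "path_image dn \<subseteq> {z. norm z = A \<and> Im z \<le> 0}"
    using A sin_ge_zero[of "x - pi" for x]
    by (auto simp: dn_def path_image_part_circlepath' norm_mult mult_le_0_iff closed_segment_eq_real_ivl)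
  have line: "z \<notin> closed_segment (- complex_of_real A) (complex_of_real A)" "z \<notin> closed_segment (complex_of_real A) (- complex_of_real A)"
    using z by (force simp: closed_segment_def)+
  have nz: "z \<notin> path_image up" "z \<notin> path_image dn"
    using up_im dn_im z by auto
  have valid: "valid_path up" "valid_path dn" by (simp_all add: up_def dn_def)
  have "winding_number (dn +++ linepath (complex_of_real A) (- complex_of_real A)) z = 0"
  proof (rule winding_number_zero_outside[where s="{w. Im w \<le> 0}"])
    show "convex {w. Im w \<le> 0}" by (rule convex_halfspace_Im_le)
    show "path_image (dn +++ linepath (complex_of_real A) (- complex_of_real A)) \<subseteq> {w. Im w \<le> 0}"
      using dn_im A by (auto simp: path_image_join ends closed_segment_def)
  qed (use z valid ends in \<open>auto simp: valid_path_imp_path\<close>)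
  then have 1: "winding_number dn z + winding_number (linepath (complex_of_real A) (- complex_of_real A)) z = 0"
    using winding_number_join[of dn z "linepath (complex_of_real A) (- complex_of_real A)"] valid ends nz line
    by (simp add: valid_path_imp_path)
  have 2: "winding_number (linepath (complex_of_real A) (- complex_of_real A)) z = - winding_number (linepath (- complex_of_real A) (complex_of_real A)) z"
    using winding_number_reversepath[of "linepath (- complex_of_real A) (complex_of_real A)" z] line by simp
  have 3: "winding_number (circlepath 0 A) z = winding_number up z + winding_number dn z"
  proof -
    have "((\<lambda>w. 1/(w - z)) has_contour_integral 2 * pi * \<i> * winding_number up z) up"
      "((\<lambda>w. 1/(w - z)) has_contour_integral 2 * pi * \<i> * winding_number dn z) dn"
      using has_contour_integral_winding_number[OF valid(1) nz(1)]
        has_contour_integral_winding_number[OF valid(2) nz(2)] by simp_all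
    then have "((\<lambda>w. 1/(w - z)) has_contour_integral
        2 * pi * \<i> * winding_number up z + 2 * pi * \<i> * winding_number dn z) (circlepath 0 A)"
      unfolding up_def dn_def circlepath_def
      by (subst (asm) (1 2) has_contour_integral_part_circlepath_iff)
         (auto simp: has_contour_integral_part_circlepath_iff intro: has_integral_combine[of 0 pi])
    moreover have "((\<lambda>w. 1/(w - z)) has_contour_integral 2 * pi * \<i> * winding_number (circlepath 0 A) z)
        (circlepath 0 A)"
      using has_contour_integral_winding_number[of "circlepath 0 A" z] z A by auto
    ultimately have "2 * pi * \<i> * winding_number (circlepath 0 A) z =
       2 * pi * \<i> * (winding_number up z + winding_number dn z)"
      using has_contour_integral_unique by (fastforce simp: ring_distribs)
    then show ?thesis by simp
  qed
  have "winding_number (circlepath 0 A) z = 1"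
    by (rule winding_number_circlepath) (use z in auto)
  moreover have "winding_number (up +++ linepath (- complex_of_real A) (complex_of_real A)) z =
      winding_number up z + winding_number (linepath (- complex_of_real A) (complex_of_real A)) z"
    by (rule winding_number_join) (use valid ends nz line in \<open>auto simp: valid_path_imp_path\<close>)
  ultimately show ?thesis using 1 2 3 unfolding up_def by simp
qed

theorem half_disc_residue_theorem:
  assumes A: "A > 0" and fin: "finite pts" and holo: "f holomorphic_on ball 0 (A + 1) - pts"
    and pts: "pts \<subseteq> ball 0 (A + 1)" "\<And>z. z \<in> pts \<Longrightarrow> Im z < 0 \<or> Im z > 0 \<and> norm z < A"
  shows "f contour_integrable_on part_circlepath 0 A 0 pi"
    and "continuous_on {-A..A} (\<lambda>x. f (of_real x))"
    and "contour_integral (part_circlepath 0 A 0 pi) f + integral {-A..A} (\<lambda>x. f (of_real x)) =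
           2 * pi * \<i> * (\<Sum>z | z \<in> pts \<and> Im z > 0. residue f z)"
proof -
  define up where "up = part_circlepath 0 A 0 pi"
  define g where "g = up +++ linepath (- complex_of_real A) (complex_of_real A)"
  have ends: "pathstart up = A" "pathfinish up = -A"
    by (simp_all add: up_def exp_Euler)
  have up_im: "path_image up \<subseteq> {z. norm z = A \<and> Im z \<ge> 0}"
    unfolding up_def by (rule upper_arc_image[OF A])
  have up_im2: "path_image up \<subseteq> ball 0 (A + 1) - pts"
    using up_im pts by force
  have cont: "continuous_on (ball 0 (A + 1) - pts) f"
    by (rule holomorphic_on_imp_continuous_on[OF holo])
  show 1: "f contour_integrable_on part_circlepath 0 A 0 pi"
    by (rule contour_integrable_continuous_part_circlepath)
       (rule continuous_on_subset[OF cont up_im2[unfolded up_def]])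
  have real_im: "complex_of_real ` {-A..A} \<subseteq> ball 0 (A + 1) - pts"
    using pts by (force simp: dist_norm)
  show 2: "continuous_on {-A..A} (\<lambda>x. f (of_real x))"
    by (rule continuous_on_compose2[OF cont _ real_im]) (intro continuous_intros)
  have seg: "closed_segment (- complex_of_real A) (complex_of_real A) = complex_of_real ` {-A..A}"
    using A closed_segment_of_real[of "-A" A] by (simp add: closed_segment_eq_real_ivl)
  have line: "f contour_integrable_on linepath (- complex_of_real A) (complex_of_real A)"
    using contour_integrable_continuous_linepath[of "- complex_of_real A" "complex_of_real A" f]
      continuous_on_subset[OF cont real_im] unfolding seg by simp
  have line_eq: "contour_integral (linepath (- complex_of_real A) (complex_of_real A)) f = integral {-A..A} (\<lambda>x. f (of_real x))"
    using A by (subst contour_integral_linepath_Reals_eq) auto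
  have valid: "valid_path up" by (simp add: up_def)
  have "contour_integral g f = contour_integral up f + contour_integral (linepath (- complex_of_real A) (complex_of_real A)) f"
    unfolding g_def by (rule contour_integral_join) (use 1 line valid in \<open>auto simp: up_def\<close>)
  then have "contour_integral (part_circlepath 0 A 0 pi) f + integral {-A..A} (\<lambda>x. f (of_real x))
      = contour_integral g f" unfolding line_eq up_def by simp
  also have g_im: "path_image g \<subseteq> ball 0 (A + 1) - pts"
    using up_im2 real_im ends seg by (auto simp: g_def path_image_join)
  have g_im2: "path_image g \<subseteq> {w. Im w \<ge> 0}"
    using up_im ends seg by (auto simp: g_def path_image_join)
  have g_valid: "valid_path g" "pathfinish g = pathstart g"
    using valid ends by (auto simp: g_def)
  have "contour_integral g f = 2 * pi * \<i> * (\<Sum>z\<in>pts. winding_number g z * residue f z)"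
  proof (rule Residue_theorem[OF open_ball _ fin holo g_valid g_im])
    show "connected (ball (0::complex) (A + 1))" by (rule convex_connected[OF convex_ball])
    show "\<forall>z. z \<notin> ball 0 (A + 1) \<longrightarrow> winding_number g z = 0"
      using winding_number_zero_outside[of g "ball 0 (A + 1)"] g_valid g_im
      by (auto simp: valid_path_imp_path)
  qed
  also have "(\<Sum>z\<in>pts. winding_number g z * residue f z) = (\<Sum>z\<in>pts. if Im z > 0 then residue f z else 0)"
  proof (rule sum.cong[OF refl])
    fix z assume z: "z \<in> pts"
    show "winding_number g z * residue f z = (if Im z > 0 then residue f z else 0)"
    proof (cases "Im z > 0")
      case True
      then show ?thesis
        using winding_number_upper_half_disc[OF A True] pts(2)[OF z] by (simp add: g_def up_def)
    next
      case False
      then have "winding_number g z = 0"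
        using pts(2)[OF z] g_im2 g_valid
        by (intro winding_number_zero_outside[of g "{w. Im w \<ge> 0}"])
           (auto simp: valid_path_imp_path convex_halfspace_Im_ge)
      with False show ?thesis by simp
    qed
  qed
  also have "\<dots> = (\<Sum>z | z \<in> pts \<and> Im z > 0. residue f z)"
    using fin by (simp add: sum.inter_filter)
  finally show "contour_integral (part_circlepath 0 A 0 pi) f + integral {-A..A} (\<lambda>x. f (of_real x)) =
           2 * pi * \<i> * (\<Sum>z | z \<in> pts \<and> Im z > 0. residue f z)" .
qed

lemma holomorphic_split_zero:
  assumes f: "f holomorphic_on UNIV" and z: "f a = 0"
  obtains g where "g holomorphic_on UNIV" "g a = deriv f a" "\<And>w. f w = (w - a) * g w"
proof -
  define g where "g w = (if w = a then deriv f a else f w / (w - a))" for w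
  have "(\<lambda>w. if w = a then deriv f a else f w / (w - a) - f a / (w - a)) holomorphic_on UNIV"
    by (rule pole_theorem_open[where g=f]) (use f in auto)
  then have "g holomorphic_on UNIV"
    unfolding g_def[abs_def] using z by (simp cong: if_cong)
  then show ?thesis by (rule that) (use z in \<open>auto simp: g_def\<close>)
qed

lemma has_contour_integral_inverse_upper_arc:
  assumes "A > 0"
  shows "((\<lambda>k. 1 / k) has_contour_integral \<i> * pi) (part_circlepath 0 A 0 pi)"
proof -
  have "(\<lambda>t. 1 / (0 + A * cis t) * A * \<i> * cis t) = (\<lambda>t. \<i>)"
    using assms by (auto simp: fun_eq_iff)
  then show ?thesis
    using has_integral_const_real[of \<i> 0 pi]
    by (simp add: has_contour_integral_part_circlepath_iff scaleR_conv_of_real mult.commute)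
qed

lemma has_contour_integral_cube_upper_arc:
  "((\<lambda>k. k ^ 3) has_contour_integral 0) (part_circlepath 0 A 0 pi)"
proof -
  have "((\<lambda>k. k ^ 3) has_contour_integral
      pathfinish (part_circlepath 0 A 0 pi) ^ 4 / 4 - pathstart (part_circlepath 0 A 0 pi) ^ 4 / 4)
      (part_circlepath 0 A 0 pi)"
    by (rule contour_integral_primitive[of UNIV]) (auto intro!: derivative_eq_intros)
  then show ?thesis by (simp add: exp_Euler)
qed

text \<open>
  On the circle, \<open>A\<^sup>4 = l (cnj l)\<close> with \<open>l = k\<^sup>2\<close>, so the weight is \<open>(cnj l - l) / cnj l\<close>.  It vanishes to first
  order exactly where the resolvent bound \<open>1 / |Im l|\<close> blows up.
\<close>

lemma weight_norm_on_circle: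
  assumes "norm k = A" "A > 0"
  shows "norm (1 - k ^ 4 / complex_of_real A ^ 4) = 2 * \<bar>Im (k\<^sup>2)\<bar> / A\<^sup>2"
proof -
  define l where "l = k\<^sup>2"
  have nl: "norm l = A\<^sup>2" "l \<noteq> 0" using assms by (auto simp: l_def norm_power)
  have "complex_of_real A ^ 4 = complex_of_real ((norm l)\<^sup>2)" unfolding nl by simp
  also have "\<dots> = l * cnj l" by (simp only: complex_norm_square)
  finally have "1 - k ^ 4 / complex_of_real A ^ 4 = 1 - l * l / (l * cnj l)"
    by (simp add: l_def power2_eq_square power4_eq_xxxx mult.assoc)
  also have "\<dots> = (cnj l - l) / cnj l" using nl by (simp add: field_simps)
  also have "cnj l - l = - 2 * \<i> * Im l" by (simp add: complex_eq_iff)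
  also have "norm (- 2 * \<i> * Im l / cnj l) = 2 * \<bar>Im l\<bar> / A\<^sup>2"
    by (simp add: norm_divide norm_mult nl)
  finally show ?thesis by (simp add: l_def)
qed

section \<open>Matrix elements of the resolvent\<close>

text \<open>
  The squared norm on the whole half-line of an eigenfunction at \<open>- \<kappa>\<^sup>2\<close>: the second summand is the
  contribution of its tail \<open>phi(R) exp (- \<kappa> (x - R))\<close>.
\<close>

definition (in sl_interval) phi_norm :: "real \<Rightarrow> complex" where
  "phi_norm \<kappa> = integral {0..R} (\<lambda>x. (phi (of_real (- \<kappa>\<^sup>2)) x)\<^sup>2) + (phi (of_real (- \<kappa>\<^sup>2)) R)\<^sup>2 / (2 * \<kappa>)"

text \<open>
  A pair of test functions for which the matrix element of the resolvent is studied.  The assumption on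
  \<open>h\<close> encodes \<open>qh = p h'\<close> and \<open>Dh = D h\<close> as a solution of the system at parameter \<open>0\<close>.  The boundary
  conditions hold for functions supported in the interior of \<open>[0,R]\<close>.
\<close>

locale sl_pair = sl_interval +
  fixes g h Dh qh :: "real \<Rightarrow> complex"
  assumes g_cont: "continuous_on {0..R} g"
    and Dh_cont: "continuous_on {0..R} Dh"
    and system_h: "system 0 Dh h qh"
    and h_boundary: "h 0 = 0" "qh 0 = 0" "h R = 0" "qh R = 0"
begin

definition left_coeff :: "complex \<Rightarrow> complex" where
  "left_coeff k = integral {0..R} (\<lambda>x. cnj (g x) * phi (k\<^sup>2) x)"
definition right_coeff :: "complex \<Rightarrow> complex" where
  "right_coeff k = integral {0..R} (\<lambda>x. phi (k\<^sup>2) x * h x)"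
definition gsol :: "complex \<Rightarrow> complex" where
  "gsol k = integral {0..R} (\<lambda>x. cnj (g x) * sol 0 0 h (k\<^sup>2) x)"
definition boundary_h :: "complex \<Rightarrow> complex" where
  "boundary_h k = quasi_sol 0 0 h (k\<^sup>2) R - \<i> * k * sol 0 0 h (k\<^sup>2) R"
definition pairing :: complex where
  "pairing = integral {0..R} (\<lambda>x. cnj (g x) * h x)"
definition test_energy :: real where
  "test_energy = integral {0..R} (\<lambda>x. (norm (g x))\<^sup>2) + integral {0..R} (\<lambda>x. (norm (Dh x))\<^sup>2)"

lemma h_cont: "continuous_on {0..R} h"
  using system_continuous(1)[OF system_h] .

lemma cnj_g_cont: "continuous_on {0..R} (\<lambda>x. cnj (g x))"
  by (intro continuous_intros g_cont)

lemma holomorphic_parts [holomorphic_intros]: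
  "left_coeff holomorphic_on S" "gsol holomorphic_on S" "boundary_h holomorphic_on S"
proof -
  show "left_coeff holomorphic_on S"
    unfolding left_coeff_def[abs_def] by (rule integral_phi_holomorphic[OF cnj_g_cont])
  show "gsol holomorphic_on S"
    unfolding gsol_def[abs_def]
    by (rule holomorphic_compose_square[OF integral_sol_holomorphic[OF cnj_g_cont h_cont]])
  show "boundary_h holomorphic_on S"
    unfolding boundary_h_def[abs_def]
    by (intro holomorphic_intros
        holomorphic_compose_square[OF sol_holomorphic(1)[OF h_cont R_in]]
        holomorphic_compose_square[OF sol_holomorphic(2)[OF h_cont R_in]])
qed

lemma right_coeff_boundary:
  "right_coeff k = quasi_phi (k\<^sup>2) R * sol 0 0 h (k\<^sup>2) R - phi (k\<^sup>2) R * quasi_sol 0 0 h (k\<^sup>2) R"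
  unfolding right_coeff_def by (rule transform_eq_boundary[OF h_cont])

text \<open>
  \<open>\<langle>g, u\<rangle>\<close> for \<open>u = U - (boundary_h k / jost k) phi\<close>, where \<open>U\<close> solves the inhomogeneous equation with zero
  initial data and the coefficient is chosen such that the outgoing condition holds at \<open>R\<close>.  The formula makes sense in
  the whole plane, not only where it is the resolvent of \<open>D\<close>.
\<close>

definition resolvent :: "complex \<Rightarrow> complex" where
  "resolvent k = gsol k - left_coeff k * boundary_h k / jost k"

text \<open>
  If \<open>(D - k\<^sup>2) u = h\<close>, then \<open>h + k\<^sup>2 u\<close> solves the same problem with right-hand side \<open>D h\<close>, still with the
  outgoing condition because \<open>h\<close> and \<open>qh\<close> vanish at \<open>R\<close>.  So its pairing with \<open>g\<close> is controlled by
  \<open>pairing_bound\<close>.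
\<close>

lemma resolvent_bound:
  assumes k: "Im k > 0" "Re k \<noteq> 0"
  shows "norm (pairing + k\<^sup>2 * resolvent k) \<le> test_energy / (2 * \<bar>Im (k\<^sup>2)\<bar>)"
proof -
  define c where "c = - boundary_h k / jost k"
  define l where "l = k\<^sup>2"
  define u where "u x = h x + l * (sol 0 0 h l x + c * phi l x)" for x
  define v where "v x = qh x + l * (quasi_sol 0 0 h l x + c * quasi_phi l x)" for x
  have jk: "jost k \<noteq> 0" by (rule jost_nonzero_upper[OF k])
  have s: "system l Dh u v"
    unfolding system_def
  proof (intro ballI conjI)
    fix x assume x: "x \<in> {0..R}"
    note d1 = system_h[unfolded system_def, rule_format, OF x]
    note d2 = system_sol[OF h_cont, where l=l and ?u0.0=0 and ?v0.0=0, unfolded system_def, rule_format, OF x]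
    note d3 = system_phi[unfolded system_def, rule_format, OF x, of l]
    have "(u has_vector_derivative qh x / of_real (p x) +
        l * (quasi_sol 0 0 h l x / of_real (p x) + c * (quasi_phi l x / of_real (p x)))) (at x within {0..R})"
      unfolding u_def
      by (intro has_vector_derivative_add has_vector_derivative_mult_right
          conjunct1[OF d1] conjunct1[OF d2] conjunct1[OF d3])
    then show "(u has_vector_derivative v x / of_real (p x)) (at x within {0..R})"
      by (simp add: v_def add_divide_distrib distrib_left)
    have "(v has_vector_derivative ((of_real (q x) - 0) * h x - Dh x) +
        l * (((of_real (q x) - l) * sol 0 0 h l x - h x) +
          c * ((of_real (q x) - l) * phi l x - 0))) (at x within {0..R})"
      unfolding v_def
      by (intro has_vector_derivative_add has_vector_derivative_mult_right
          conjunct2[OF d1] conjunct2[OF d2] conjunct2[OF d3])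
    then show "(v has_vector_derivative (of_real (q x) - l) * u x - Dh x) (at x within {0..R})"
      by (simp add: u_def algebra_simps)
  qed
  have u0: "u 0 = 0" using h_boundary h_cont by (simp add: u_def)
  have "(quasi_sol 0 0 h l R + c * quasi_phi l R) - \<i> * k * (sol 0 0 h l R + c * phi l R) = boundary_h k + c * jost k"
    unfolding boundary_h_def jost_def l_def by (simp add: algebra_simps)
  also have "\<dots> = 0" using jk by (simp add: c_def)
  finally have uR: "v R = \<i> * k * u R"
    using h_boundary by (simp add: u_def v_def algebra_simps)
  have "integral {0..R} (\<lambda>x. cnj (g x) * u x) =
      integral {0..R} (\<lambda>x. cnj (g x) * h x + l * (cnj (g x) * sol 0 0 h l x + c * (cnj (g x) * phi l x)))"
    by (simp add: u_def algebra_simps)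
  also have "\<dots> = pairing + l * (gsol k + c * left_coeff k)"
    unfolding pairing_def gsol_def left_coeff_def l_def
    by (subst integral_add integral_mult_right |
        intro integrable_continuous_real continuous_intros cnj_g_cont h_cont phi_continuous sol_continuous |
        rule refl)+
  also have "gsol k + c * left_coeff k = resolvent k"
    by (simp add: resolvent_def c_def mult.commute)
  finally have "pairing + k\<^sup>2 * resolvent k = integral {0..R} (\<lambda>x. cnj (g x) * u x)"
    by (simp add: l_def)
  then show ?thesis
    using pairing_bound[OF s Dh_cont u0 uR l_def k g_cont] by (simp add: l_def test_energy_def)
qed

text \<open>
  Twice this divided by \<open>\<pi>\<close> is the spectral density with respect to \<open>dk\<close> on \<open>k > 0\<close>.
\<close>

definition momentum_density :: "real \<Rightarrow> complex" where
  "momentum_density x = x\<^sup>2 * left_coeff x * right_coeff x / ((quasi_phi (x\<^sup>2) R)\<^sup>2 + x\<^sup>2 * (phi (x\<^sup>2) R)\<^sup>2)"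

text \<open>
  Only \<open>boundary_h\<close> and \<open>jost\<close> change under \<open>k \<mapsto> - k\<close>.  The cross terms of the difference collect to the
  boundary expression of \<open>transform_eq_boundary\<close>, which is how the transform of \<open>h\<close> appears.
\<close>

lemma resolvent_jump:
  fixes x :: real
  assumes "x \<noteq> 0"
  shows "resolvent x - resolvent (- complex_of_real x) =
    2 * \<i> * x * left_coeff x * right_coeff x / ((quasi_phi (x\<^sup>2) R)\<^sup>2 + x\<^sup>2 * (phi (x\<^sup>2) R)\<^sup>2)"
proof -
  define a where "a = phi (x\<^sup>2) R"
  define b where "b = quasi_phi (x\<^sup>2) R"
  define s where "s = sol 0 0 h (x\<^sup>2) R"
  define t where "t = quasi_sol 0 0 h (x\<^sup>2) R"
  have j: "jost x = b - \<i> * x * a" "jost (- complex_of_real x) = b + \<i> * x * a"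
    by (simp_all add: jost_def a_def b_def)
  have nz: "b - \<i> * x * a \<noteq> 0" "b + \<i> * x * a \<noteq> 0"
    using jost_nonzero_real[of x] jost_nonzero_real[of "-x"] assms j by simp_all
  have prod: "(b - \<i> * x * a) * (b + \<i> * x * a) = b\<^sup>2 + x\<^sup>2 * a\<^sup>2"
    by (simp add: algebra_simps power2_eq_square)
  have "resolvent x - resolvent (- complex_of_real x) =
      left_coeff x * ((t + \<i> * x * s) / (b + \<i> * x * a) - (t - \<i> * x * s) / (b - \<i> * x * a))"
    by (simp add: resolvent_def j gsol_def left_coeff_def boundary_h_def a_def b_def s_def t_def algebra_simps)
  also have "(t + \<i> * x * s) / (b + \<i> * x * a) - (t - \<i> * x * s) / (b - \<i> * x * a) =
      ((t + \<i> * x * s) * (b - \<i> * x * a) - (t - \<i> * x * s) * (b + \<i> * x * a)) /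
      ((b - \<i> * x * a) * (b + \<i> * x * a))"
    using nz by (simp add: divide_simps)
  also have "(t + \<i> * x * s) * (b - \<i> * x * a) - (t - \<i> * x * s) * (b + \<i> * x * a) =
      2 * \<i> * x * (b * s - a * t)"
    by (simp add: algebra_simps)
  also have "b * s - a * t = right_coeff x" by (simp add: right_coeff_boundary a_def b_def s_def t_def)
  finally show ?thesis unfolding prod by (simp add: a_def b_def)
qed

text \<open>
  The factor \<open>2 k\<close> removes the possible zero of \<open>jost\<close> at \<open>0\<close>, so that the integrand of the contour integral
  has no pole on the real axis.
\<close>

lemma jost_quotient:
  obtains M N where "M holomorphic_on UNIV" "N holomorphic_on UNIV" "N 0 \<noteq> 0"
    "\<And>k. k \<noteq> 0 \<Longrightarrow> N k = 0 \<longleftrightarrow> jost k = 0" "\<And>k. k \<noteq> 0 \<Longrightarrow> M k / N k = 2 * k / jost k"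
proof (cases "jost 0 = 0")
  case False
  show ?thesis
    by (rule that[of "\<lambda>k. 2 * k" jost]) (use False in \<open>auto intro!: holomorphic_intros\<close>)
next
  case True
  obtain N where N: "N holomorphic_on UNIV" "N 0 = deriv jost 0" "\<And>w. jost w = (w - 0) * N w"
    using holomorphic_split_zero[OF jost_holomorphic True] by metis
  show ?thesis
    by (rule that[of "\<lambda>k. 2" N]) (use N jost_deriv_0[OF True] in \<open>auto intro!: holomorphic_intros\<close>)
qed

text \<open>
  Were the integral zero, \<open>phi\<close> would vanish identically and so would its derivative at \<open>0\<close>, which is \<open>1 / p(0)\<close>.
\<close>

lemma phi_norm_pos:
  assumes "\<kappa> > 0"
  shows "\<exists>r>0. phi_norm \<kappa> = of_real r"
proof -
  define \<mu> where "\<mu> = complex_of_real (- \<kappa>\<^sup>2)"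
  define a where "a x = Re (phi \<mu> x)" for x
  have a: "phi \<mu> x = of_real (a x)" if "x \<in> {0..R}" for x
    using phi_real(1)[OF that, of "- \<kappa>\<^sup>2"] by (simp add: a_def \<mu>_def)
  have c: "continuous_on {0..R} a"
    unfolding a_def by (intro continuous_intros phi_continuous)
  have "integral {0..R} (\<lambda>x. (phi \<mu> x)\<^sup>2) = integral {0..R} (\<lambda>x. complex_of_real ((a x)\<^sup>2))"
    by (rule integral_cong) (simp add: a)
  also have "\<dots> = of_real (integral {0..R} (\<lambda>x. (a x)\<^sup>2))"
    by (rule integral_unique, rule has_integral_of_real, rule integrable_integral)
       (intro integrable_continuous_real continuous_intros c)
  finally have e: "phi_norm \<kappa> = of_real (integral {0..R} (\<lambda>x. (a x)\<^sup>2) + (a R)\<^sup>2 / (2 * \<kappa>))"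
    by (simp add: phi_norm_def \<mu>_def[symmetric] a[OF R_in] del: of_real_minus)
  have ge: "integral {0..R} (\<lambda>x. (a x)\<^sup>2) \<ge> 0"
    by (intro integral_nonneg integrable_continuous_real continuous_intros c) simp
  have "integral {0..R} (\<lambda>x. (a x)\<^sup>2) \<noteq> 0"
  proof
    assume "integral {0..R} (\<lambda>x. (a x)\<^sup>2) = 0"
    then have "\<forall>x\<in>{0..R}. (a x)\<^sup>2 = 0"
      using R_pos by (subst (asm) integral_eq_0_iff) (auto intro!: continuous_intros c)
    then have z: "phi \<mu> x = 0" if "x \<in> {0..R}" for x using a that by simp
    have "(phi \<mu> has_vector_derivative quasi_phi \<mu> 0 / of_real (p 0)) (at 0 within {0..R})"
      using bspec[OF system_phi[unfolded system_def], of 0 \<mu>] R_pos by simp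
    moreover have "((\<lambda>x. 0::complex) has_vector_derivative 0) (at 0 within {0..R})" by simp
    then have "(phi \<mu> has_vector_derivative 0) (at 0 within {0..R})"
      by (rule has_vector_derivative_transform[rotated 2]) (use z R_pos in auto)
    moreover have "at 0 within {0..R} \<noteq> bot"
      using R_pos by (simp add: at_within_Icc_at_right trivial_limit_at_right_real)
    ultimately have "quasi_phi \<mu> 0 / of_real (p 0) = 0"
      using vector_derivative_unique_within by blast
    then show False using p_pos[of 0] R_pos by simp
  qed
  with ge have "integral {0..R} (\<lambda>x. (a x)\<^sup>2) + (a R)\<^sup>2 / (2 * \<kappa>) > 0"
    using assms by (intro add_pos_nonneg) auto
  with e show ?thesis by blast
qed

text \<open>
  By \<open>jost_factor\<close> the derivative of \<open>jost\<close> at \<open>i \<kappa>\<close> is \<open>- 2 i \<kappa> phi_norm \<kappa> / phi(R)\<close>, and at a zero of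
  \<open>jost\<close> the boundary values of \<open>phi\<close> are proportional to \<open>(1, - \<kappa>)\<close>, which turns \<open>boundary_h\<close> into
  \<open>- right_coeff / phi(R)\<close>.
\<close>

lemma residue_at_eigenvalue:
  fixes \<kappa> :: real
  assumes \<kappa>: "\<kappa> > 0" and z: "jost (\<i> * \<kappa>) = 0"
    and W: "W holomorphic_on UNIV"
    and f: "\<And>k. k \<noteq> 0 \<Longrightarrow> jost k \<noteq> 0 \<Longrightarrow> f k = W k * (2 * k * resolvent k)"
  shows "residue f (\<i> * \<kappa>) = - W (\<i> * \<kappa>) * left_coeff (\<i> * \<kappa>) * right_coeff (\<i> * \<kappa>) / phi_norm \<kappa>"
proof -
  define z0 where "z0 = \<i> * complex_of_real \<kappa>"
  define \<mu> where "\<mu> = complex_of_real (- \<kappa>\<^sup>2)"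
  define a where "a = phi \<mu> R"
  have z0: "z0 \<noteq> 0" "z0\<^sup>2 = \<mu>" using \<kappa> by (simp_all add: z0_def \<mu>_def power_mult_distrib)
  have a: "a \<noteq> 0" unfolding a_def \<mu>_def by (rule jost_factor(1)[OF z])
  define N where "N k = - (k + z0) * integral {0..R} (\<lambda>x. phi \<mu> x * phi (k\<^sup>2) x)
      - \<i> * phi (k\<^sup>2) R * a" for k
  have jN: "jost k * a = (k - z0) * N k" for k
    unfolding a_def \<mu>_def N_def z0_def by (rule jost_factor(2)[OF z])
  have N_holo: "N holomorphic_on UNIV"
    unfolding N_def[abs_def]
    by (intro holomorphic_intros integral_phi_holomorphic phi_continuous R_in)
  have I: "integral {0..R} (\<lambda>x. phi \<mu> x * phi (z0\<^sup>2) x) = integral {0..R} (\<lambda>x. (phi \<mu> x)\<^sup>2)"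
    unfolding z0 by (simp add: power2_eq_square)
  have N0: "N z0 = - 2 * z0 * phi_norm \<kappa>"
  proof -
    have e1: "N z0 = - 2 * z0 * integral {0..R} (\<lambda>x. (phi \<mu> x)\<^sup>2) - \<i> * a * a"
      unfolding N_def I unfolding z0(2) a_def by simp
    have e2: "phi_norm \<kappa> = integral {0..R} (\<lambda>x. (phi \<mu> x)\<^sup>2) + a\<^sup>2 / (2 * \<kappa>)"
      unfolding phi_norm_def \<mu>_def a_def ..
    show ?thesis
      unfolding e1 e2 unfolding z0_def using \<kappa> by (simp add: field_simps power2_eq_square)
  qed
  have pn: "phi_norm \<kappa> \<noteq> 0" using phi_norm_pos[OF \<kappa>] by auto
  then have N0': "N z0 \<noteq> 0" using N0 z0 by simp
  define S where "S = {k. k \<noteq> 0 \<and> N k \<noteq> 0}"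
  have S: "open S" "z0 \<in> S"
  proof -
    have "continuous_on UNIV N" by (rule holomorphic_on_imp_continuous_on[OF N_holo])
    then have "open (N -` (-{0}))" by (rule open_vimage[rotated]) auto
    moreover have "S = (-{0}) \<inter> N -` (-{0})" by (auto simp: S_def)
    ultimately show "open S" by auto
    show "z0 \<in> S" using z0 N0' by (simp add: S_def)
  qed
  define F where "F k = W k * 2 * k * (gsol k * (k - z0) - left_coeff k * boundary_h k * a / N k)" for k
  have F: "F holomorphic_on S"
    unfolding F_def[abs_def]
    by (intro holomorphic_intros holomorphic_on_subset[OF W] holomorphic_on_subset[OF N_holo])
       (auto simp: S_def)
  have "residue f z0 = residue (\<lambda>k. F k / (k - z0)) z0"
  proof (rule residue_cong)
    have "eventually (\<lambda>k. k \<in> S - {z0}) (at z0)"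
      using S by (intro eventually_at_in_open) auto
    then show "eventually (\<lambda>k. f k = F k / (k - z0)) (at z0)"
    proof (rule eventually_mono)
      fix k assume k: "k \<in> S - {z0}"
      then have k': "k \<noteq> 0" "N k \<noteq> 0" "k - z0 \<noteq> 0" by (auto simp: S_def)
      with jN[of k] a have jk: "jost k \<noteq> 0" by auto
      have j: "jost k = (k - z0) * N k / a" using jN[of k] a by (simp add: field_simps)
      show "f k = F k / (k - z0)"
        unfolding f[OF k'(1) jk] resolvent_def F_def j using k' a by (simp add: field_simps)
    qed
  qed simp
  also have "\<dots> = F z0" by (rule residue_simple[OF S F])
  also have "F z0 = W z0 * left_coeff z0 * (boundary_h z0 * a) / phi_norm \<kappa>"
    unfolding F_def N0 using z0 pn by (simp add: field_simps)
  also have "boundary_h z0 * a = - right_coeff z0"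
  proof -
    have "quasi_phi \<mu> R = \<i> * z0 * a"
      using z unfolding jost_def z0_def[symmetric] z0(2) by (simp add: a_def)
    then show ?thesis
      unfolding boundary_h_def right_coeff_boundary z0(2) a_def[symmetric] by (simp add: algebra_simps)
  qed
  finally show ?thesis by (simp add: z0_def)
qed

end

section \<open>The weighted contour identity\<close>

context sl_pair
begin

text \<open>
  The residue theorem for \<open>(1 - k\<^sup>4 / A\<^sup>4) 2 k resolvent k\<close> on the upper half disc.  The explicit part
  \<open>- 2 pairing / k\<close> of the integrand contributes \<open>- 2 \<pi> i pairing\<close> on the arc, since \<open>k\<^sup>3\<close> integrates
  to zero there.
\<close>

theorem contour_identity:
  fixes Z :: "real set" and A :: real
  assumes A: "A > 0" and fin: "finite Z" and Z: "\<And>\<kappa>. \<kappa> \<in> Z \<Longrightarrow> 0 < \<kappa> \<and> \<kappa> < A"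
    and zero: "\<And>\<kappa>. \<kappa> > 0 \<Longrightarrow> jost (\<i> * complex_of_real \<kappa>) = 0 \<longleftrightarrow> \<kappa> \<in> Z"
  shows "\<exists>K::complex. ((\<lambda>x. of_real (1 - x ^ 4 / A ^ 4) * momentum_density x) has_integral K) {0..A} \<and>
    norm (pairing - 2 / pi * K - (\<Sum>\<kappa>\<in>Z. of_real (1 - \<kappa> ^ 4 / A ^ 4) *
      (left_coeff (\<i> * \<kappa>) * right_coeff (\<i> * \<kappa>) / phi_norm \<kappa>))) \<le> test_energy / A\<^sup>2"
proof -
  obtain M N where MN: "M holomorphic_on UNIV" "N holomorphic_on UNIV" "N 0 \<noteq> 0"
    "\<And>k. k \<noteq> 0 \<Longrightarrow> N k = 0 \<longleftrightarrow> jost k = 0" "\<And>k. k \<noteq> 0 \<Longrightarrow> M k / N k = 2 * k / jost k"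
    using jost_quotient by blast
  define W where "W k = 1 - k ^ 4 / complex_of_real A ^ 4" for k
  have W: "W holomorphic_on S" for S
    unfolding W_def[abs_def] using A by (intro holomorphic_intros) auto
  define f where "f k = W k * (2 * k * gsol k - left_coeff k * boundary_h k * (M k / N k))" for k
  have f_eq: "f k = W k * (2 * k * resolvent k)" if "k \<noteq> 0" for k
    unfolding f_def MN(5)[OF that] resolvent_def by (simp add: algebra_simps)
  define pts where "pts = {z \<in> ball 0 (A + 1). N z = 0}"
  have fin_pts: "finite pts"
  proof (cases "N constant_on UNIV")
    case True
    then have "N z \<noteq> 0" for z using MN(3) unfolding constant_on_def by (metis UNIV_I)
    then have "pts = {}" by (simp add: pts_def)
    then show ?thesis by simp
  next
    case False
    have "finite {z \<in> cball 0 (A + 1). N z = 0}"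
      by (rule holomorphic_compact_finite_zeros[OF MN(2)]) (use False in auto)
    then show ?thesis by (rule rev_finite_subset) (auto simp: pts_def)
  qed
  have holo: "f holomorphic_on ball 0 (A + 1) - pts"
    unfolding f_def[abs_def]
    by (intro holomorphic_intros W holomorphic_on_subset[OF MN(1)] holomorphic_on_subset[OF MN(2)])
       (auto simp: pts_def)
  have zeros: "\<exists>\<kappa>\<in>Z. z = \<i> * complex_of_real \<kappa>" if "N z = 0" "Im z \<ge> 0" for z
  proof -
    have "z \<noteq> 0" using that MN(3) by auto
    then have jz: "jost z = 0" using that MN(4) by blast
    have "Im z \<noteq> 0"
    proof
      assume "Im z = 0"
      then have "z = of_real (Re z)" by (simp add: complex_eq_iff)
      with jz jost_nonzero_real[of "Re z"] \<open>z \<noteq> 0\<close> show False by force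
    qed
    with that have Im: "Im z > 0" by simp
    then have "Re z = 0" using jost_nonzero_upper jz by blast
    then have "z = \<i> * complex_of_real (Im z)" by (simp add: complex_eq_iff)
    with zero[OF Im] jz show ?thesis by metis
  qed
  have pts: "Im z < 0 \<or> Im z > 0 \<and> norm z < A" if "z \<in> pts" for z
    using that
  proof (cases "Im z < 0")
    case False
    then obtain \<kappa> where "\<kappa> \<in> Z" "z = \<i> * complex_of_real \<kappa>"
      using zeros[of z] \<open>z \<in> pts\<close> unfolding pts_def by force
    then show ?thesis using Z[of \<kappa>] by (simp add: norm_mult)
  qed simp
  have pts_sub: "pts \<subseteq> ball 0 (A + 1)" by (auto simp: pts_def)
  note half_disc = half_disc_residue_theorem[OF A fin_pts holo pts_sub pts]
  have upper: "{z \<in> pts. Im z > 0} = (\<lambda>\<kappa>. \<i> * complex_of_real \<kappa>) ` Z"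
  proof (intro equalityI subsetI)
    fix z assume "z \<in> {z \<in> pts. Im z > 0}"
    then show "z \<in> (\<lambda>\<kappa>. \<i> * complex_of_real \<kappa>) ` Z" using zeros[of z] by (auto simp: pts_def)
  next
    fix z assume "z \<in> (\<lambda>\<kappa>. \<i> * complex_of_real \<kappa>) ` Z"
    then obtain \<kappa> where \<kappa>: "\<kappa> \<in> Z" "z = \<i> * complex_of_real \<kappa>" by blast
    then have "N z = 0" using Z[of \<kappa>] zero[of \<kappa>] MN(4)[of z] by simp
    then show "z \<in> {z \<in> pts. Im z > 0}" using \<kappa> Z[of \<kappa>] by (simp add: pts_def norm_mult)
  qed
  define \<Phi> where "\<Phi> \<kappa> = left_coeff (\<i> * \<kappa>) * right_coeff (\<i> * \<kappa>) / phi_norm \<kappa>" for \<kappa> :: real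
  have res: "residue f (\<i> * complex_of_real \<kappa>) = - (of_real (1 - \<kappa> ^ 4 / A ^ 4) * \<Phi> \<kappa>)" if "\<kappa> \<in> Z" for \<kappa>
  proof -
    have r: "residue f (\<i> * complex_of_real \<kappa>) = - W (\<i> * \<kappa>) * left_coeff (\<i> * \<kappa>) * right_coeff (\<i> * \<kappa>) / phi_norm \<kappa>"
      by (rule residue_at_eigenvalue[OF _ _ W f_eq]) (use Z[OF that] zero[of \<kappa>] that in auto)
    have w: "W (\<i> * \<kappa>) = of_real (1 - \<kappa> ^ 4 / A ^ 4)"
      by (simp add: W_def power_mult_distrib)
    show ?thesis unfolding r w \<Phi>_def by (simp only: mult_minus_left minus_divide_left[symmetric]
          times_divide_eq_right mult.assoc)
  qed
  have sum_res: "(\<Sum>z | z \<in> pts \<and> Im z > 0. residue f z) =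
      - (\<Sum>\<kappa>\<in>Z. of_real (1 - \<kappa> ^ 4 / A ^ 4) * \<Phi> \<kappa>)"
    unfolding upper
    by (subst sum.reindex) (auto simp: inj_on_def res sum_negf[symmetric])

  have fc: "continuous_on {-A..A} (\<lambda>x. f (of_real x))" by (rule half_disc(2))
  define K where "K = integral {-A..A} (\<lambda>x. f (of_real x)) / (4 * \<i>)"
  have K: "((\<lambda>x. of_real (1 - x ^ 4 / A ^ 4) * momentum_density x) has_integral K) {0..A}"
  proof -
    have c1: "(\<lambda>x. f (of_real x)) integrable_on {-A..A}"
      by (rule integrable_continuous_real[OF fc])
    have i0: "((\<lambda>x. f (of_real x)) has_integral integral {-A..0} (\<lambda>x. f (of_real x))) {-A..0}"
      by (rule integrable_integral, rule integrable_subinterval_real[OF c1]) (use A in auto)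
    have i1: "((\<lambda>x. f (of_real x)) has_integral integral {0..A} (\<lambda>x. f (of_real x))) {0..A}"
      by (rule integrable_integral, rule integrable_subinterval_real[OF c1]) (use A in auto)
    have i2: "((\<lambda>x. f (of_real (- x))) has_integral integral {-A..0} (\<lambda>x. f (of_real x))) {0..A}"
      using has_integral_reflect_real[where f="\<lambda>x. f (of_real x)" and a="-A" and b=0] i0 by simp
    have "integral {-A..A} (\<lambda>x. f (of_real x)) =
        integral {-A..0} (\<lambda>x. f (of_real x)) + integral {0..A} (\<lambda>x. f (of_real x))"
      using Henstock_Kurzweil_Integration.integral_combine[OF _ _ c1, of 0] A by simp
    then have "((\<lambda>x. f (of_real x) + f (of_real (- x))) has_integral integral {-A..A} (\<lambda>x. f (of_real x))) {0..A}"
      using has_integral_add[OF i1 i2] by (simp add: add.commute)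
    then have 1: "((\<lambda>x. (f (of_real x) + f (of_real (- x))) / (4 * \<i>)) has_integral K) {0..A}"
      unfolding K_def by (rule has_integral_divide)
    \<comment> \<open>The point \<open>0\<close> is excluded because the density takes a default value there when \<open>jost 0 = 0\<close>.\<close>
    show ?thesis
    proof (rule has_integral_spike_finite[OF _ _ 1, of "{0}"])
      fix x :: real assume "x \<in> {0..A} - {0}"
      then have x: "x \<noteq> 0" by simp
      have "f (of_real x) + f (of_real (- x)) =
          W x * (2 * x * (resolvent x - resolvent (- complex_of_real x)))"
        using x by (subst (1 2) f_eq) (auto simp: W_def algebra_simps)
      also have "\<dots> = W x * (4 * \<i> * momentum_density x)"
        unfolding resolvent_jump[OF x] momentum_density_def by (simp add: power2_eq_square)
      finally have e: "f (of_real x) + f (of_real (- x)) = W x * (4 * \<i> * momentum_density x)" .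
      have w: "W x = of_real (1 - x ^ 4 / A ^ 4)" by (simp add: W_def)
      have "c * d = c * (4 * \<i> * d) / (4 * \<i>)" for c d :: complex by (simp add: field_simps)
      then show "of_real (1 - x ^ 4 / A ^ 4) * momentum_density x = (f (of_real x) + f (of_real (- x))) / (4 * \<i>)"
        unfolding e w .
    qed simp
  qed
  have arc: "norm (contour_integral (part_circlepath 0 A 0 pi) f + 2 * pi * \<i> * pairing) \<le> 2 * pi * (test_energy / A\<^sup>2)"
  proof -
    have i1: "(f has_contour_integral contour_integral (part_circlepath 0 A 0 pi) f) (part_circlepath 0 A 0 pi)"
      by (rule has_contour_integral_integral[OF half_disc(1)])
    have "((\<lambda>k. 2 * pairing * (1 / k - k ^ 3 / complex_of_real A ^ 4)) has_contour_integral
        2 * pairing * (\<i> * pi - 0 / complex_of_real A ^ 4)) (part_circlepath 0 A 0 pi)"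
      by (intro has_contour_integral_lmul has_contour_integral_diff has_contour_integral_div
          has_contour_integral_inverse_upper_arc[OF A] has_contour_integral_cube_upper_arc)
    from has_contour_integral_add[OF i1 this]
    have i2: "((\<lambda>k. f k + 2 * pairing * (1 / k - k ^ 3 / complex_of_real A ^ 4)) has_contour_integral
        contour_integral (part_circlepath 0 A 0 pi) f + 2 * pi * \<i> * pairing) (part_circlepath 0 A 0 pi)"
      by (simp add: mult_ac)
    have test_energy: "test_energy \<ge> 0"
      unfolding test_energy_def
      by (intro add_nonneg_nonneg integral_nonneg integrable_continuous_real continuous_intros
          g_cont Dh_cont) auto
    have "norm (contour_integral (part_circlepath 0 A 0 pi) f + 2 * pi * \<i> * pairing) \<le>
        2 * test_energy / A ^ 3 * A * (pi - 0)"
    proof (rule has_contour_integral_bound_part_circlepath_strong[OF i2])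
      \<comment> \<open>The resolvent bound says nothing where the arc meets the coordinate axes.\<close>
      show "finite {complex_of_real A, - of_real A, \<i> * of_real A}" by simp
      fix k assume k: "k \<in> path_image (part_circlepath 0 A 0 pi) - {complex_of_real A, - of_real A, \<i> * of_real A}"
      then have nk: "norm k = A" "Im k \<ge> 0" using upper_arc_image[OF A] by auto
      have k0: "k \<noteq> 0" using nk A by auto
      have sq: "(Re k)\<^sup>2 + (Im k)\<^sup>2 = A\<^sup>2" using nk(1) by (simp add: cmod_power2[symmetric])
      have "Im k \<noteq> 0"
      proof
        assume "Im k = 0"
        with sq have "Re k = A \<or> Re k = - A" by (simp add: power2_eq_iff)
        with \<open>Im k = 0\<close> k show False by (auto simp: complex_eq_iff)
      qed
      then have Im: "Im k > 0" using nk by simp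
      have Re: "Re k \<noteq> 0"
      proof
        assume "Re k = 0"
        with sq Im A have "Im k = A" by (simp add: power2_eq_iff)
        with \<open>Re k = 0\<close> k show False by (auto simp: complex_eq_iff)
      qed
      have pos: "\<bar>Im (k\<^sup>2)\<bar> > 0" using Im Re by (simp add: power2_eq_square)
      have "f k + 2 * pairing * (1 / k - k ^ 3 / complex_of_real A ^ 4) =
          W k * (2 / k) * (pairing + k\<^sup>2 * resolvent k)"
        unfolding f_eq[OF k0] W_def using k0 A
        by (simp add: field_simps power2_eq_square power3_eq_cube power4_eq_xxxx)
      also have "norm \<dots> = (2 * \<bar>Im (k\<^sup>2)\<bar> / A\<^sup>2) * (2 / A) * norm (pairing + k\<^sup>2 * resolvent k)"
        unfolding norm_mult W_def weight_norm_on_circle[OF nk(1) A] by (simp add: norm_divide nk)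
      also have "\<dots> \<le> (2 * \<bar>Im (k\<^sup>2)\<bar> / A\<^sup>2) * (2 / A) * (test_energy / (2 * \<bar>Im (k\<^sup>2)\<bar>))"
        using A by (intro mult_left_mono resolvent_bound[OF Im Re]) auto
      also have "\<dots> = 2 * test_energy / A ^ 3"
        using pos A by (simp add: field_simps power2_eq_square power3_eq_cube)
      finally show "norm (f k + 2 * pairing * (1 / k - k ^ 3 / complex_of_real A ^ 4)) \<le> 2 * test_energy / A ^ 3" .
    qed (use A test_energy in auto)
    then show ?thesis using A by (simp add: field_simps power2_eq_square power3_eq_cube)
  qed
  define E where "E = contour_integral (part_circlepath 0 A 0 pi) f + 2 * pi * \<i> * pairing"
  define S where "S = (\<Sum>\<kappa>\<in>Z. of_real (1 - \<kappa> ^ 4 / A ^ 4) * \<Phi> \<kappa>)"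
  have "E - 2 * pi * \<i> * pairing + 4 * \<i> * K = 2 * pi * \<i> * (- S)"
    using half_disc(3) unfolding sum_res K_def E_def S_def by simp
  then have E: "E = 2 * pi * \<i> * pairing - 4 * \<i> * K - 2 * pi * \<i> * S"
    by (simp add: algebra_simps)
  have "pairing - 2 / pi * K - S = E / (2 * pi * \<i>)"
    unfolding E by (simp add: field_simps)
  then have "norm (pairing - 2 / pi * K - S) = norm E / (2 * pi)"
    by (simp add: norm_divide norm_mult)
  also have "\<dots> \<le> test_energy / A\<^sup>2"
    using arc unfolding E_def by (simp add: field_simps)
  finally show ?thesis using K unfolding S_def \<Phi>_def by blast
qed

end

section \<open>Removing the weight\<close>

definition (in sl_interval) bound_states :: "real set" where
  "bound_states = {\<kappa>. \<kappa> > 0 \<and> jost (\<i> * complex_of_real \<kappa>) = 0}"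

context sl_pair
begin

definition eig_term :: "real \<Rightarrow> complex" where
  "eig_term \<kappa> = left_coeff (\<i> * \<kappa>) * right_coeff (\<i> * \<kappa>) / phi_norm \<kappa>"

text \<open>
  The contour identity along a sequence of radii that exceed all bound states, with the cut-off
  integrals extended to one common domain.
\<close>

lemma cutoff_identity:
  assumes fin: "finite bound_states"
  obtains A :: "nat \<Rightarrow> real" and K :: "nat \<Rightarrow> complex" where
    "\<And>n. A n > 0" "incseq A" "filterlim A at_top sequentially"
    "\<And>n. ((\<lambda>x. if x \<in> {0..A n} then of_real (1 - x ^ 4 / A n ^ 4) * momentum_density x else 0) has_integral K n) {0..}"
    "(\<lambda>n. 2 / pi * K n) \<longlonglongrightarrow> pairing - (\<Sum>\<kappa>\<in>bound_states. eig_term \<kappa>)"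
proof -
  \<comment> \<open>The sum of all bound states is a convenient upper bound for each of them.\<close>
  define A where "A n = (1 + (\<Sum>\<kappa>\<in>bound_states. \<kappa>)) + real n" for n
  have "(\<Sum>\<kappa>\<in>bound_states. \<kappa>) \<ge> 0"
    by (rule sum_nonneg) (auto simp: bound_states_def)
  then have A_pos: "A n > 0" for n by (simp add: A_def)
  have less: "0 < \<kappa> \<and> \<kappa> < A n" if "\<kappa> \<in> bound_states" for \<kappa> n
  proof -
    have "\<kappa> \<le> (\<Sum>\<kappa>\<in>bound_states. \<kappa>)"
      using that fin by (intro member_le_sum) (auto simp: bound_states_def)
    with that show ?thesis by (auto simp: A_def bound_states_def)
  qed
  have inc: "incseq A" by (auto simp: A_def incseq_def)
  have lim: "filterlim A at_top sequentially"
    unfolding A_def by (rule filterlim_tendsto_add_at_top[OF tendsto_const filterlim_real_sequentially])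
  have "\<forall>n. \<exists>K::complex. ((\<lambda>x. of_real (1 - x ^ 4 / A n ^ 4) * momentum_density x) has_integral K) {0..A n} \<and>
    norm (pairing - 2 / pi * K - (\<Sum>\<kappa>\<in>bound_states. of_real (1 - \<kappa> ^ 4 / A n ^ 4) * eig_term \<kappa>)) \<le> test_energy / (A n)\<^sup>2"
    unfolding eig_term_def
    by (rule allI, rule contour_identity[OF A_pos fin less]) (auto simp: bound_states_def)
  from choice[OF this] obtain K :: "nat \<Rightarrow> complex" where KK:
    "\<forall>n. ((\<lambda>x. of_real (1 - x ^ 4 / A n ^ 4) * momentum_density x) has_integral K n) {0..A n} \<and>
      norm (pairing - 2 / pi * K n - (\<Sum>\<kappa>\<in>bound_states. of_real (1 - \<kappa> ^ 4 / A n ^ 4) * eig_term \<kappa>)) \<le> test_energy / (A n)\<^sup>2" ..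
  note K = conjunct1[OF KK[rule_format]] and err = conjunct2[OF KK[rule_format]]
  have K': "((\<lambda>x. if x \<in> {0..A n} then of_real (1 - x ^ 4 / A n ^ 4) * momentum_density x else 0) has_integral K n) {0..}" for n
    by (rule has_integral_restrict[THEN iffD2, OF _ K]) auto
  have inv0: "(\<lambda>n. c / A n ^ m) \<longlonglongrightarrow> 0" if "m > 0" for c :: real and m
    by (rule real_tendsto_divide_at_top[OF tendsto_const filterlim_pow_at_top[OF that lim]])
  define S where "S n = (\<Sum>\<kappa>\<in>bound_states. of_real (1 - \<kappa> ^ 4 / A n ^ 4) * eig_term \<kappa>)" for n
  define e where "e n = pairing - 2 / pi * K n - S n" for n
  have "e \<longlonglongrightarrow> 0"
    by (rule Lim_null_comparison[OF always_eventually inv0[of 2 test_energy]])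
       (use err in \<open>auto simp: e_def S_def\<close>)
  moreover have "S \<longlonglongrightarrow> (\<Sum>\<kappa>\<in>bound_states. of_real (1 - 0) * eig_term \<kappa>)"
    unfolding S_def by (intro tendsto_intros inv0) simp
  ultimately have "(\<lambda>n. pairing - e n - S n) \<longlonglongrightarrow> pairing - 0 - (\<Sum>\<kappa>\<in>bound_states. of_real (1 - 0) * eig_term \<kappa>)"
    using tendsto_diff tendsto_const by blast
  then have "(\<lambda>n. 2 / pi * K n) \<longlonglongrightarrow> pairing - (\<Sum>\<kappa>\<in>bound_states. eig_term \<kappa>)"
    by (simp add: e_def)
  from that[OF A_pos inc lim K' this] show ?thesis .
qed

lemma cutoff_tendsto:
  assumes "filterlim A at_top sequentially" "x \<ge> 0"
  shows "(\<lambda>n. if x \<in> {0..A n} then of_real (1 - x ^ 4 / A n ^ 4) * momentum_density x else 0) \<longlonglongrightarrow> momentum_density x"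
proof -
  have inv0: "(\<lambda>n. x ^ 4 / A n ^ 4) \<longlonglongrightarrow> 0"
    by (rule real_tendsto_divide_at_top[OF tendsto_const filterlim_pow_at_top[OF _ assms(1)]]) simp
  have "(\<lambda>n. of_real (1 - x ^ 4 / A n ^ 4) * momentum_density x) \<longlonglongrightarrow> of_real (1 - 0) * momentum_density x"
    by (intro tendsto_intros inv0)
  then have "(\<lambda>n. of_real (1 - x ^ 4 / A n ^ 4) * momentum_density x) \<longlonglongrightarrow> momentum_density x"
    by (simp only: diff_zero of_real_1 mult_1_left)
  moreover have "eventually (\<lambda>n. of_real (1 - x ^ 4 / A n ^ 4) * momentum_density x =
      (if x \<in> {0..A n} then of_real (1 - x ^ 4 / A n ^ 4) * momentum_density x else 0)) sequentially"
    using assms(1)[unfolded filterlim_at_top, rule_format, of x]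
    by eventually_elim (use assms(2) in auto)
  ultimately show ?thesis
    by (rule Lim_transform_eventually)
qed

lemma weight_bounds:
  assumes "x \<in> {0..A::real}" "A > 0"
  shows "0 \<le> 1 - x ^ 4 / A ^ 4" "1 - x ^ 4 / A ^ 4 \<le> 1"
proof -
  have "x ^ 4 \<le> A ^ 4" using assms by (intro power_mono) auto
  then show "0 \<le> 1 - x ^ 4 / A ^ 4" using assms by (simp add: divide_le_eq)
  show "1 - x ^ 4 / A ^ 4 \<le> 1" using assms by simp
qed

theorem expansion_if_dominated:
  assumes fin: "finite bound_states"
    and D: "D integrable_on {0..}" "\<And>x. x \<ge> 0 \<Longrightarrow> norm (momentum_density x) \<le> D x"
  shows "momentum_density absolutely_integrable_on {0..}"
    and "pairing = (\<Sum>\<kappa>\<in>bound_states. eig_term \<kappa>) + 2 / pi * integral {0..} momentum_density"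
proof -
  obtain A and K :: "nat \<Rightarrow> complex" where A: "\<And>n. A n > 0" "incseq A" "filterlim A at_top sequentially"
    and K: "\<And>n. ((\<lambda>x. if x \<in> {0..A n} then of_real (1 - x ^ 4 / A n ^ 4) * momentum_density x else 0) has_integral K n) {0..}"
    and lim: "(\<lambda>n. 2 / pi * K n) \<longlonglongrightarrow> pairing - (\<Sum>\<kappa>\<in>bound_states. eig_term \<kappa>)"
    by (rule cutoff_identity[OF fin]) (rule that; assumption)
  have le: "norm (if x \<in> {0..A n} then of_real (1 - x ^ 4 / A n ^ 4) * momentum_density x else 0) \<le> D x"
    if "x \<in> {0..}" for n x
  proof (cases "x \<in> {0..A n}")
    case True
    have "norm (of_real (1 - x ^ 4 / A n ^ 4) * momentum_density x) \<le> 1 * norm (momentum_density x)"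
      unfolding norm_mult norm_of_real
      using weight_bounds[OF True A(1)] by (intro mult_right_mono) auto
    with True D(2)[of x] that show ?thesis by auto
  next
    case False
    have "0 \<le> D x" using order_trans[OF norm_ge_zero D(2)[of x]] that by simp
    then show ?thesis unfolding if_not_P[OF False] norm_zero .
  qed
  have "momentum_density integrable_on {0..}" and lim2: "K \<longlonglongrightarrow> integral {0..} momentum_density"
  proof -
    have c: "(\<lambda>n. if x \<in> {0..A n} then of_real (1 - x ^ 4 / A n ^ 4) * momentum_density x else 0) \<longlonglongrightarrow> momentum_density x"
      if "x \<in> {0..}" for x
      using cutoff_tendsto[OF A(3)] that by simp
    note dc = dominated_convergence[OF has_integral_integrable[OF K] D(1) le c]
    show "momentum_density integrable_on {0..}" using dc(1) .
    show "K \<longlonglongrightarrow> integral {0..} momentum_density" using dc(2) unfolding integral_unique[OF K] .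
  qed
  then show "momentum_density absolutely_integrable_on {0..}"
    by (intro absolutely_integrable_integrable_bound[OF _ _ D(1)]) (use D(2) in auto)
  have "(\<lambda>n. 2 / pi * K n) \<longlonglongrightarrow> 2 / pi * integral {0..} momentum_density"
    by (intro tendsto_intros lim2)
  from LIMSEQ_unique[OF lim this]
  show "pairing = (\<Sum>\<kappa>\<in>bound_states. eig_term \<kappa>) + 2 / pi * integral {0..} momentum_density"
    by (simp add: algebra_simps)
qed

lemma left_coeff_eq_cnj:
  "left_coeff (complex_of_real x) = cnj (integral {0..R} (\<lambda>t. phi ((complex_of_real x)\<^sup>2) t * g t))"
  unfolding left_coeff_def integral_cnj
  by (rule integral_cong) (simp only: complex_cnj_mult phi_cnj complex_cnj_power
      complex_cnj_complex_of_real mult.commute)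

text \<open>
  For real \<open>x\<close> the density is the product of the two transforms with a nonnegative factor that depends on
  \<open>x\<close> but not on the test functions.  This gives positivity for \<open>g = h\<close> and the comparison of
  different pairs.
\<close>

lemma momentum_density_factor:
  obtains d where "d \<ge> 0" "momentum_density x = left_coeff (of_real x) * right_coeff (of_real x) * of_real d"
    "(complex_of_real x)\<^sup>2 / ((quasi_phi ((of_real x)\<^sup>2) R)\<^sup>2 + (of_real x)\<^sup>2 * (phi ((of_real x)\<^sup>2) R)\<^sup>2) = of_real d"
proof -
  define a where "a = Re (phi (of_real (x\<^sup>2)) R)"
  define b where "b = Re (quasi_phi (of_real (x\<^sup>2)) R)"
  have ab: "phi ((complex_of_real x)\<^sup>2) R = of_real a" "quasi_phi ((complex_of_real x)\<^sup>2) R = of_real b"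
    unfolding a_def b_def phi_real[OF R_in] by (simp_all only: of_real_power)
  \<comment> \<open>At \<open>x = 0\<close> with a zero-energy resonance the quotient is \<open>0 / 0 = 0\<close>; a single point does not matter.\<close>
  define d where "d = x\<^sup>2 / (b\<^sup>2 + x\<^sup>2 * a\<^sup>2)"
  have e: "(complex_of_real x)\<^sup>2 / ((quasi_phi ((of_real x)\<^sup>2) R)\<^sup>2 + (of_real x)\<^sup>2 * (phi ((of_real x)\<^sup>2) R)\<^sup>2) = of_real d"
    unfolding ab d_def by simp
  have "momentum_density x = left_coeff (of_real x) * right_coeff (of_real x) *
      ((complex_of_real x)\<^sup>2 / ((quasi_phi ((of_real x)\<^sup>2) R)\<^sup>2 + (of_real x)\<^sup>2 * (phi ((of_real x)\<^sup>2) R)\<^sup>2))"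
    unfolding momentum_density_def by (simp only: times_divide_eq_right mult_ac)
  then have "momentum_density x = left_coeff (of_real x) * right_coeff (of_real x) * of_real d" unfolding e .
  from that[OF _ this e] show ?thesis by (simp add: d_def)
qed

text \<open>
  For \<open>g = h\<close> the density is nonnegative and the weights increase with the radius, so the boundedness of the
  cut-off integrals, which converge by \<open>cutoff_identity\<close>, is enough.
\<close>

theorem momentum_density_diagonal_integrable:
  assumes fin: "finite bound_states" and diag: "g = h"
  shows "(\<lambda>x. norm (momentum_density x)) integrable_on {0..}"
proof -
  have real: "momentum_density x = of_real (norm (momentum_density x))" for x
  proof -
    obtain d where d: "d \<ge> 0" "momentum_density x = left_coeff x * right_coeff x * complex_of_real d"
      using momentum_density_factor[of x] by metis
    have c: "left_coeff x = cnj (right_coeff x)"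
      using left_coeff_eq_cnj[of x] by (simp only: right_coeff_def diag)
    have "momentum_density x = (right_coeff x * cnj (right_coeff x)) * complex_of_real d"
      unfolding d(2) c by (simp add: mult_ac)
    also have "\<dots> = of_real ((norm (right_coeff x))\<^sup>2 * d)" by (simp only: complex_norm_square of_real_mult)
    finally have e: "momentum_density x = of_real ((norm (right_coeff x))\<^sup>2 * d)" .
    have "(norm (right_coeff x))\<^sup>2 * d \<ge> 0" using d(1) by simp
    then show ?thesis unfolding e by (simp only: norm_of_real abs_of_nonneg)
  qed
  obtain A and K :: "nat \<Rightarrow> complex" where A: "\<And>n. A n > 0" "incseq A" "filterlim A at_top sequentially"
    and K: "\<And>n. ((\<lambda>x. if x \<in> {0..A n} then of_real (1 - x ^ 4 / A n ^ 4) * momentum_density x else 0) has_integral K n) {0..}"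
    and lim: "(\<lambda>n. 2 / pi * K n) \<longlonglongrightarrow> pairing - (\<Sum>\<kappa>\<in>bound_states. eig_term \<kappa>)"
    by (rule cutoff_identity[OF fin]) (rule that; assumption)
  define r where "r n x = (if x \<in> {0..A n} then (1 - x ^ 4 / A n ^ 4) * norm (momentum_density x) else 0)" for n x
  have Re_dens: "Re (momentum_density x) = norm (momentum_density x)" for x
    by (subst real) (rule Re_complex_of_real)
  have Re_mult_of_real: "Re (of_real w * z) = w * Re z" for w z by simp
  have r_eq: "Re (if x \<in> {0..A n} then of_real (1 - x ^ 4 / A n ^ 4) * momentum_density x else 0) = r n x" for n x
    by (cases "x \<in> {0..A n}") (simp_all only: r_def if_True if_False Re_mult_of_real Re_dens zero_complex.sel)
  have rK: "(r n has_integral Re (K n)) {0..}" for n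
    using has_integral_linear[OF K bounded_linear_Re, unfolded o_def r_eq, of n] by simp
  have "(\<lambda>x. norm (momentum_density x)) integrable_on {0..} \<and>
     (\<lambda>n. integral {0..} (r n)) \<longlonglongrightarrow> integral {0..} (\<lambda>x. norm (momentum_density x))"
  proof (rule monotone_convergence_increasing)
    show "r n integrable_on {0..}" for n using rK by blast
    fix x :: real assume x: "x \<in> {0..}"
    show "r n x \<le> r (Suc n) x" for n
    proof (cases "x \<in> {0..A n}")
      case True
      have An: "A n \<le> A (Suc n)" using A(2) by (simp add: incseq_SucD)
      have "x ^ 4 / A (Suc n) ^ 4 \<le> x ^ 4 / A n ^ 4"
        using An A(1)[of n] A(1)[of "Suc n"] x
        by (intro divide_left_mono power_mono mult_pos_pos zero_less_power) auto
      then have "(1 - x ^ 4 / A n ^ 4) * norm (momentum_density x) \<le> (1 - x ^ 4 / A (Suc n) ^ 4) * norm (momentum_density x)"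
        by (intro mult_right_mono) auto
      with True An show ?thesis by (simp add: r_def)
    next
      case False
      then show ?thesis using weight_bounds(1)[of x "A (Suc n)"] A(1)[of "Suc n"] by (auto simp: r_def)
    qed
    have "(\<lambda>n. Re (if x \<in> {0..A n} then of_real (1 - x ^ 4 / A n ^ 4) * momentum_density x else 0)) \<longlonglongrightarrow> Re (momentum_density x)"
      using cutoff_tendsto[OF A(3)] x by (intro tendsto_Re) auto
    then show "(\<lambda>n. r n x) \<longlonglongrightarrow> norm (momentum_density x)"
      unfolding r_eq Re_dens .
  next
    have "(\<lambda>n. of_real (pi / 2) * (2 / pi * K n)) \<longlonglongrightarrow> of_real (pi / 2) * (pairing - (\<Sum>\<kappa>\<in>bound_states. eig_term \<kappa>))"
      by (intro tendsto_intros lim)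
    then have "convergent (\<lambda>n. of_real (pi / 2) * (2 / pi * K n))" by (rule convergentI)
    then have "convergent K" by simp
    then have "Bseq K" by (rule convergent_imp_Bseq)
    then obtain B where "\<And>n. norm (K n) \<le> B" unfolding Bseq_def by blast
    then have "norm (Re (K n)) \<le> B" for n
      using order_trans[OF abs_Re_le_cmod, of "K n" B] by simp
    then show "bounded (range (\<lambda>n. integral {0..} (r n)))"
      unfolding integral_unique[OF rK] by (intro boundedI[of _ B]) auto
  qed
  then show ?thesis ..
qed

end

theorem expansion_in_momentum:
  assumes gg: "sl_pair p q R g g Dg qg" and hh: "sl_pair p q R h h Dh qh"
    and fin: "finite (sl_interval.bound_states p q R)"
  shows "sl_pair.momentum_density p q R g h absolutely_integrable_on {0..}"
    and "sl_pair.pairing R g h = (\<Sum>\<kappa>\<in>sl_interval.bound_states p q R. sl_pair.eig_term p q R g h \<kappa>)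
           + 2 / pi * integral {0..} (sl_pair.momentum_density p q R g h)"
proof -
  interpret gg: sl_pair p q R g g Dg qg by (rule gg)
  interpret hh: sl_pair p q R h h Dh qh by (rule hh)
  interpret gh: sl_pair p q R g h Dh qh by unfold_locales (rule gg.g_cont hh.Dh_cont hh.system_h hh.h_boundary)+
  have D: "(\<lambda>x. norm (gg.momentum_density x) + norm (hh.momentum_density x)) integrable_on {0..}"
    by (intro integrable_add gg.momentum_density_diagonal_integrable hh.momentum_density_diagonal_integrable fin refl)
  have le: "norm (gh.momentum_density x) \<le> norm (gg.momentum_density x) + norm (hh.momentum_density x)" for x
  proof -
    let ?w = "(complex_of_real x)\<^sup>2 / ((gg.quasi_phi ((of_real x)\<^sup>2) R)\<^sup>2 + (of_real x)\<^sup>2 * (gg.phi ((of_real x)\<^sup>2) R)\<^sup>2)"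
    obtain d1 where d1: "d1 \<ge> 0" "gg.momentum_density x = gg.left_coeff x * gg.right_coeff x * complex_of_real d1"
      "?w = complex_of_real d1" by (rule gg.momentum_density_factor[of x]) (rule that; assumption)
    obtain d2 where d2: "d2 \<ge> 0" "hh.momentum_density x = hh.left_coeff x * hh.right_coeff x * complex_of_real d2"
      "?w = complex_of_real d2" by (rule hh.momentum_density_factor[of x]) (rule that; assumption)
    obtain d3 where d3: "d3 \<ge> 0" "gh.momentum_density x = gh.left_coeff x * gh.right_coeff x * complex_of_real d3"
      "?w = complex_of_real d3" by (rule gh.momentum_density_factor[of x]) (rule that; assumption)
    \<comment> \<open>The three factors agree because the quotient does not involve the test functions.\<close>
    have d_eq: "d1 = d3" "d2 = d3" using d1(3) d2(3) d3(3) by simp_all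
    define s where "s = norm (gg.right_coeff x)"
    define t where "t = norm (hh.right_coeff x)"
    have n: "norm (gg.left_coeff x) = s" "norm (hh.left_coeff x) = t"
      unfolding gg.left_coeff_eq_cnj hh.left_coeff_eq_cnj s_def t_def gg.right_coeff_def hh.right_coeff_def by simp_all
    have "norm (gh.momentum_density x) = s * t * d3"
      unfolding d3(2) using d3(1) n by (simp add: norm_mult t_def)
    also have "\<dots> \<le> (s * s + t * t) * d3"
    proof (rule mult_right_mono[OF _ d3(1)])
      have "0 \<le> (s - t)\<^sup>2" "0 \<le> s * t" by (simp_all add: s_def t_def)
      then show "s * t \<le> s * s + t * t" unfolding power2_diff by (simp add: power2_eq_square)
    qed
    also have "\<dots> = norm (gg.momentum_density x) + norm (hh.momentum_density x)"
      unfolding d1(2) d2(2) using d3(1) n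
      by (simp add: norm_mult d_eq s_def[symmetric] t_def[symmetric] distrib_right)
    finally show ?thesis .
  qed
  show "gh.momentum_density absolutely_integrable_on {0..}"
    by (rule gh.expansion_if_dominated(1)[OF fin D le])
  show "gh.pairing = (\<Sum>\<kappa>\<in>gg.bound_states. gh.eig_term \<kappa>) + 2 / pi * integral {0..} gh.momentum_density"
    by (rule gh.expansion_if_dominated(2)[OF fin D le])
qed

section \<open>Finiteness of the bound states and the passage to the energy variable\<close>

context sl_interval
begin

text \<open>
  When \<open>q + \<kappa>\<^sup>2 \<ge> 0\<close>, the product \<open>phi p phi'\<close> is nondecreasing from \<open>0\<close>, which is incompatible with the
  decay condition \<open>quasi_phi(R) = - \<kappa> phi(R)\<close>.
\<close>

lemma jost_nonzero_below_potential:
  assumes q: "\<And>x. x \<in> {0..R} \<Longrightarrow> q x + \<kappa>\<^sup>2 \<ge> 0" and \<kappa>: "\<kappa> > 0"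
  shows "jost (\<i> * complex_of_real \<kappa>) \<noteq> 0"
proof
  assume *: "jost (\<i> * complex_of_real \<kappa>) = 0"
  define \<mu> where "\<mu> = complex_of_real (- \<kappa>\<^sup>2)"
  have mu: "(\<i> * complex_of_real \<kappa>)\<^sup>2 = \<mu>" by (simp add: \<mu>_def power_mult_distrib)
  define a where "a x = Re (phi \<mu> x)" for x
  define b where "b x = Re (quasi_phi \<mu> x)" for x
  have ab: "phi \<mu> x = of_real (a x)" "quasi_phi \<mu> x = of_real (b x)" if "x \<in> {0..R}" for x
    using phi_real[OF that, of "- \<kappa>\<^sup>2", folded \<mu>_def] by (simp_all only: a_def b_def)
  have "((\<lambda>x. phi \<mu> x * quasi_phi \<mu> x) has_vector_derivative
      of_real ((b x)\<^sup>2 / p x + (q x + \<kappa>\<^sup>2) * (a x)\<^sup>2)) (at x within {0..R})" if x: "x \<in> {0..R}" for x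
  proof -
    note d = bspec[OF system_phi[unfolded system_def] x, of \<mu>]
    have "((\<lambda>x. phi \<mu> x * quasi_phi \<mu> x) has_vector_derivative
      phi \<mu> x * ((of_real (q x) - \<mu>) * phi \<mu> x - 0) + quasi_phi \<mu> x / of_real (p x) * quasi_phi \<mu> x) (at x within {0..R})"
      by (intro has_vector_derivative_mult conjunct1[OF d] conjunct2[OF d])
    then show ?thesis
      unfolding ab[OF x] by (simp add: \<mu>_def power2_eq_square algebra_simps)
  qed
  then have I: "((\<lambda>x. of_real ((b x)\<^sup>2 / p x + (q x + \<kappa>\<^sup>2) * (a x)\<^sup>2)) has_integral
      phi \<mu> R * quasi_phi \<mu> R - phi \<mu> 0 * quasi_phi \<mu> 0) {0..R}"
    by (intro fundamental_theorem_of_calculus) (use R_pos in auto)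
  have "((\<lambda>x. (b x)\<^sup>2 / p x + (q x + \<kappa>\<^sup>2) * (a x)\<^sup>2) has_integral a R * b R) {0..R}"
    using has_integral_linear[OF I bounded_linear_Re] ab[OF R_in] by (simp add: o_def)
  then have "a R * b R \<ge> 0"
  proof (rule has_integral_nonneg)
    fix x assume x: "x \<in> {0..R}"
    show "0 \<le> (b x)\<^sup>2 / p x + (q x + \<kappa>\<^sup>2) * (a x)\<^sup>2"
      by (intro add_nonneg_nonneg divide_nonneg_pos mult_nonneg_nonneg zero_le_power2 p_pos[OF x] q[OF x])
  qed
  moreover have "b R = - \<kappa> * a R"
  proof -
    have "quasi_phi \<mu> R + \<kappa> * phi \<mu> R = 0" using * unfolding jost_def mu by (simp add: algebra_simps)
    then have "complex_of_real (b R + \<kappa> * a R) = 0" unfolding ab[OF R_in] by simp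
    then have "b R + \<kappa> * a R = 0" by (simp only: of_real_eq_0_iff)
    then show ?thesis by simp
  qed
  ultimately have "\<kappa> * (a R)\<^sup>2 \<le> 0" by (simp add: power2_eq_square mult_ac)
  then have "a R = 0" "b R = 0"
    using \<kappa> \<open>b R = - \<kappa> * a R\<close> by (auto simp: mult_le_0_iff)
  then show False using phi_no_common_zero[OF R_in, of \<mu>] ab[OF R_in] by simp
qed

text \<open>
  Bound states correspond to zeros of the entire function \<open>jost\<close> on a bounded piece of the imaginary axis.
\<close>

lemma finite_bound_states: "finite bound_states"
proof -
  have "bounded (q ` {0..R})"
    by (intro compact_imp_bounded compact_continuous_image q_cont) auto
  then obtain M where M: "M > 0" "\<And>x. x \<in> {0..R} \<Longrightarrow> \<bar>q x\<bar> \<le> M"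
    unfolding bounded_pos by auto
  have le: "\<kappa> \<le> M + 1" if "\<kappa> \<in> bound_states" for \<kappa>
  proof (rule ccontr)
    assume "\<not> \<kappa> \<le> M + 1"
    then have k: "\<kappa> > M" "\<kappa> > 1" "\<kappa> > 0" using M(1) by auto
    have "\<kappa>\<^sup>2 \<ge> \<kappa>" using k by (simp add: power2_eq_square)
    then have "q x + \<kappa>\<^sup>2 \<ge> 0" if "x \<in> {0..R}" for x using M(2)[OF that] k by linarith
    from jost_nonzero_below_potential[OF this k(3)] that show False by (simp add: bound_states_def)
  qed
  define S where "S = (\<lambda>\<kappa>. \<i> * complex_of_real \<kappa>) ` {0..M+1}"
  have S: "compact S" unfolding S_def
    by (intro compact_continuous_image continuous_intros) auto
  have "finite {z \<in> S. jost z = 0}"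
  proof (cases "jost constant_on UNIV")
    case True
    then have "jost z \<noteq> 0" for z
      using jost_nonzero_real[of 1] unfolding constant_on_def by (metis UNIV_I zero_neq_one)
    then show ?thesis by simp
  next
    case False
    then show ?thesis
      by (intro holomorphic_compact_finite_zeros[OF jost_holomorphic, of UNIV] S) auto
  qed
  moreover have "(\<lambda>\<kappa>. \<i> * complex_of_real \<kappa>) ` bound_states \<subseteq> {z \<in> S. jost z = 0}"
    using le by (auto simp: S_def bound_states_def)
  ultimately have "finite ((\<lambda>\<kappa>. \<i> * complex_of_real \<kappa>) ` bound_states)"
    by (rule rev_finite_subset)
  then show ?thesis by (rule finite_imageD) (simp add: inj_on_def)
qed

end

context sl_pair
begin

lemma momentum_density_continuous: "continuous_on {0<..} momentum_density"
proof -
  have "(quasi_phi ((complex_of_real x)\<^sup>2) R)\<^sup>2 + (of_real x)\<^sup>2 * (phi ((of_real x)\<^sup>2) R)\<^sup>2 \<noteq> 0" if "x > 0" for x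
  proof -
    have "(quasi_phi ((complex_of_real x)\<^sup>2) R)\<^sup>2 + (of_real x)\<^sup>2 * (phi ((of_real x)\<^sup>2) R)\<^sup>2 = jost (of_real x) * jost (- of_real x)"
      by (simp add: jost_def algebra_simps power2_eq_square)
    also have "\<dots> \<noteq> 0" using jost_nonzero_real[of x] jost_nonzero_real[of "-x"] that by simp
    finally show ?thesis .
  qed
  moreover have "continuous_on A (\<lambda>x. f (complex_of_real x))" if "f holomorphic_on UNIV" for f A
    by (rule continuous_on_compose2[OF holomorphic_on_imp_continuous_on[OF that]]) (auto intro!: continuous_intros)
  ultimately show ?thesis
    unfolding momentum_density_def
    using phi_sq_holomorphic[OF R_in, of UNIV] holomorphic_parts(1)[of UNIV]
      integral_phi_holomorphic[OF h_cont, of UNIV]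
    by (intro continuous_intros) (auto simp: right_coeff_def[abs_def] mult.commute)
qed

text \<open>
  The density with respect to \<open>dl / (4 \<pi>)\<close>; the factor comes from \<open>(2 / \<pi>) dk = (1 / (4 \<pi>)) (4 / k) dl\<close>.
\<close>

definition spectral_density :: "real \<Rightarrow> complex" where
  "spectral_density l = 4 * momentum_density (sqrt l) / of_real (sqrt l)"

theorem expansion_in_energy:
  assumes i: "momentum_density absolutely_integrable_on {0..}"
  shows "set_integrable lborel {0<..} spectral_density"
    and "(LBINT l:{0<..}. spectral_density l) = 8 * integral {0..} momentum_density"
proof -
  have i': "momentum_density absolutely_integrable_on {0<..}"
    by (rule set_integrable_subset[OF i]) auto
  have eq: "integral {0<..} momentum_density = integral {0..} momentum_density"
    by (rule integral_spike_set) (auto intro: negligible_subset[of "{0}"])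
  have cv: "\<bar>2 * x\<bar> *\<^sub>R spectral_density (x\<^sup>2) = 8 * momentum_density x" if "x \<in> {0<..}" for x
    using that by (simp add: spectral_density_def scaleR_conv_of_real)
  have img: "(\<lambda>x::real. x\<^sup>2) ` {0<..} = {0<..}"
  proof (intro equalityI subsetI)
    fix y :: real assume "y \<in> {0<..}"
    then show "y \<in> (\<lambda>x. x\<^sup>2) ` {0<..}" by (intro image_eqI[of _ _ "sqrt y"]) auto
  qed auto
  have "(\<lambda>x. \<bar>2 * x\<bar> *\<^sub>R spectral_density (x\<^sup>2)) absolutely_integrable_on {0<..} \<longleftrightarrow>
      (\<lambda>x. 8 * momentum_density x) absolutely_integrable_on {0<..}"
    by (rule set_integrable_cong) (use cv in auto)
  then have 1: "(\<lambda>x. \<bar>2 * x\<bar> *\<^sub>R spectral_density (x\<^sup>2)) absolutely_integrable_on {0<..}"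
    using set_integrable_mult_right[of 8, OF i'] by simp
  have 2: "integral {0<..} (\<lambda>x. \<bar>2 * x\<bar> *\<^sub>R spectral_density (x\<^sup>2)) = 8 * integral {0..} momentum_density"
  proof -
    have "integral {0<..} (\<lambda>x. \<bar>2 * x\<bar> *\<^sub>R spectral_density (x\<^sup>2)) = integral {0<..} (\<lambda>x. 8 * momentum_density x)"
      by (rule integral_cong) (rule cv)
    then show ?thesis unfolding integral_mult_right eq .
  qed
  have "spectral_density absolutely_integrable_on (\<lambda>x. x\<^sup>2) ` {0<..} \<and>
      integral ((\<lambda>x. x\<^sup>2) ` {0<..}) spectral_density = 8 * integral {0..} momentum_density"
  proof (rule has_absolute_integral_change_of_variables_real[THEN iffD1])
    show "inj_on (\<lambda>x::real. x\<^sup>2) {0<..}" by (auto simp: inj_on_def power2_eq_iff)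
    show "((\<lambda>x. x\<^sup>2) has_field_derivative 2 * x) (at x within {0<..})" for x :: real
      by (rule derivative_eq_intros refl | simp)+
  qed (use 1 2 in auto)
  then have 3: "spectral_density absolutely_integrable_on {0<..}"
    "integral {0<..} spectral_density = 8 * integral {0..} momentum_density" unfolding img by auto
  have "continuous_on {0<..} spectral_density"
    unfolding spectral_density_def
    by (intro continuous_intros continuous_on_compose2[OF momentum_density_continuous]) auto
  then have "(\<lambda>l. indicator {0<..} l *\<^sub>R spectral_density l) \<in> borel_measurable borel"
    by (rule borel_measurable_continuous_on_indicator[rotated]) simp
  then show s: "set_integrable lborel {0<..} spectral_density"
    using 3(1) unfolding set_integrable_def by (subst (asm) integrable_completion) auto
  show "(LBINT l:{0<..}. spectral_density l) = 8 * integral {0..} momentum_density"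
    using set_borel_integral_eq_integral(2)[OF s] 3(2) by simp
qed

end

section \<open>Test functions and integrals over the half-line\<close>

lemma smooth_within_imp_continuous_on:
  assumes "smooth_within S f"
  shows "continuous_on S f"
proof -
  obtain d where d: "\<And>x. x \<in> S \<Longrightarrow> d 0 x = f x"
      "\<And>n x. x \<in> S \<Longrightarrow> (d n has_vector_derivative d (Suc n) x) (at x within S)"
    using assms unfolding smooth_within_def by blast
  have "continuous_on S (d (0::nat))"
    by (auto simp: continuous_on_eq_continuous_within intro: has_vector_derivative_continuous d(2))
  then show ?thesis by (rule continuous_on_eq) (rule d(1))
qed

text \<open>
  Compactness of the support inside the open half-line keeps it away from \<open>0\<close>, so all derivatives extend
  by zero to smooth functions on the line.
\<close>

lemma smooth_compact_support_extension:
  fixes g :: "real \<Rightarrow> 'a::real_normed_vector"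
  assumes sm: "smooth_within {0<..} g" and supp: "compact_support_in {0<..} g"
  obtains G :: "nat \<Rightarrow> real \<Rightarrow> 'a" and B where
    "\<And>x. x > 0 \<Longrightarrow> G 0 x = g x"
    "\<And>n x. (G n has_vector_derivative G (Suc n) x) (at x)"
    "\<And>n x. x \<le> 0 \<or> x > B \<Longrightarrow> G n x = 0"
proof -
  obtain d where d: "\<And>x. x \<in> {0<..} \<Longrightarrow> d 0 x = g x"
      "\<And>n x. x \<in> {0<..} \<Longrightarrow> (d n has_vector_derivative d (Suc n) x) (at x within {0<..})"
    using sm unfolding smooth_within_def by blast
  have d': "(d n has_vector_derivative d (Suc n) x) (at x)" if "x > 0" for n x
    using d(2)[of x n] that by (simp add: at_within_open[of _ "{0<..}"])
  define K where "K = top_of_set {0<..} closure_of support_on {0<..} g"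
  have K: "compact K" using supp by (simp add: K_def compact_support_in_def)
  have K_sub: "K \<subseteq> {0<..}"
    unfolding K_def using closure_of_subset_topspace[of "top_of_set {0<..}"] by simp
  have "support_on {0<..} g \<subseteq> K"
    unfolding K_def by (rule closure_of_subset) (auto simp: support_on_def)
  then have out: "g x = 0" if "x > 0" "x \<notin> K" for x
    using that by (auto simp: support_on_def)
  obtain \<epsilon> where \<epsilon>: "\<epsilon> > 0" "\<And>x. x \<in> K \<Longrightarrow> \<epsilon> \<le> x"
  proof (cases "K = {}")
    case True
    then show ?thesis using that[of 1] by simp
  next
    case False
    from compact_attains_inf[OF K this] obtain s where "s \<in> K" "\<forall>t\<in>K. s \<le> t" by blast
    then show ?thesis using that[of s] K_sub by auto
  qed
  obtain B where B: "\<And>x. x \<in> K \<Longrightarrow> norm x \<le> B"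
    using compact_imp_bounded[OF K] unfolding bounded_iff by blast
  define U where "U = {0<..<\<epsilon>} \<union> ({B<..} \<inter> {0<..})"
  have U: "open U" "U \<subseteq> {0<..}" unfolding U_def by (intro open_Un open_Int open_greaterThan open_greaterThanLessThan) auto
  have d0: "d n x = 0" if "x \<in> U" for n x
    using that
  proof (induction n arbitrary: x)
    case 0
    then have "x \<notin> K" using \<epsilon>(2)[of x] B[of x] by (auto simp: U_def)
    with 0 out[of x] d(1)[of x] U show ?case by auto
  next
    case (Suc n)
    have "((\<lambda>_. 0) has_vector_derivative d (Suc n) x) (at x)"
      by (rule has_vector_derivative_transform_within_open[OF d'[of x n] U(1) Suc.prems])
         (use Suc U in auto)
    then show ?case using vector_derivative_unique_at has_vector_derivative_const by blast
  qed
  define G where "G n x = (if x > 0 then d n x else 0)" for n x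
  show ?thesis
  proof (rule that[of G B])
    show "G 0 x = g x" if "x > 0" for x using that d(1)[of x] by (simp add: G_def)
    show "G n x = 0" if "x \<le> 0 \<or> x > B" for n x
      using that d0[of x n] by (auto simp: G_def U_def)
    show "(G n has_vector_derivative G (Suc n) x) (at x)" for n x
    proof (cases "x > 0")
      case True
      show ?thesis
        by (rule has_vector_derivative_transform_within_open[of "d n" _ _ "{0<..}"])
           (use True d' in \<open>auto simp: G_def\<close>)
    next
      case False
      have z: "G m t = 0" if "t \<in> {..<\<epsilon>}" for m t
        using that d0[of t m] by (auto simp: G_def U_def)
      show ?thesis
        by (rule has_vector_derivative_transform_within_open[of "\<lambda>_. 0" _ _ "{..<\<epsilon>}"])
           (use False \<epsilon>(1) z[of x "Suc n"] z[of _ n] in auto)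
    qed
  qed
qed

lemma set_lebesgue_integral_half_line_eq:
  fixes f f' :: "real \<Rightarrow> complex"
  assumes c: "continuous_on {0..R} f'" and R: "R > 0"
    and eq: "\<And>x. x > 0 \<Longrightarrow> x \<le> R \<Longrightarrow> f x = f' x" and out: "\<And>x. x > R \<Longrightarrow> f x = 0"
  shows "(LBINT x:{0<..}. f x) = integral {0..R} f'"
proof -
  have i: "set_integrable lborel {0..R} f'"
    by (rule borel_integrable_atLeastAtMost') (rule c)
  have e: "indicator {0<..} x *\<^sub>R f x = indicator {0<..R} x *\<^sub>R f' x" for x
    using eq[of x] out[of x] by (auto simp: indicator_def)
  have i2: "set_integrable lborel {0<..R} f'"
    by (rule set_integrable_subset[OF i]) auto
  have "(LBINT x:{0<..}. f x) = (LBINT x:{0<..R}. f' x)"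
    unfolding set_lebesgue_integral_def e ..
  also have "\<dots> = integral {0<..R} f'"
    by (rule set_borel_integral_eq_integral(2)[OF i2])
  also have "\<dots> = integral {0..R} f'"
    by (rule integral_spike_set) (auto intro: negligible_subset[of "{0}"])
  finally show ?thesis .
qed

lemma set_integrable_half_line_nonneg:
  fixes f :: "real \<Rightarrow> real"
  assumes c: "continuous_on {0..} f" and pos: "\<And>x. x \<ge> 0 \<Longrightarrow> f x \<ge> 0"
    and I: "(f has_integral I) {0..}"
  shows "set_integrable lborel {0<..} f" "(LBINT x:{0<..}. f x) = I"
proof -
  have "f absolutely_integrable_on {0..}"
    by (rule nonnegative_absolutely_integrable_1) (use I pos in auto)
  then have a: "f absolutely_integrable_on {0<..}"
    by (rule set_integrable_subset) auto
  have "(\<lambda>x. indicator {0<..} x *\<^sub>R f x) \<in> borel_measurable borel"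
    by (rule borel_measurable_continuous_on_indicator[rotated], rule continuous_on_subset[OF c]) auto
  with a show s: "set_integrable lborel {0<..} f"
    unfolding set_integrable_def by (subst (asm) integrable_completion) auto
  have "integral {0<..} f = integral {0..} f"
    by (rule integral_spike_set) (auto intro: negligible_subset[of "{0}"])
  then show "(LBINT x:{0<..}. f x) = I"
    using set_borel_integral_eq_integral(2)[OF s] integral_unique[OF I] by simp
qed

section \<open>The eigenfunctions on the half-line\<close>

locale half_line_problem =
  fixes p q :: "real \<Rightarrow> real" and R0 :: real and F :: "real \<Rightarrow> real \<Rightarrow> real"
  assumes p_cont: "continuous_on {0..} p" and q_cont: "continuous_on {0..} q"
    and p_pos: "\<And>x. x \<ge> 0 \<Longrightarrow> p x > 0" and R0_pos: "R0 > 0"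
    and p_tail: "\<And>x. x \<ge> R0 \<Longrightarrow> p x = 1" and q_tail: "\<And>x. x \<ge> R0 \<Longrightarrow> q x = 0"
    and F_solution: "\<And>l. sl_solution p q l (F l)"
    and F_zero: "\<And>l. F l 0 = 0"
    and F_nonzero: "\<And>l. \<exists>x\<ge>0. F l x \<noteq> 0"
begin

lemma interval: "R > 0 \<Longrightarrow> sl_interval p q R"
  by unfold_locales
     (auto intro: continuous_on_subset[OF p_cont] continuous_on_subset[OF q_cont] p_pos)

definition pF :: "real \<Rightarrow> real \<Rightarrow> real" where
  "pF l t = p t * half_line_deriv (F l) t"

lemma F_deriv:
  assumes "x \<ge> 0"
  shows "(F l has_vector_derivative pF l x / p x) (at x within {0..})"
    and "(pF l has_vector_derivative (q x - l) * F l x) (at x within {0..})"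
proof -
  note s = F_solution[of l, unfolded sl_solution_def]
  have "F l differentiable (at x within {0..})"
    using s assms by (auto simp: differentiable_on_def)
  then have "(F l has_vector_derivative half_line_deriv (F l) x) (at x within {0..})"
    unfolding half_line_deriv_def by (simp add: vector_derivative_works)
  then show "(F l has_vector_derivative pF l x / p x) (at x within {0..})"
    using p_pos[OF assms] by (simp add: pF_def)
  have eq: "(\<lambda>t. p t * half_line_deriv (F l) t) = pF l" by (simp add: fun_eq_iff pF_def)
  have "pF l differentiable (at x within {0..})"
    using s assms unfolding eq by (auto simp: differentiable_on_def)
  then have "(pF l has_vector_derivative half_line_deriv (pF l) x) (at x within {0..})"
    unfolding half_line_deriv_def by (simp add: vector_derivative_works)
  moreover have "half_line_deriv (pF l) x = (q x - l) * F l x"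
    using s assms unfolding sturm_liouville_def eq
    by (auto simp: algebra_simps dest: spec[of _ x])
  ultimately show "(pF l has_vector_derivative (q x - l) * F l x) (at x within {0..})" by simp
qed

lemma F_continuous: "continuous_on {0..} (F l)"
  by (auto simp: continuous_on_eq_continuous_within intro: has_vector_derivative_continuous F_deriv(1))

lemma F_system:
  assumes "R > 0"
  shows "sl_interval.system p q R (of_real l) (\<lambda>_. 0) (\<lambda>x. of_real (F l x)) (\<lambda>x. of_real (pF l x))"
proof -
  interpret I: sl_interval p q R by (rule interval[OF assms])
  show ?thesis
    unfolding I.system_def
  proof (intro ballI conjI)
    fix x assume x: "x \<in> {0..R}"
    have "(F l has_vector_derivative pF l x / p x) (at x within {0..R})"
      by (rule has_vector_derivative_within_subset[OF F_deriv(1)]) (use x in auto)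
    then have "((\<lambda>x. complex_of_real (F l x)) has_vector_derivative of_real (pF l x / p x)) (at x within {0..R})"
      unfolding has_real_derivative_iff_has_vector_derivative[symmetric]
      by (rule has_vector_derivative_of_real)
    then show "((\<lambda>x. complex_of_real (F l x)) has_vector_derivative of_real (pF l x) / of_real (p x)) (at x within {0..R})"
      by simp
    have "(pF l has_vector_derivative (q x - l) * F l x) (at x within {0..R})"
      by (rule has_vector_derivative_within_subset[OF F_deriv(2)]) (use x in auto)
    then have "((\<lambda>x. complex_of_real (pF l x)) has_vector_derivative of_real ((q x - l) * F l x)) (at x within {0..R})"
      unfolding has_real_derivative_iff_has_vector_derivative[symmetric]
      by (rule has_vector_derivative_of_real)
    then show "((\<lambda>x. complex_of_real (pF l x)) has_vector_derivative
       (of_real (q x) - of_real l) * of_real (F l x) - 0) (at x within {0..R})"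
      by simp
  qed
qed

lemma F_eq_phi:
  assumes "R > 0" "x \<in> {0..R}"
  shows "complex_of_real (F l x) = of_real (pF l 0) * sl_interval.phi p q (of_real l) x"
    and "complex_of_real (pF l x) = of_real (pF l 0) * sl_interval.quasi_phi p q (of_real l) x"
proof -
  interpret I: sl_interval p q R by (rule interval[OF assms(1)])
  show "complex_of_real (F l x) = of_real (pF l 0) * I.phi (of_real l) x"
    "complex_of_real (pF l x) = of_real (pF l 0) * I.quasi_phi (of_real l) x"
    using I.system_eq_phi[OF F_system[OF assms(1)] _ assms(2), of l] F_zero[of l] by simp_all
qed

lemma pF_0_nonzero: "pF l 0 \<noteq> 0"
proof
  assume z: "pF l 0 = 0"
  obtain x where x: "x \<ge> 0" "F l x \<noteq> 0" using F_nonzero by blast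
  then show False using F_eq_phi(1)[of "x + 1" x l] z by simp
qed

lemma tail_deriv:
  assumes "R \<ge> R0" "x \<ge> R"
  shows "(F l has_vector_derivative pF l x) (at x within {R..})"
    and "(pF l has_vector_derivative - l * F l x) (at x within {R..})"
proof -
  have x: "x \<ge> 0" "x \<ge> R0" using assms R0_pos by auto
  have sub: "{R..} \<subseteq> {0..}" using assms R0_pos by auto
  show "(F l has_vector_derivative pF l x) (at x within {R..})"
    using has_vector_derivative_within_subset[OF F_deriv(1)[OF x(1)] sub, of l] p_tail[OF x(2)] by simp
  show "(pF l has_vector_derivative - l * F l x) (at x within {R..})"
    using has_vector_derivative_within_subset[OF F_deriv(2)[OF x(1)] sub, of l] q_tail[OF x(2)] by simp
qed

lemma constant_on_tail:
  fixes f :: "real \<Rightarrow> real"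
  assumes "\<And>x. x \<ge> R \<Longrightarrow> (f has_vector_derivative 0) (at x within {R..})" "x \<ge> R"
  shows "f x = f R"
proof -
  obtain c where "\<And>x. x \<in> {R..} \<Longrightarrow> f x = c"
    by (rule has_vector_derivative_zero_constant[of "{R..}" f]) (use assms in auto)
  then show ?thesis using assms(2) by auto
qed

text \<open>
  Beyond \<open>R\<close> the equation is \<open>u'' = - l u\<close>, so \<open>u'\<^sup>2 + l u\<^sup>2\<close> is constant.  It is evaluated at one
  point where the asymptotic formula holds on a neighbourhood, so that the formula may be differentiated.
\<close>

lemma amplitude:
  fixes c :: complex
  assumes l: "l > 0" and R: "R \<ge> R0"
    and as: "\<forall>\<^sub>F x in at_top. complex_of_real (F l x) =
       c * exp (\<i> * complex_of_real (sqrt l * x)) + cnj c * exp (- \<i> * complex_of_real (sqrt l * x))"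
  shows "(pF l R)\<^sup>2 + l * (F l R)\<^sup>2 = 4 * l * (cmod c)\<^sup>2"
proof -
  define k where "k = sqrt l"
  have k: "k > 0" "k\<^sup>2 = l" using l by (simp_all add: k_def)
  define a b where "a = Re c" and "b = Im c"
  have as': "\<forall>\<^sub>F x in at_top. F l x = 2 * (a * cos (k * x) - b * sin (k * x))"
    using as
  proof (rule eventually_mono)
    fix x assume *: "complex_of_real (F l x) =
       c * exp (\<i> * complex_of_real (sqrt l * x)) + cnj c * exp (- \<i> * complex_of_real (sqrt l * x))"
    have e1: "exp (\<i> * complex_of_real (sqrt l * x)) = cis (k * x)" by (simp only: cis_conv_exp k_def)
    have e2: "exp (- \<i> * complex_of_real (sqrt l * x)) = cis (- (k * x))"
      unfolding cis_conv_exp k_def by simp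
    have "F l x = Re (c * cis (k * x) + cnj c * cis (- (k * x)))"
      using arg_cong[OF *, of Re] unfolding e1 e2 by (simp only: Re_complex_of_real)
    then show "F l x = 2 * (a * cos (k * x) - b * sin (k * x))"
      by (simp add: a_def b_def)
  qed
  then obtain X0 where X0: "\<And>x. x \<ge> X0 \<Longrightarrow> F l x = 2 * (a * cos (k * x) - b * sin (k * x))"
    unfolding eventually_at_top_linorder by blast
  define X where "X = max X0 R + 1"
  have X: "X > R" "X > X0" by (auto simp: X_def)
  have "((\<lambda>x. 2 * (a * cos (k * x) - b * sin (k * x))) has_vector_derivative
      2 * (- a * k * sin (k * X) - b * k * cos (k * X))) (at X)"
    unfolding has_real_derivative_iff_has_vector_derivative[symmetric]
    by (auto intro!: derivative_eq_intros)
  then have "(F l has_vector_derivative 2 * (- a * k * sin (k * X) - b * k * cos (k * X))) (at X)"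
    by (rule has_vector_derivative_transform_within_open[of _ _ _ "{X0<..}"]) (use X X0 in auto)
  moreover have "(F l has_vector_derivative pF l X) (at X)"
    using tail_deriv(1)[OF R, of X l] X at_within_interior[of X "{R..}"] by simp
  ultimately have pX: "pF l X = 2 * (- a * k * sin (k * X) - b * k * cos (k * X))"
    by (rule vector_derivative_unique_at[rotated])
  have FX: "F l X = 2 * (a * cos (k * X) - b * sin (k * X))" using X0 X by simp
  have alg: "(2 * (- a * k * S - b * k * C))\<^sup>2 + k\<^sup>2 * (2 * (a * C - b * S))\<^sup>2 =
      4 * k\<^sup>2 * (a\<^sup>2 + b\<^sup>2) * (S\<^sup>2 + C\<^sup>2)" for S C
    by (simp add: algebra_simps power2_eq_square)
  have "((\<lambda>x. (pF l x)\<^sup>2 + l * (F l x)\<^sup>2) has_vector_derivative 0) (at x within {R..})" if x: "x \<ge> R" for x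
  proof -
    note d = tail_deriv[OF R x, of l, folded has_real_derivative_iff_has_vector_derivative]
    show ?thesis
      unfolding has_real_derivative_iff_has_vector_derivative[symmetric]
      by (rule derivative_eq_intros d refl | simp)+
  qed
  from constant_on_tail[OF this, of X] X(1)
  have "(pF l R)\<^sup>2 + l * (F l R)\<^sup>2 = (pF l X)\<^sup>2 + l * (F l X)\<^sup>2" by simp
  also have "\<dots> = 4 * l * (a\<^sup>2 + b\<^sup>2) * ((sin (k * X))\<^sup>2 + (cos (k * X))\<^sup>2)"
    unfolding pX FX unfolding k(2)[symmetric] by (rule alg)
  also have "\<dots> = 4 * l * (cmod c)\<^sup>2" by (simp add: cmod_power2 a_def b_def)
  finally show ?thesis .
qed

text \<open>
  Beyond \<open>R\<close> the functions \<open>(u' + s u) exp (- s (x - R))\<close> with \<open>s = \<kappa>\<close> and \<open>s = - \<kappa>\<close> are constant.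
\<close>

lemma exponential_tail:
  assumes \<kappa>: "\<kappa> > 0" and R: "R \<ge> R0" and x: "x \<ge> R"
  defines "l \<equiv> - \<kappa>\<^sup>2"
  shows "2 * \<kappa> * F l x = (pF l R + \<kappa> * F l R) * exp (\<kappa> * (x - R))
           - (pF l R - \<kappa> * F l R) * exp (- \<kappa> * (x - R))"
proof -
  have "((\<lambda>x. (pF l x + s * F l x) * exp (- s * (x - R))) has_vector_derivative 0) (at x within {R..})"
    if s: "s\<^sup>2 = \<kappa>\<^sup>2" and x: "x \<ge> R" for s x
  proof -
    note d = tail_deriv[OF R x, of l, folded has_real_derivative_iff_has_vector_derivative]
    have "((\<lambda>x. (pF l x + s * F l x) * exp (- s * (x - R))) has_real_derivative
      (- l * F l x + s * pF l x) * exp (- s * (x - R)) +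
      (exp (- s * (x - R)) * (- s)) * (pF l x + s * F l x)) (at x within {R..})"
      by (rule derivative_eq_intros d refl | simp)+
    moreover have "(- l * F l x + s * pF l x) * exp (- s * (x - R)) +
      (exp (- s * (x - R)) * (- s)) * (pF l x + s * F l x) = 0"
      using s by (simp add: l_def algebra_simps power2_eq_square)
    ultimately show ?thesis
      unfolding has_real_derivative_iff_has_vector_derivative by simp
  qed
  from constant_on_tail[OF this x]
  have c: "(pF l x + s * F l x) * exp (- s * (x - R)) = pF l R + s * F l R" if "s\<^sup>2 = \<kappa>\<^sup>2" for s
    using that by simp
  have move: "y = z * exp t" if "y * exp (- t) = z" for y z t :: real
    using that by (auto simp: exp_minus)
  have "pF l x + \<kappa> * F l x = (pF l R + \<kappa> * F l R) * exp (\<kappa> * (x - R))"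
    by (rule move) (use c[of \<kappa>] in simp)
  moreover have "pF l x - \<kappa> * F l x = (pF l R - \<kappa> * F l R) * exp (- \<kappa> * (x - R))"
    by (rule move) (use c[of "- \<kappa>"] in simp)
  ultimately show ?thesis by linarith
qed

text \<open>
  The hypothesis kills the growing exponential, and the square of the remaining one is integrated exactly.
\<close>

lemma bound_state_norm:
  assumes \<kappa>: "\<kappa> > 0" and R: "R \<ge> R0"
  defines "l \<equiv> - \<kappa>\<^sup>2"
  assumes decay: "pF l R + \<kappa> * F l R = 0"
  shows "set_integrable lborel {0<..} (\<lambda>x. (F l x)\<^sup>2)"
    and "(LBINT x:{0<..}. (F l x)\<^sup>2) = integral {0..R} (\<lambda>x. (F l x)\<^sup>2) + (F l R)\<^sup>2 / (2 * \<kappa>)"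
proof -
  have Fx: "F l x = F l R * exp (- \<kappa> * (x - R))" if "x \<ge> R" for x
  proof -
    have pR: "pF l R = - \<kappa> * F l R" using decay by simp
    have "2 * \<kappa> * F l x = (pF l R + \<kappa> * F l R) * exp (\<kappa> * (x - R))
           - (pF l R - \<kappa> * F l R) * exp (- \<kappa> * (x - R))"
      unfolding l_def by (rule exponential_tail[OF \<kappa> R that])
    then have "2 * \<kappa> * F l x = 2 * \<kappa> * (F l R * exp (- \<kappa> * (x - R)))"
      unfolding pR by simp
    then show ?thesis using \<kappa> by simp
  qed
  have c: "continuous_on {0..} (\<lambda>x. (F l x)\<^sup>2)" by (intro continuous_intros F_continuous)
  have i1: "((\<lambda>x. (F l x)\<^sup>2) has_integral integral {0..R} (\<lambda>x. (F l x)\<^sup>2)) {0..R}"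
    by (intro integrable_integral integrable_continuous_real continuous_on_subset[OF c]) auto
  have "((\<lambda>x. (F l R)\<^sup>2 * exp (2 * \<kappa> * R) * exp (- (2 * \<kappa>) * x)) has_integral
      (F l R)\<^sup>2 * exp (2 * \<kappa> * R) * (exp (- (2 * \<kappa>) * R) / (2 * \<kappa>))) {R..}"
    using \<kappa> by (intro has_integral_mult_right has_integral_exp_minus_to_infinity) simp
  also have "(F l R)\<^sup>2 * exp (2 * \<kappa> * R) * (exp (- (2 * \<kappa>) * R) / (2 * \<kappa>)) = (F l R)\<^sup>2 / (2 * \<kappa>)"
    by (simp add: exp_minus field_simps)
  finally have "((\<lambda>x. (F l x)\<^sup>2) has_integral (F l R)\<^sup>2 / (2 * \<kappa>)) {R..}"
  proof (rule has_integral_eq[rotated])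
    fix x assume "x \<in> {R..}"
    then have "(F l x)\<^sup>2 = (F l R)\<^sup>2 * (exp (- \<kappa> * (x - R)))\<^sup>2"
      using Fx[of x] by (simp add: power_mult_distrib)
    also have "(exp (- \<kappa> * (x - R)))\<^sup>2 = exp (2 * \<kappa> * R) * exp (- (2 * \<kappa>) * x)"
      by (simp add: power2_eq_square exp_add[symmetric] algebra_simps)
    finally show "(F l R)\<^sup>2 * exp (2 * \<kappa> * R) * exp (- (2 * \<kappa>) * x) = (F l x)\<^sup>2" by simp
  qed
  with i1 have "((\<lambda>x. (F l x)\<^sup>2) has_integral
      integral {0..R} (\<lambda>x. (F l x)\<^sup>2) + (F l R)\<^sup>2 / (2 * \<kappa>)) ({0..R} \<union> {R..})"
    by (rule has_integral_Un) (auto intro: negligible_subset[of "{R}"])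
  also have "{0..R} \<union> {R..} = {0..}" using R R0_pos by auto
  finally have I: "((\<lambda>x. (F l x)\<^sup>2) has_integral
      integral {0..R} (\<lambda>x. (F l x)\<^sup>2) + (F l R)\<^sup>2 / (2 * \<kappa>)) {0..}" .
  from set_integrable_half_line_nonneg[OF c _ I]
  show "set_integrable lborel {0<..} (\<lambda>x. (F l x)\<^sup>2)"
    and "(LBINT x:{0<..}. (F l x)\<^sup>2) = integral {0..R} (\<lambda>x. (F l x)\<^sup>2) + (F l R)\<^sup>2 / (2 * \<kappa>)"
    by auto
qed

text \<open>
  The growing exponential dominates the other one, so \<open>F\<^sup>2\<close> is eventually at least \<open>1\<close>.
\<close>

lemma not_square_integrable:
  assumes \<kappa>: "\<kappa> > 0" and R: "R \<ge> R0"
  defines "l \<equiv> - \<kappa>\<^sup>2"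
  assumes grow: "pF l R + \<kappa> * F l R \<noteq> 0"
  shows "\<not> square_integrable (F l)"
proof
  assume "square_integrable (F l)"
  then have i: "set_integrable lborel {0<..} (\<lambda>x. (F l x)\<^sup>2)"
    by (simp add: square_integrable_def)
  define a where "a = pF l R + \<kappa> * F l R"
  define b where "b = pF l R - \<kappa> * F l R"
  have "filterlim (\<lambda>x. \<bar>a\<bar> * exp (\<kappa> * (x - R)) - \<bar>b\<bar>) at_top at_top"
  proof -
    have "filterlim (\<lambda>x. A * exp (\<kappa> * (x - R)) - C) at_top at_top" if "A > 0" for A C
      using \<kappa> that by real_asymp
    then show ?thesis using grow by (simp add: a_def)
  qed
  then have "\<forall>\<^sub>F x in at_top. \<bar>a\<bar> * exp (\<kappa> * (x - R)) - \<bar>b\<bar> \<ge> 2 * \<kappa>"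
    unfolding filterlim_at_top by blast
  then obtain X0 where X0: "\<And>x. x \<ge> X0 \<Longrightarrow> \<bar>a\<bar> * exp (\<kappa> * (x - R)) - \<bar>b\<bar> \<ge> 2 * \<kappa>"
    unfolding eventually_at_top_linorder by blast
  define X where "X = max X0 R"
  have big: "(F l x)\<^sup>2 \<ge> 1" if x: "x \<ge> X" for x
  proof -
    have xR: "x \<ge> R" using x by (simp add: X_def)
    have "\<bar>b * exp (- \<kappa> * (x - R))\<bar> \<le> \<bar>b\<bar>"
      using \<kappa> xR by (simp add: abs_mult mult_left_le)
    moreover have "\<bar>a * exp (\<kappa> * (x - R))\<bar> = \<bar>a\<bar> * exp (\<kappa> * (x - R))" by (simp add: abs_mult)
    moreover have "2 * \<kappa> * F l x = a * exp (\<kappa> * (x - R)) - b * exp (- \<kappa> * (x - R))"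
      unfolding a_def b_def l_def by (rule exponential_tail[OF \<kappa> R xR])
    ultimately have "\<bar>2 * \<kappa> * F l x\<bar> \<ge> 2 * \<kappa>"
      using X0[of x] x by (simp add: X_def)
    then have "\<bar>F l x\<bar> \<ge> 1" using \<kappa> by (simp add: abs_mult)
    then show ?thesis using power_mono[of 1 "\<bar>F l x\<bar>" 2] by simp
  qed
  have Xp: "X > 0" using R R0_pos by (auto simp: X_def)
  have "integrable lborel (\<lambda>x. indicator {X..} x :: real)"
  proof (rule Bochner_Integration.integrable_bound[OF i[unfolded set_integrable_def]])
    show "AE x in lborel. norm (indicator {X..} x :: real) \<le> norm (indicator {0<..} x *\<^sub>R (F l x)\<^sup>2)"
      using big Xp by (intro AE_I2) (auto simp: indicator_def)
  qed simp
  then have "emeasure lborel {X..} < \<infinity>"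
    by (subst (asm) integrable_indicator_iff) auto
  moreover have "emeasure lborel {X..} = \<infinity>"
  proof (rule ccontr)
    assume *: "emeasure lborel {X..} \<noteq> \<infinity>"
    have "ennreal (real n) \<le> emeasure lborel {X..}" for n
      using emeasure_mono[of "{X..X + real n}" "{X..}" lborel] by simp
    moreover obtain r where r: "r \<ge> 0" "emeasure lborel {X..} = ennreal r"
      using * by (cases "emeasure lborel {X..}") auto
    ultimately have "real n \<le> r" for n by simp
    then show False using reals_Archimedean2[of r] linorder_not_less by blast
  qed
  ultimately show False by simp
qed

text \<open>
  At \<open>k = i \<kappa>\<close> the Jost function is \<open>phi'(R) + \<kappa> phi(R)\<close>, a nonzero multiple of the coefficient
  of the growing exponential.
\<close>

lemma decay_iff_bound_state:
  assumes \<kappa>: "\<kappa> > 0" and R: "R \<ge> R0"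
  defines "l \<equiv> - \<kappa>\<^sup>2"
  shows "pF l R + \<kappa> * F l R = 0 \<longleftrightarrow> \<kappa> \<in> sl_interval.bound_states p q R"
proof -
  have Rp: "R > 0" using R R0_pos by simp
  interpret I: sl_interval p q R by (rule interval[OF Rp])
  have sq: "(\<i> * complex_of_real \<kappa>)\<^sup>2 = complex_of_real l" by (simp add: l_def power_mult_distrib)
  have "complex_of_real (pF l R + \<kappa> * F l R) = of_real (pF l 0) * I.jost (\<i> * \<kappa>)"
    unfolding I.jost_def sq using F_eq_phi[OF Rp I.R_in, of l] by (simp add: algebra_simps)
  then show ?thesis
    using pF_0_nonzero[of l] \<kappa> unfolding I.bound_states_def
    by (simp only: mem_Collect_eq of_real_eq_0_iff[where 'a=complex, symmetric] mult_eq_0_iff) simp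
qed

theorem square_integrable_iff:
  assumes \<kappa>: "\<kappa> > 0" and R: "R \<ge> R0"
  shows "square_integrable (F (- \<kappa>\<^sup>2)) \<longleftrightarrow> \<kappa> \<in> sl_interval.bound_states p q R"
proof -
  define l where "l = - \<kappa>\<^sup>2"
  have "(\<lambda>x. indicator {0<..} x *\<^sub>R F l x) \<in> borel_measurable borel"
    by (rule borel_measurable_continuous_on_indicator[rotated], rule continuous_on_subset[OF F_continuous]) auto
  then have "square_integrable (F l)" if "pF l R + \<kappa> * F l R = 0"
    using bound_state_norm(1)[OF \<kappa> R] that
    by (simp add: square_integrable_def set_borel_measurable_def l_def)
  then show ?thesis
    using not_square_integrable[OF \<kappa> R] decay_iff_bound_state[OF \<kappa> R] unfolding l_def by blast
qed

end

section \<open>The eigenfunction expansion\<close>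

context half_line_problem
begin

text \<open>
  The values of test functions on \<open>(- \<infinity>, 0]\<close> are arbitrary, so they are replaced by their extensions by
  zero.  One \<open>R\<close> serves both functions, and it lies strictly beyond their supports, which gives the
  boundary conditions at \<open>R\<close>.
\<close>

lemma sl_pair_of_test_functions:
  assumes p_smooth: "smooth_within {0..} p"
    and g: "smooth_within {0<..} g" "compact_support_in {0<..} g"
    and h: "smooth_within {0<..} h" "compact_support_in {0<..} h"
  obtains R g0 h0 Dg Dh qg qh where "R \<ge> R0"
    "\<And>x. x > 0 \<Longrightarrow> g x = g0 x" "\<And>x. x > 0 \<Longrightarrow> h x = h0 x"
    "\<And>x. x > R \<Longrightarrow> g0 x = 0" "\<And>x. x > R \<Longrightarrow> h0 x = 0"
    "sl_pair p q R g0 g0 Dg qg" "sl_pair p q R h0 h0 Dh qh"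
proof -
  obtain dp where dp: "\<And>x. x \<in> {0..} \<Longrightarrow> dp 0 x = p x"
      "\<And>n x. x \<in> {0..} \<Longrightarrow> (dp n has_vector_derivative dp (Suc n) x) (at x within {0..})"
    using p_smooth unfolding smooth_within_def by blast
  have p_deriv: "(p has_vector_derivative dp (Suc 0) x) (at x within {0..})" if "x \<ge> 0" for x
    by (rule has_vector_derivative_transform[OF _ _ dp(2)]) (use that dp(1) in auto)
  have p'_cont: "continuous_on {0..} (dp (Suc 0))"
    by (auto simp: continuous_on_eq_continuous_within intro: has_vector_derivative_continuous dp(2))
  obtain G Bg where G: "\<And>x. x > 0 \<Longrightarrow> G 0 x = g x"
    "\<And>n x. (G n has_vector_derivative G (Suc n) x) (at x)"
    "\<And>n x. x \<le> 0 \<or> x > Bg \<Longrightarrow> G n x = 0"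
    using smooth_compact_support_extension[OF g] by metis
  obtain H Bh where H: "\<And>x. x > 0 \<Longrightarrow> H 0 x = h x"
    "\<And>n x. (H n has_vector_derivative H (Suc n) x) (at x)"
    "\<And>n x. x \<le> 0 \<or> x > Bh \<Longrightarrow> H n x = 0"
    using smooth_compact_support_extension[OF h] by metis
  define R where "R = max R0 (max (Bg + 1) (Bh + 1))"
  have R: "R \<ge> R0" "R > 0" "R > Bg" "R > Bh" using R0_pos by (auto simp: R_def)
  interpret I: sl_interval p q R by (rule interval[OF R(2)])
  have pair: "sl_pair p q R (E 0) (E 0) (\<lambda>x. of_real (q x) * E 0 x - (of_real (p x) * E 2 x + of_real (dp 1 x) * E 1 x))
      (\<lambda>x. of_real (p x) * E 1 x)"
    if E: "\<And>n x. (E n has_vector_derivative E (Suc n) x) (at x)"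
      "\<And>n x. x \<le> 0 \<or> x > B \<Longrightarrow> E n x = 0" and B: "R > B" for E :: "nat \<Rightarrow> real \<Rightarrow> complex" and B
  proof -
    have E_cont: "continuous_on A (E n)" for n A
      by (auto simp: continuous_on_eq_continuous_within
          intro!: has_vector_derivative_continuous has_vector_derivative_at_within[OF E(1)])
    have sub: "{0..R} \<subseteq> {0..}" by auto
    show ?thesis
    proof unfold_locales
      show "continuous_on {0..R} (\<lambda>x. of_real (q x) * E 0 x - (of_real (p x) * E 2 x + of_real (dp 1 x) * E 1 x))"
        using continuous_on_subset[OF p'_cont sub]
        by (intro continuous_intros E_cont I.q_cont I.p_cont) simp
      show "I.system 0 (\<lambda>x. of_real (q x) * E 0 x - (of_real (p x) * E 2 x + of_real (dp 1 x) * E 1 x)) (E 0)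
        (\<lambda>x. of_real (p x) * E 1 x)"
        unfolding I.system_def
      proof (intro ballI conjI)
        fix x assume x: "x \<in> {0..R}"
        have "(E 0 has_vector_derivative E 1 x) (at x within {0..R})"
          using has_vector_derivative_at_within[OF E(1)[of 0 x]] by simp
        then show "(E 0 has_vector_derivative of_real (p x) * E 1 x / of_real (p x)) (at x within {0..R})"
          using I.p_pos[OF x] by simp
        have E1: "(E 1 has_vector_derivative E 2 x) (at x within {0..R})"
          using has_vector_derivative_at_within[OF E(1)[of 1 x]] by (simp add: numeral_2_eq_2)
        have "(p has_vector_derivative dp 1 x) (at x within {0..R})"
          using has_vector_derivative_within_subset[OF p_deriv sub, of x] x by simp
        then have "((\<lambda>x. complex_of_real (p x)) has_vector_derivative of_real (dp 1 x)) (at x within {0..R})"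
          unfolding has_real_derivative_iff_has_vector_derivative[symmetric]
          by (rule has_vector_derivative_of_real)
        from has_vector_derivative_mult[OF this E1]
        show "((\<lambda>x. of_real (p x) * E 1 x) has_vector_derivative
           (of_real (q x) - 0) * E 0 x -
           (of_real (q x) * E 0 x - (of_real (p x) * E 2 x + of_real (dp 1 x) * E 1 x))) (at x within {0..R})"
          by simp
      qed
      show "continuous_on {0..R} (E 0)" by (rule E_cont)
    qed (use E(2) B in auto)
  qed
  show ?thesis
    by (rule that[OF R(1) _ _ _ _ pair[where E=G and B=Bg, OF G(2,3) R(3)] pair[where E=H and B=Bh, OF H(2,3) R(4)]])
       (use G H R in auto)
qed

lemma l2_inner_F_eq:
  assumes R: "R \<ge> R0" and c: "continuous_on {0..R} f0"
    and eq: "\<And>x. x > 0 \<Longrightarrow> f x = f0 x" and out: "\<And>x. x > R \<Longrightarrow> f0 x = 0"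
  shows "l2_inner f (\<lambda>x. complex_of_real (F l x)) =
      of_real (pF l 0) * integral {0..R} (\<lambda>x. cnj (f0 x) * sl_interval.phi p q (of_real l) x)"
    and "l2_inner (\<lambda>x. complex_of_real (F l x)) f =
      of_real (pF l 0) * integral {0..R} (\<lambda>x. sl_interval.phi p q (of_real l) x * f0 x)"
proof -
  have Rp: "R > 0" using R R0_pos by simp
  interpret I: sl_interval p q R by (rule interval[OF Rp])
  have F: "complex_of_real (F l x) = of_real (pF l 0) * I.phi (of_real l) x" if "x \<in> {0..R}" for x
    by (rule F_eq_phi(1)[OF Rp that])
  have "l2_inner f (\<lambda>x. complex_of_real (F l x)) =
      integral {0..R} (\<lambda>x. of_real (pF l 0) * (cnj (f0 x) * I.phi (of_real l) x))"
    unfolding l2_inner_def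
    by (rule set_lebesgue_integral_half_line_eq[OF _ Rp])
       (use c Rp in \<open>auto simp: eq out F intro!: continuous_intros I.phi_continuous\<close>)
  then show "l2_inner f (\<lambda>x. complex_of_real (F l x)) =
      of_real (pF l 0) * integral {0..R} (\<lambda>x. cnj (f0 x) * I.phi (of_real l) x)" by simp
  have "l2_inner (\<lambda>x. complex_of_real (F l x)) f =
      integral {0..R} (\<lambda>x. of_real (pF l 0) * (I.phi (of_real l) x * f0 x))"
    unfolding l2_inner_def complex_cnj_complex_of_real
    by (rule set_lebesgue_integral_half_line_eq[OF _ Rp])
       (use c Rp in \<open>auto simp: eq out F intro!: continuous_intros I.phi_continuous\<close>)
  then show "l2_inner (\<lambda>x. complex_of_real (F l x)) f =
      of_real (pF l 0) * integral {0..R} (\<lambda>x. I.phi (of_real l) x * f0 x)" by simp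
qed

lemma l2_inner_bound_state:
  assumes R: "R \<ge> R0" and \<kappa>: "\<kappa> \<in> sl_interval.bound_states p q R"
  defines "l \<equiv> - \<kappa>\<^sup>2"
  shows "l2_inner (\<lambda>x. complex_of_real (F l x)) (\<lambda>x. complex_of_real (F l x)) =
      (of_real (pF l 0))\<^sup>2 * sl_interval.phi_norm p q R \<kappa>"
proof -
  have Rp: "R > 0" using R R0_pos by simp
  interpret I: sl_interval p q R by (rule interval[OF Rp])
  have F: "complex_of_real (F l x) = of_real (pF l 0) * I.phi (of_real l) x" if "x \<in> {0..R}" for x
    by (rule F_eq_phi(1)[OF Rp that])
  have k: "\<kappa> > 0" using \<kappa> by (simp add: I.bound_states_def)
  have decay: "pF l R + \<kappa> * F l R = 0"
    using decay_iff_bound_state[OF k R] \<kappa> by (simp add: l_def)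
  have c: "continuous_on {0..R} (F l)" by (rule continuous_on_subset[OF F_continuous]) auto
  have "l2_inner (\<lambda>x. complex_of_real (F l x)) (\<lambda>x. complex_of_real (F l x)) =
      (LBINT x:{0<..}. complex_of_real ((F l x)\<^sup>2))"
    unfolding l2_inner_def by (simp add: power2_eq_square)
  also have "\<dots> = of_real (LBINT x:{0<..}. (F l x)\<^sup>2)"
    by (rule set_integral_complex_of_real)
  also have "\<dots> = complex_of_real (integral {0..R} (\<lambda>x. (F l x)\<^sup>2)) +
      (complex_of_real (F l R))\<^sup>2 / (2 * complex_of_real \<kappa>)"
    using bound_state_norm(2)[OF k R] decay by (simp add: l_def)
  also have "complex_of_real (integral {0..R} (\<lambda>x. (F l x)\<^sup>2)) = integral {0..R} (\<lambda>x. complex_of_real ((F l x)\<^sup>2))"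
    by (rule integral_unique[symmetric], rule has_integral_of_real, rule integrable_integral)
       (intro integrable_continuous_real continuous_intros c)
  also have "\<dots> = integral {0..R} (\<lambda>x. (of_real (pF l 0))\<^sup>2 * (I.phi (of_real l) x)\<^sup>2)"
    by (rule integral_cong) (simp only: of_real_power F power_mult_distrib)
  also have "\<dots> = (of_real (pF l 0))\<^sup>2 * integral {0..R} (\<lambda>x. (I.phi (of_real l) x)\<^sup>2)"
    by (rule integral_mult_right)
  finally show ?thesis
    unfolding F[OF I.R_in] I.phi_norm_def[of \<kappa>, folded l_def]
    by (simp add: distrib_left power_mult_distrib)
qed

lemma point_spectrum_eq:
  assumes R: "R \<ge> R0"
  shows "{l. l < 0 \<and> square_integrable (F l)} = (\<lambda>\<kappa>. - \<kappa>\<^sup>2) ` sl_interval.bound_states p q R"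
proof -
  have Rp: "R > 0" using R R0_pos by simp
  interpret I: sl_interval p q R by (rule interval[OF Rp])
  show ?thesis
  proof (intro equalityI subsetI)
    fix l assume l: "l \<in> {l. l < 0 \<and> square_integrable (F l)}"
    define \<kappa> where "\<kappa> = sqrt (- l)"
    have k: "\<kappa> > 0" "l = - \<kappa>\<^sup>2" using l by (simp_all add: \<kappa>_def)
    then show "l \<in> (\<lambda>\<kappa>. - \<kappa>\<^sup>2) ` I.bound_states"
      using l square_integrable_iff[OF k(1) R] by auto
  next
    fix l assume "l \<in> (\<lambda>\<kappa>. - \<kappa>\<^sup>2) ` I.bound_states"
    then obtain \<kappa> where k: "\<kappa> \<in> I.bound_states" "l = - \<kappa>\<^sup>2" by blast
    then have "\<kappa> > 0" by (simp add: I.bound_states_def)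
    then show "l \<in> {l. l < 0 \<and> square_integrable (F l)}"
      using k square_integrable_iff[OF _ R] by simp
  qed
qed

theorem finite_point_spectrum: "finite {l. l < 0 \<and> square_integrable (F l)}"
  unfolding point_spectrum_eq[OF order_refl]
  by (intro finite_imageI sl_interval.finite_bound_states interval R0_pos)

text \<open>
  It remains to pass from \<open>phi\<close> to the given eigenfunctions: the normalization \<open>pF l 0\<close> cancels from every
  summand and, through \<open>amplitude\<close>, from the integrand.
\<close>

theorem eigenfunction_expansion:
  fixes c :: "real \<Rightarrow> complex" and g h :: "real \<Rightarrow> complex"
  assumes p_smooth: "smooth_within {0..} p"
    and c_nonzero: "\<And>l. l > 0 \<Longrightarrow> c l \<noteq> 0"
    and c_asymptotics: "\<And>l. l > 0 \<Longrightarrow> \<forall>\<^sub>F x in at_top.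
          complex_of_real (F l x) =
            c l * exp (\<i> * complex_of_real (sqrt l * x)) +
            cnj (c l) * exp (- \<i> * complex_of_real (sqrt l * x))"
    and g: "smooth_within {0<..} g" "compact_support_in {0<..} g"
    and h: "smooth_within {0<..} h" "compact_support_in {0<..} h"
  defines "Fc \<equiv> \<lambda>l x. complex_of_real (F l x)"
  shows "set_integrable lborel {0<..}
           (\<lambda>l. l2_inner g (Fc l) * l2_inner (Fc l) h / complex_of_real ((cmod (c l))\<^sup>2 * sqrt l))"
    and "l2_inner g h =
           (\<Sum>l | l < 0 \<and> square_integrable (F l).
              l2_inner g (Fc l) * l2_inner (Fc l) h / l2_inner (Fc l) (Fc l)) +
           1 / (4 * complex_of_real pi) *
             (LBINT l:{0<..}. l2_inner g (Fc l) * l2_inner (Fc l) h /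
                complex_of_real ((cmod (c l))\<^sup>2 * sqrt l))"
proof -
  obtain R g0 h0 Dg Dh qg qh where R: "R \<ge> R0"
    and eq: "\<And>x. x > 0 \<Longrightarrow> g x = g0 x" "\<And>x. x > 0 \<Longrightarrow> h x = h0 x"
    and out: "\<And>x. x > R \<Longrightarrow> g0 x = 0" "\<And>x. x > R \<Longrightarrow> h0 x = 0"
    and gg: "sl_pair p q R g0 g0 Dg qg" and hh: "sl_pair p q R h0 h0 Dh qh"
    by (rule sl_pair_of_test_functions[OF p_smooth g h]) (rule that; assumption)
  have Rp: "R > 0" using R R0_pos by simp
  interpret gg: sl_pair p q R g0 g0 Dg qg by (rule gg)
  interpret hh: sl_pair p q R h0 h0 Dh qh by (rule hh)
  interpret gh: sl_pair p q R g0 h0 Dh qh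
    by unfold_locales (rule gg.g_cont hh.Dh_cont hh.system_h hh.h_boundary)+
  note momentum = expansion_in_momentum[OF gg hh gg.finite_bound_states]
  note energy = gh.expansion_in_energy[OF momentum(1)]
  have inner: "l2_inner g (Fc l) = of_real (pF l 0) * gh.left_coeff k"
    "l2_inner (Fc l) h = of_real (pF l 0) * gh.right_coeff k" if "k\<^sup>2 = of_real l" for k l
    unfolding Fc_def gh.left_coeff_def gh.right_coeff_def that
    by (rule l2_inner_F_eq(1)[OF R gg.g_cont eq(1) out(1)] l2_inner_F_eq(2)[OF R hh.g_cont eq(2) out(2)]; assumption)+
  have integrand: "l2_inner g (Fc l) * l2_inner (Fc l) h / complex_of_real ((cmod (c l))\<^sup>2 * sqrt l)
      = gh.spectral_density l" if l: "l > 0" for l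
  proof -
    define k where "k = complex_of_real (sqrt l)"
    define C where "C = complex_of_real (pF l 0)"
    define den where "den = (gg.quasi_phi (of_real l) R)\<^sup>2 + of_real l * (gg.phi (of_real l) R)\<^sup>2"
    define m where "m = complex_of_real ((cmod (c l))\<^sup>2)"
    have k2: "k\<^sup>2 = of_real l" and k0: "k \<noteq> 0"
      unfolding k_def using l by (simp_all only: of_real_power[symmetric] real_sqrt_pow2 less_imp_le) simp
    have C: "C \<noteq> 0" using pF_0_nonzero by (simp add: C_def)
    have m0: "m \<noteq> 0" using c_nonzero[OF l] by (simp add: m_def)
    have l0: "complex_of_real l \<noteq> 0" using l by simp
    have "complex_of_real ((pF l R)\<^sup>2 + l * (F l R)\<^sup>2) = of_real (4 * l * (cmod (c l))\<^sup>2)"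
      by (simp only: amplitude[OF l R c_asymptotics[OF l]])
    \<comment> \<open>This is where the amplitude \<open>c\<close> is traded for the modulus of the Jost function.\<close>
    then have amp: "C\<^sup>2 * den = 4 * of_real l * m"
      using F_eq_phi[OF Rp gg.R_in, of l]
      by (simp add: den_def C_def m_def power_mult_distrib algebra_simps)
    then have den0: "den \<noteq> 0" using l0 m0 by auto
    have "gh.spectral_density l = 4 * (of_real l * gh.left_coeff k * gh.right_coeff k / den) / k"
      unfolding gh.spectral_density_def gh.momentum_density_def k_def[symmetric] k2 den_def ..
    moreover have "l2_inner g (Fc l) * l2_inner (Fc l) h / complex_of_real ((cmod (c l))\<^sup>2 * sqrt l)
        = (C * gh.left_coeff k) * (C * gh.right_coeff k) / (m * k)"
      unfolding inner[OF k2] C_def m_def k_def by simp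
    moreover have "(C * G) * (C * H) / (m * k) = 4 * (of_real l * G * H / den) / k" for G H
    proof -
      have "(C * G) * (C * H) * den = (4 * of_real l * m) * G * H"
        unfolding amp[symmetric] by (simp add: power2_eq_square)
      then show ?thesis using m0 k0 den0 by (simp add: field_simps)
    qed
    ultimately show ?thesis by simp
  qed
  have "set_integrable lborel {0<..}
      (\<lambda>l. l2_inner g (Fc l) * l2_inner (Fc l) h / complex_of_real ((cmod (c l))\<^sup>2 * sqrt l)) \<longleftrightarrow>
     set_integrable lborel {0<..} gh.spectral_density"
    by (rule set_integrable_cong[OF refl refl]) (use integrand in auto)
  then show "set_integrable lborel {0<..}
      (\<lambda>l. l2_inner g (Fc l) * l2_inner (Fc l) h / complex_of_real ((cmod (c l))\<^sup>2 * sqrt l))"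
    using energy(1) by simp
  have lbint: "(LBINT l:{0<..}. l2_inner g (Fc l) * l2_inner (Fc l) h / complex_of_real ((cmod (c l))\<^sup>2 * sqrt l))
      = 8 * integral {0..} gh.momentum_density"
    unfolding energy(2)[symmetric]
    by (rule set_lebesgue_integral_cong) (use integrand in auto)
  have sum: "(\<Sum>l | l < 0 \<and> square_integrable (F l).
        l2_inner g (Fc l) * l2_inner (Fc l) h / l2_inner (Fc l) (Fc l)) = (\<Sum>\<kappa>\<in>gg.bound_states. gh.eig_term \<kappa>)"
    unfolding point_spectrum_eq[OF R]
  proof (subst sum.reindex)
    show "inj_on (\<lambda>\<kappa>. - \<kappa>\<^sup>2) gg.bound_states"
      by (auto simp: inj_on_def gg.bound_states_def power2_eq_iff)
    have "l2_inner g (Fc (- \<kappa>\<^sup>2)) * l2_inner (Fc (- \<kappa>\<^sup>2)) h / l2_inner (Fc (- \<kappa>\<^sup>2)) (Fc (- \<kappa>\<^sup>2)) =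
        gh.eig_term \<kappa>" if \<kappa>: "\<kappa> \<in> gg.bound_states" for \<kappa>
    proof -
      have sq: "(\<i> * complex_of_real \<kappa>)\<^sup>2 = of_real (- \<kappa>\<^sup>2)" by (simp add: power_mult_distrib)
      have n: "l2_inner (Fc (- \<kappa>\<^sup>2)) (Fc (- \<kappa>\<^sup>2)) = (of_real (pF (- \<kappa>\<^sup>2) 0))\<^sup>2 * gg.phi_norm \<kappa>"
        unfolding Fc_def by (rule l2_inner_bound_state[OF R \<kappa>])
      have "(C * G) * (C * H) / (C\<^sup>2 * N) = G * H / N" if "C \<noteq> 0" for C G H N :: complex
        using that by (simp add: power2_eq_square)
      then show ?thesis
        unfolding inner[OF sq] n gh.eig_term_def using pF_0_nonzero by simp
    qed
    then show "sum ((\<lambda>l. l2_inner g (Fc l) * l2_inner (Fc l) h / l2_inner (Fc l) (Fc l)) \<circ> (\<lambda>\<kappa>. - \<kappa>\<^sup>2)) gg.bound_states =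
        (\<Sum>\<kappa>\<in>gg.bound_states. gh.eig_term \<kappa>)"
      by (intro sum.cong) auto
  qed
  have "l2_inner g h = gh.pairing"
    unfolding l2_inner_def gh.pairing_def
    by (rule set_lebesgue_integral_half_line_eq[OF _ Rp])
       (use Rp in \<open>auto simp: eq out intro!: continuous_intros gg.g_cont hh.g_cont\<close>)
  also have "\<dots> = (\<Sum>\<kappa>\<in>gg.bound_states. gh.eig_term \<kappa>) + 2 / pi * integral {0..} gh.momentum_density"
    by (rule momentum(2))
  finally show "l2_inner g h =
           (\<Sum>l | l < 0 \<and> square_integrable (F l).
              l2_inner g (Fc l) * l2_inner (Fc l) h / l2_inner (Fc l) (Fc l)) +
           1 / (4 * complex_of_real pi) *
             (LBINT l:{0<..}. l2_inner g (Fc l) * l2_inner (Fc l) h /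
                complex_of_real ((cmod (c l))\<^sup>2 * sqrt l))"
    unfolding sum lbint by (simp add: field_simps)
qed

end

theorem theorem1p8:
  fixes p q :: "real \<Rightarrow> real"
    and F :: "real \<Rightarrow> real \<Rightarrow> real"
    and c :: "real \<Rightarrow> complex"
  assumes p_smooth: "smooth_within {0..} p"
    and q_smooth: "smooth_within {0..} q"
    and p_pos: "\<And>x. x \<ge> 0 \<Longrightarrow> p x > 0"
    and p_eventually: "\<forall>\<^sub>F x in at_top. p x = 1"
    and q_eventually: "\<forall>\<^sub>F x in at_top. q x = 0"
    and F_solution: "\<And>l. sl_solution p q l (F l)"
    and F_zero: "\<And>l. F l 0 = 0"
    and F_nonzero: "\<And>l. \<exists>x\<ge>0. F l x \<noteq> 0"
    and c_nonzero: "\<And>l. l > 0 \<Longrightarrow> c l \<noteq> 0"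
    and c_asymptotics: "\<And>l. l > 0 \<Longrightarrow> \<forall>\<^sub>F x in at_top.
          complex_of_real (F l x) =
            c l * exp (\<i> * complex_of_real (sqrt l * x)) +
            cnj (c l) * exp (- \<i> * complex_of_real (sqrt l * x))"
  defines "\<Sigma> \<equiv> {l. l < 0 \<and> square_integrable (F l)}"
    and "Fc \<equiv> \<lambda>l x. complex_of_real (F l x)"
  shows "finite \<Sigma> \<and>
    (\<forall>g h :: real \<Rightarrow> complex.
       smooth_within {0<..} g \<and> compact_support_in {0<..} g \<and>
       smooth_within {0<..} h \<and> compact_support_in {0<..} h \<longrightarrow>
         set_integrable lborel {0<..}
           (\<lambda>l. l2_inner g (Fc l) * l2_inner (Fc l) h /
                complex_of_real ((cmod (c l))\<^sup>2 * sqrt l)) \<and>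
         l2_inner g h =
           (\<Sum>l\<in>\<Sigma>. l2_inner g (Fc l) * l2_inner (Fc l) h / l2_inner (Fc l) (Fc l)) +
           1 / (4 * complex_of_real pi) *
             (LBINT l:{0<..}. l2_inner g (Fc l) * l2_inner (Fc l) h /
                complex_of_real ((cmod (c l))\<^sup>2 * sqrt l)))"
proof -
  obtain X where X: "\<And>x. x \<ge> X \<Longrightarrow> p x = 1 \<and> q x = 0"
    using eventually_conj[OF p_eventually q_eventually] unfolding eventually_at_top_linorder by blast
  interpret half_line_problem p q "max X 1" F
    by unfold_locales
       (use X p_pos F_solution F_zero F_nonzero in
         \<open>auto intro: smooth_within_imp_continuous_on p_smooth q_smooth\<close>)
  show ?thesis
    unfolding \<Sigma>_def Fc_def
    using finite_point_spectrum eigenfunction_expansion[OF p_smooth c_nonzero c_asymptotics] by blast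
qed

end
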